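(* Let $\delta>0$, let $(X,d,\mu)$ be an Ahlfors $\delta$-regular metric-measure space and let $\Delta$ be its logarithmic Dirichlet Laplacian on $L^2(X,\mu)$. Then the operator $e^{-t\Delta}$ is compact for every $t>0$.
   Context: A metric-measure space is a triple $(X,d,\mu)$ where $(X,d)$ is a locally compact second-countable metric space and $\mu$ is a finite Borel measure on $X$. It is Ahlfors $\delta$-regular ($\delta>0$) if there is $C\ge 1$ such that $C^{-1}r^\delta\le\mu(\overline B(x,r))\le Cr^\delta$ for all $x\in X$ and $0\le r<\operatorname{diam}X$; then $\operatorname{diam} X<\infty$. $L^2(X,\mu)$ denotes the real Hilbert space of real-valued square-integrable functions. Define $$\operatorname{Dom}\mathcal E=\Big\{f\in L^2(X,\mu):\int_X\int_X\frac{|f(x)-f(y)|^2}{d(x,y)^\delta}\,d\mu(y)\,d\mu(x)<\infty\Big\},$$ $$\mathcal E(f,g)=\frac12\int_X\int_X\frac{(f(x)-f(y))(g(x)-g(y))}{d(x,y)^\delta}\,d\mu(y)\,d\mu(x),\qquad f,g\in\operatorname{Dom}\mathcal E,$$ the integrals being over the complement of the diagonal in $X\times X$. This is a densely defined closed form. The logarithmic Dirichlet Laplacian $\Delta$ is the positive self-adjoint operator associated with $\mathcal E$: if $R:L^2(X,\mu)\to\operatorname{Dom}\mathcal E$ is determined by $\langle Rf,g\rangle_{L^2}+\mathcal E(Rf,g)=\langle f,g\rangle_{L^2}$ for all $g\in\operatorname{Dom}\mathcal E$, then $\operatorname{Dom}\Delta=R(L^2(X,\mu))$ and $\Delta Rf=f-Rf$.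 Thus $R=(1+\Delta)^{-1}$, $\operatorname{Dom}\mathcal E=\operatorname{Dom}\Delta^{1/2}$ and $\mathcal E(f,g)=\langle\Delta^{1/2}f,\Delta^{1/2}g\rangle_{L^2}$. The operators $e^{-t\Delta}$ are defined by functional calculus. *)

theory Defs
  imports "HOL-Analysis.Analysis"
begin

text \<open>
  The metric space is the whole type \<open>'a\<close>. Its extended diameter is used because
  \<^const>\<open>diameter\<close> is unspecified on unbounded sets, and boundedness is a consequence of
  Ahlfors regularity, not an assumption.
\<close>

definition metric_measure_space ::
    "'a::{metric_space, second_countable_topology} measure \<Rightarrow> bool" where
  "metric_measure_space M \<longleftrightarrow>
     locally_compact_space (euclidean :: 'a topology) \<and> sets M = sets borel \<and> finite_measure M"

definition ediameter :: "'a::metric_space set \<Rightarrow> ereal" where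
  "ediameter S = (SUP p\<in>S \<times> S. ereal (dist (fst p) (snd p)))"

definition ahlfors_regular :: "real \<Rightarrow> 'a::metric_space measure \<Rightarrow> bool" where
  "ahlfors_regular \<delta> M \<longleftrightarrow>
     (\<exists>C\<ge>1. \<forall>x r. 0 \<le> r \<and> ereal r < ediameter (UNIV :: 'a set) \<longrightarrow>
        inverse C * r powr \<delta> \<le> measure M (cball x r) \<and> measure M (cball x r) \<le> C * r powr \<delta>)"

text \<open>
  Elements of the real Hilbert space \<open>L\<^sup>2(M)\<close> are represented by square-integrable functions,
  and equality in \<open>L\<^sup>2(M)\<close> is equality almost everywhere. A (possibly unbounded) operator is
  represented by its graph, a set of pairs of square-integrable functions that is closed under
  almost everywhere equality in both components.
\<close>

definition L2 :: "'a measure \<Rightarrow> ('a \<Rightarrow> real) set" where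
  "L2 M = {f \<in> borel_measurable M. integrable M (\<lambda>x. (f x)\<^sup>2)}"

definition L2_inner :: "'a measure \<Rightarrow> ('a \<Rightarrow> real) \<Rightarrow> ('a \<Rightarrow> real) \<Rightarrow> real" where
  "L2_inner M f g = (\<integral>x. f x * g x \<partial>M)"

definition L2_norm :: "'a measure \<Rightarrow> ('a \<Rightarrow> real) \<Rightarrow> real" where
  "L2_norm M f = sqrt (L2_inner M f f)"

type_synonym 'a L2_graph = "(('a \<Rightarrow> real) \<times> ('a \<Rightarrow> real)) set"


definition form_domain :: "real \<Rightarrow> 'a::metric_space measure \<Rightarrow> ('a \<Rightarrow> real) set" where
  "form_domain \<delta> M =
     {f \<in> L2 M. (\<integral>\<^sup>+x. (\<integral>\<^sup>+y\<in>-{x}. ennreal (\<bar>f x - f y\<bar>\<^sup>2 / dist x y powr \<delta>) \<partial>M) \<partial>M) < \<infinity>}"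

definition energy_form ::
    "real \<Rightarrow> 'a::metric_space measure \<Rightarrow> ('a \<Rightarrow> real) \<Rightarrow> ('a \<Rightarrow> real) \<Rightarrow> real" where
  "energy_form \<delta> M f g =
     1/2 * (\<integral>x. (LINT y:-{x}|M. (f x - f y) * (g x - g y) / dist x y powr \<delta>) \<partial>M)"

definition form_resolvent :: "real \<Rightarrow> 'a::metric_space measure \<Rightarrow> 'a L2_graph" where
  "form_resolvent \<delta> M =
     {(f, u). f \<in> L2 M \<and> u \<in> form_domain \<delta> M \<and>
        (\<forall>g\<in>form_domain \<delta> M. L2_inner M u g + energy_form \<delta> M u g = L2_inner M f g)}"

definition log_laplacian :: "real \<Rightarrow> 'a::metric_space measure \<Rightarrow> 'a L2_graph" where
  "log_laplacian \<delta> M =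
     {(u, v). v \<in> L2 M \<and> (\<exists>f. (f, u) \<in> form_resolvent \<delta> M \<and> (AE x in M. v x = f x - u x))}"


definition L2_projection :: "'a measure \<Rightarrow> (('a \<Rightarrow> real) \<Rightarrow> ('a \<Rightarrow> real)) \<Rightarrow> bool" where
  "L2_projection M P \<longleftrightarrow>
     (\<forall>u\<in>L2 M. P u \<in> L2 M) \<and>
     (\<forall>u\<in>L2 M. \<forall>v\<in>L2 M. (AE x in M. u x = v x) \<longrightarrow> (AE x in M. P u x = P v x)) \<and>
     (\<forall>u\<in>L2 M. \<forall>v\<in>L2 M. \<forall>a b.
        AE x in M. P (\<lambda>y. a * u y + b * v y) x = a * P u x + b * P v x) \<and>
     (\<forall>u\<in>L2 M. AE x in M. P (P u) x = P u x) \<and>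
     (\<forall>u\<in>L2 M. \<forall>v\<in>L2 M. L2_inner M (P u) v = L2_inner M u (P v))"

definition projection_valued_measure ::
    "'a measure \<Rightarrow> (real set \<Rightarrow> ('a \<Rightarrow> real) \<Rightarrow> ('a \<Rightarrow> real)) \<Rightarrow> bool" where
  "projection_valued_measure M E \<longleftrightarrow>
     (\<forall>B\<in>sets borel. L2_projection M (E B)) \<and>
     (\<forall>u\<in>L2 M. AE x in M. E UNIV u x = u x) \<and>
     (\<forall>A\<in>sets borel. \<forall>B\<in>sets borel. \<forall>u\<in>L2 M. AE x in M. E (A \<inter> B) u x = E A (E B u) x) \<and>
     (\<forall>B. range B \<subseteq> sets borel \<and> disjoint_family B \<longrightarrow>
        (\<forall>u\<in>L2 M. \<forall>v\<in>L2 M. (\<lambda>n::nat. L2_inner M (E (B n) u) v) sums L2_inner M (E (\<Union>n. B n) u) v))"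

text \<open>The measure \<open>B \<mapsto> \<langle>E(B)u, u\<rangle>\<close>.\<close>

definition spectral_distribution ::
    "'a measure \<Rightarrow> (real set \<Rightarrow> ('a \<Rightarrow> real) \<Rightarrow> ('a \<Rightarrow> real)) \<Rightarrow> ('a \<Rightarrow> real) \<Rightarrow> real measure" where
  "spectral_distribution M E u =
     measure_of UNIV (sets borel) (\<lambda>B. ennreal (L2_inner M (E B u) u))"

definition spectral_domain ::
    "'a measure \<Rightarrow> (real set \<Rightarrow> ('a \<Rightarrow> real) \<Rightarrow> ('a \<Rightarrow> real)) \<Rightarrow> (real \<Rightarrow> real) \<Rightarrow> ('a \<Rightarrow> real) set" where
  "spectral_domain M E \<phi> =
     {u \<in> L2 M. (\<integral>\<^sup>+s. ennreal ((\<phi> s)\<^sup>2) \<partial>spectral_distribution M E u) < \<infinity>}"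

text \<open>
  The operator \<open>\<integral>\<phi> dE\<close> sends \<open>u\<close> in its domain to the \<open>w\<close> with
  \<open>\<langle>w, v\<rangle> = \<integral>\<phi>(s) d\<langle>E(s)u, v\<rangle>\<close>. The signed measure \<open>\<langle>E(\<cdot>)u, v\<rangle>\<close> is written by polarization as
  a difference of two finite positive measures. Taking \<open>v\<close> in the domain makes both integrals
  finite; since the domain is dense, this determines \<open>w\<close> up to null sets.
\<close>

definition spectral_integral ::
    "'a measure \<Rightarrow> (real set \<Rightarrow> ('a \<Rightarrow> real) \<Rightarrow> ('a \<Rightarrow> real)) \<Rightarrow> (real \<Rightarrow> real) \<Rightarrow> 'a L2_graph" where
  "spectral_integral M E \<phi> =
     {(u, w). u \<in> spectral_domain M E \<phi> \<and> w \<in> L2 M \<and>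
        (\<forall>v\<in>spectral_domain M E \<phi>.
           L2_inner M w v =
             1/4 * ((\<integral>s. \<phi> s \<partial>spectral_distribution M E (\<lambda>x. u x + v x))
                  - (\<integral>s. \<phi> s \<partial>spectral_distribution M E (\<lambda>x. u x - v x))))}"

definition spectral_resolution ::
    "'a measure \<Rightarrow> 'a L2_graph \<Rightarrow> (real set \<Rightarrow> ('a \<Rightarrow> real) \<Rightarrow> ('a \<Rightarrow> real)) \<Rightarrow> bool" where
  "spectral_resolution M A E \<longleftrightarrow>
     projection_valued_measure M E \<and> spectral_integral M E (\<lambda>s. s) = A"

text \<open>
  Borel functional calculus \<open>\<phi>(A) = \<integral>\<phi> dE\<close> of a self-adjoint operator \<open>A = \<integral>s dE(s)\<close>. By the
  spectral theorem such an \<open>E\<close> exists and is unique up to almost everywhere equality, so the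
  choice only selects representatives.
\<close>

definition functional_calculus ::
    "'a measure \<Rightarrow> 'a L2_graph \<Rightarrow> (real \<Rightarrow> real) \<Rightarrow> 'a L2_graph" where
  "functional_calculus M A \<phi> = spectral_integral M (SOME E. spectral_resolution M A E) \<phi>"


definition everywhere_defined_operator :: "'a measure \<Rightarrow> 'a L2_graph \<Rightarrow> bool" where
  "everywhere_defined_operator M S \<longleftrightarrow>
     S \<subseteq> L2 M \<times> L2 M \<and>
     (\<forall>u\<in>L2 M. \<exists>w. (u, w) \<in> S) \<and>
     (\<forall>(u, w)\<in>S. \<forall>(u', w')\<in>S. (AE x in M. u x = u' x) \<longrightarrow> (AE x in M. w x = w' x)) \<and>
     (\<forall>(u, w)\<in>S. \<forall>(u', w')\<in>S. \<forall>a b.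
        ((\<lambda>x. a * u x + b * u' x), (\<lambda>x. a * w x + b * w' x)) \<in> S)"

definition compact_operator :: "'a measure \<Rightarrow> 'a L2_graph \<Rightarrow> bool" where
  "compact_operator M S \<longleftrightarrow>
     everywhere_defined_operator M S \<and>
     (\<forall>(u :: nat \<Rightarrow> 'a \<Rightarrow> real) w.
        (\<forall>n. (u n, w n) \<in> S) \<and> (\<exists>K. \<forall>n. L2_norm M (u n) \<le> K) \<longrightarrow>
        (\<exists>(r :: nat \<Rightarrow> nat) h. strict_mono r \<and> h \<in> L2 M \<and>
           (\<lambda>n. L2_norm M (\<lambda>x. w (r n) x - h x)) \<longlonglongrightarrow> 0))"

end

theory Submission
  imports Defs "HOL-Complex_Analysis.Great_Picard"
begin

text \<open>
  The kernel \<open>d(x, y)\<^sup>-\<^sup>\<delta>\<close> is exactly critical for a \<open>\<delta>\<close>-regular measure: in every annulus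
  \<open>r\<^bsub>k+1\<^esub> < d(x, y) \<le> r\<^bsub>k\<^esub>\<close> with geometrically decreasing radii it has mass bounded below, uniformly in
  \<open>x\<close> and \<open>k\<close>, so its mass outside a small ball diverges logarithmically (\<open>annular_mass_unbounded\<close>).
  If \<open>f\<close> is averaged against the kernel restricted to the first \<open>N\<close> annuli, the Cauchy-Schwarz
  inequality bounds the squared \<open>L\<^sup>2\<close> distance of \<open>f\<close> to its average by a multiple of \<open>\<E>(f, f) / N\<close>
  (\<open>annular_average_error\<close>). The averages themselves only see integrals of \<open>f\<close> over Borel sets, and
  a bounded sequence in \<open>L\<^sup>2\<close> has a subsequence along which all of these converge. Hence sets that are
  bounded for \<open>\<parallel>f\<parallel>\<^sup>2 + \<E>(f, f)\<close> are precompact in \<open>L\<^sup>2\<close> (\<open>form_domain_compact_embedding\<close>).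

  Compactness makes the minimum of \<open>\<E>(f, f)\<close> on the unit sphere of the orthogonal complement of
  finitely many functions attained. Iterating, one obtains orthonormal eigenfunctions \<open>e\<^sub>k\<close> of the
  form with eigenvalues \<open>\<lambda>\<^sub>k\<close>; the eigenvalues tend to infinity, again by compactness, and the
  eigenfunctions are complete because bounded Lipschitz functions have finite energy
  (\<open>eigenbasis_exists\<close>). In the coordinates \<open>c\<^sub>k(u) = \<langle>u, e\<^sub>k\<rangle>\<close> the logarithmic Laplacian is
  multiplication by \<open>\<lambda>\<^sub>k\<close> (\<open>log_laplacian_diagonal\<close>).

  The functional calculus refers to an arbitrarily chosen resolution of the identity of the
  Laplacian. One exists, namely the eigenprojections. Conversely, for any resolution the spectral
  distribution of an eigenfunction \<open>e\<^sub>k\<close> is concentrated at \<open>\<lambda>\<^sub>k\<close>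
  (\<open>eigenvector_spectral_distribution\<close>), which determines the resolution. Consequently \<open>\<phi>(\<Delta>)\<close> is
  multiplication by \<open>\<phi>(\<lambda>\<^sub>k)\<close> for every Borel function \<open>\<phi>\<close> (\<open>functional_calculus_diagonal\<close>).
  For \<open>\<phi>(s) = exp (- t s)\<close> with \<open>t > 0\<close> these multipliers tend to \<open>0\<close>, and a diagonal operator
  whose entries tend to \<open>0\<close> is compact (\<open>diagonal_graph_compact\<close>).
\<close>

section \<open>Square-integrable functions on a finite measure space\<close>

lemma L2_mult_integrable:
  assumes "f \<in> L2 M" "g \<in> L2 M"
  shows "integrable M (\<lambda>x. f x * g x)"
proof (rule Bochner_Integration.integrable_bound)
  show "integrable M (\<lambda>x. (f x)\<^sup>2 + (g x)\<^sup>2)"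
    using assms by (auto simp: L2_def)
  show "(\<lambda>x. f x * g x) \<in> borel_measurable M"
    using assms by (auto simp: L2_def)
  have "\<bar>a * b\<bar> \<le> a\<^sup>2 + b\<^sup>2" for a b :: real
    using sum_squares_bound[of "\<bar>a\<bar>" "\<bar>b\<bar>"] mult_nonneg_nonneg[of "\<bar>a\<bar>" "\<bar>b\<bar>"]
    unfolding abs_mult power2_abs by linarith
  then show "AE x in M. norm (f x * g x) \<le> norm ((f x)\<^sup>2 + (g x)\<^sup>2)"
    by auto
qed

lemma L2_measurable: "f \<in> L2 M \<Longrightarrow> f \<in> borel_measurable M"
  by (simp add: L2_def)

lemma L2_lin:
  assumes "f \<in> L2 M" "g \<in> L2 M"
  shows "(\<lambda>x. a * f x + b * g x) \<in> L2 M"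
proof -
  have "integrable M (\<lambda>x. a\<^sup>2 * (f x)\<^sup>2 + b\<^sup>2 * (g x)\<^sup>2 + 2 * a * b * (f x * g x))"
    using assms L2_mult_integrable[OF assms]
    by (intro Bochner_Integration.integrable_add integrable_mult_right) (simp_all add: L2_def)
  also have "(\<lambda>x. a\<^sup>2 * (f x)\<^sup>2 + b\<^sup>2 * (g x)\<^sup>2 + 2 * a * b * (f x * g x)) = (\<lambda>x. (a * f x + b * g x)\<^sup>2)"
    by (simp add: fun_eq_iff power2_eq_square algebra_simps)
  finally show ?thesis
    using assms by (auto simp: L2_def)
qed

lemma L2_add: "f \<in> L2 M \<Longrightarrow> g \<in> L2 M \<Longrightarrow> (\<lambda>x. f x + g x) \<in> L2 M"
  using L2_lin[of f M g 1 1] by simp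

lemma L2_diff: "f \<in> L2 M \<Longrightarrow> g \<in> L2 M \<Longrightarrow> (\<lambda>x. f x - g x) \<in> L2 M"
  using L2_lin[of f M g 1 "-1"] by simp

lemma L2_scale: "f \<in> L2 M \<Longrightarrow> (\<lambda>x. a * f x) \<in> L2 M"
  using L2_lin[of f M f a 0] by simp

lemma L2_zero: "(\<lambda>x. 0) \<in> L2 M"
  by (simp add: L2_def)

lemma L2_sum:
  assumes "\<And>i. i \<in> I \<Longrightarrow> f i \<in> L2 M"
  shows "(\<lambda>x. \<Sum>i\<in>I. a i * f i x) \<in> L2 M"
  using assms
  by (induction I rule: infinite_finite_induct) (auto intro!: L2_zero L2_add L2_scale)

lemma L2_bounded:
  assumes "finite_measure M" "f \<in> borel_measurable M" "\<And>x. \<bar>f x\<bar> \<le> B"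
  shows "f \<in> L2 M"
proof -
  interpret finite_measure M by fact
  have "integrable M (\<lambda>x. (f x)\<^sup>2)"
  proof (rule integrable_const_bound[where B="B\<^sup>2"])
    show "AE x in M. norm ((f x)\<^sup>2) \<le> B\<^sup>2"
      using assms(3) by (auto simp: abs_le_square_iff[symmetric] intro: order_trans[OF _ abs_ge_self])
  qed (use assms in measurable)
  then show ?thesis
    using assms by (simp add: L2_def)
qed

lemma L2_inner_commute: "L2_inner M f g = L2_inner M g f"
  by (simp add: L2_inner_def mult.commute)

lemma L2_inner_lin_left:
  assumes "f \<in> L2 M" "g \<in> L2 M" "h \<in> L2 M"
  shows "L2_inner M (\<lambda>x. a * f x + b * g x) h = a * L2_inner M f h + b * L2_inner M g h"
proof -
  have "L2_inner M (\<lambda>x. a * f x + b * g x) h = (\<integral>x. a * (f x * h x) + b * (g x * h x) \<partial>M)"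
    by (simp add: L2_inner_def algebra_simps)
  also have "\<dots> = a * L2_inner M f h + b * L2_inner M g h"
    using L2_mult_integrable[OF assms(1,3)] L2_mult_integrable[OF assms(2,3)]
    by (simp add: L2_inner_def)
  finally show ?thesis .
qed

lemma L2_inner_lin_right:
  assumes "f \<in> L2 M" "g \<in> L2 M" "h \<in> L2 M"
  shows "L2_inner M h (\<lambda>x. a * f x + b * g x) = a * L2_inner M h f + b * L2_inner M h g"
  using L2_inner_lin_left[OF assms] by (simp add: L2_inner_commute)

lemma L2_inner_add_left:
  assumes "f \<in> L2 M" "g \<in> L2 M" "h \<in> L2 M"
  shows "L2_inner M (\<lambda>x. f x + g x) h = L2_inner M f h + L2_inner M g h"
  using L2_inner_lin_left[OF assms, of 1 1] by simp

lemma L2_inner_diff_left: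
  assumes "f \<in> L2 M" "g \<in> L2 M" "h \<in> L2 M"
  shows "L2_inner M (\<lambda>x. f x - g x) h = L2_inner M f h - L2_inner M g h"
  using L2_inner_lin_left[OF assms, of 1 "-1"] by simp

lemma L2_inner_scale_left: "L2_inner M (\<lambda>x. a * f x) h = a * L2_inner M f h"
  by (simp add: L2_inner_def mult.assoc)

lemma L2_inner_diff_right:
  assumes "f \<in> L2 M" "g \<in> L2 M" "h \<in> L2 M"
  shows "L2_inner M h (\<lambda>x. f x - g x) = L2_inner M h f - L2_inner M h g"
  using L2_inner_lin_right[OF assms, of 1 "-1"] by simp

lemma L2_inner_scale_right: "L2_inner M h (\<lambda>x. a * f x) = a * L2_inner M h f"
  using L2_inner_scale_left[of M a f h] by (simp add: L2_inner_commute)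

lemma L2_inner_zero: "L2_inner M (\<lambda>x. 0) f = 0" "L2_inner M f (\<lambda>x. 0) = 0"
  by (simp_all add: L2_inner_def)

lemma L2_inner_sum_left:
  assumes "\<And>i. i \<in> I \<Longrightarrow> f i \<in> L2 M" "h \<in> L2 M"
  shows "L2_inner M (\<lambda>x. \<Sum>i\<in>I. a i * f i x) h = (\<Sum>i\<in>I. a i * L2_inner M (f i) h)"
  using assms
proof (induction I rule: infinite_finite_induct)
  case (insert i I)
  have "L2_inner M (\<lambda>x. a i * f i x + (\<Sum>i\<in>I. a i * f i x)) h
      = L2_inner M (\<lambda>x. a i * f i x) h + L2_inner M (\<lambda>x. \<Sum>i\<in>I. a i * f i x) h"
    using insert.prems by (intro L2_inner_add_left L2_scale L2_sum) auto
  with insert show ?case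
    by (simp add: L2_inner_scale_left)
qed (simp_all add: L2_inner_zero)

lemma L2_inner_cong_AE:
  assumes "f \<in> L2 M" "f' \<in> L2 M" "g \<in> L2 M" "g' \<in> L2 M"
    and "AE x in M. f x = f' x" "AE x in M. g x = g' x"
  shows "L2_inner M f g = L2_inner M f' g'"
  unfolding L2_inner_def
proof (rule integral_cong_AE)
  show "AE x in M. f x * g x = f' x * g' x"
    using assms(5,6) by eventually_elim simp
qed (use assms in \<open>auto simp: L2_def\<close>)

lemma L2_inner_nonneg: "L2_inner M f f \<ge> 0"
  by (simp add: L2_inner_def)

lemma L2_inner_self_lin:
  assumes "f \<in> L2 M" "g \<in> L2 M"
  shows "L2_inner M (\<lambda>x. a * f x + b * g x) (\<lambda>x. a * f x + b * g x) =
    a\<^sup>2 * L2_inner M f f + 2 * a * b * L2_inner M f g + b\<^sup>2 * L2_inner M g g"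
  using assms
  by (simp add: L2_inner_lin_left L2_inner_lin_right L2_lin L2_inner_commute[of M g f]
      power2_eq_square algebra_simps)

lemma L2_inner_self_diff:
  assumes "f \<in> L2 M" "g \<in> L2 M"
  shows "L2_inner M (\<lambda>x. f x - g x) (\<lambda>x. f x - g x) =
    L2_inner M f f - 2 * L2_inner M f g + L2_inner M g g"
  using L2_inner_self_lin[OF assms, of 1 "-1"] by simp

text \<open>
  Used twice: for the Cauchy-Schwarz inequality, and with \<open>a = 0\<close> as the first-order condition
  at a minimum of a quadratic form.
\<close>

lemma quadratic_nonneg_discriminant:
  fixes a b c :: real
  assumes "\<And>t. a + 2 * b * t + c * t\<^sup>2 \<ge> 0" "c \<ge> 0"
  shows "b\<^sup>2 \<le> a * c"
proof (cases "c = 0")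
  case True
  have "b = 0"
  proof (rule ccontr)
    assume b: "b \<noteq> 0"
    \<comment> \<open>a linear function takes the value \<open>-1\<close> at this point\<close>
    have "a + 2 * b * (- (a + 1) / (2 * b)) + c * (- (a + 1) / (2 * b))\<^sup>2 = -1"
      using b True by (simp add: field_simps)
    with assms(1) show False
      by (metis neg_0_le_iff_le not_one_le_zero)
  qed
  with True show ?thesis by simp
next
  case False
  with assms(2) have c: "c > 0" by simp
  have "a + 2 * b * (- b / c) + c * (- b / c)\<^sup>2 = (a * c - b\<^sup>2) / c"
    using c by (simp add: field_simps power2_eq_square)
  with assms(1)[of "- b / c"] c show ?thesis
    by (simp add: zero_le_divide_iff)
qed

lemma L2_Cauchy_Schwarz:
  assumes "f \<in> L2 M" "g \<in> L2 M"
  shows "(L2_inner M f g)\<^sup>2 \<le> L2_inner M f f * L2_inner M g g"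
proof (rule quadratic_nonneg_discriminant)
  fix t :: real
  show "L2_inner M f f + 2 * L2_inner M f g * t + L2_inner M g g * t\<^sup>2 \<ge> 0"
    using L2_inner_nonneg[of M "\<lambda>x. 1 * f x + t * g x"] L2_inner_self_lin[OF assms, of 1 t]
    by (simp add: algebra_simps)
qed (rule L2_inner_nonneg)

lemma L2_inner_null:
  assumes "f \<in> L2 M" "g \<in> L2 M" "L2_inner M f f = 0"
  shows "L2_inner M f g = 0"
  using L2_Cauchy_Schwarz[OF assms(1,2)] assms(3) by simp

text \<open>
  Squared distances need no square roots, and the factor \<open>2\<close> in their triangle inequality is
  harmless in arguments about convergence.
\<close>

definition L2_sqdist :: "'a measure \<Rightarrow> ('a \<Rightarrow> real) \<Rightarrow> ('a \<Rightarrow> real) \<Rightarrow> real" where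
  "L2_sqdist M f g = L2_inner M (\<lambda>x. f x - g x) (\<lambda>x. f x - g x)"

lemma L2_sqdist_nonneg: "L2_sqdist M f g \<ge> 0"
  by (simp add: L2_sqdist_def L2_inner_nonneg)

lemma L2_sqdist_commute: "L2_sqdist M f g = L2_sqdist M g f"
  by (simp add: L2_sqdist_def L2_inner_def algebra_simps)

lemma L2_sqdist_triangle:
  assumes "f \<in> L2 M" "g \<in> L2 M" "h \<in> L2 M"
  shows "L2_sqdist M f h \<le> 2 * L2_sqdist M f g + 2 * L2_sqdist M g h"
proof -
  have 1: "(\<lambda>x. f x - g x) \<in> L2 M" "(\<lambda>x. g x - h x) \<in> L2 M"
    using assms by (auto intro: L2_diff)
  have 2: "0 \<le> L2_inner M (\<lambda>x. 1 * (f x - g x) + (-1) * (g x - h x)) (\<lambda>x. 1 * (f x - g x) + (-1) * (g x - h x))"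
    by (rule L2_inner_nonneg)
  show ?thesis
    using L2_inner_self_lin[OF 1, of 1 1] 2 L2_inner_self_lin[OF 1, of 1 "-1"]
    by (simp add: L2_sqdist_def)
qed

text \<open>
  Fatou's lemma for the squares. On the space itself it gives completeness of \<open>L\<^sup>2\<close>; on the square
  of the space, applied to difference quotients, it gives lower semicontinuity of the energy.
\<close>

lemma L2_Fatou:
  fixes u :: "nat \<Rightarrow> 'a \<Rightarrow> real"
  assumes u: "\<And>n. u n \<in> L2 M" and v: "v \<in> borel_measurable M"
    and conv: "AE x in M. (\<lambda>n. u n x) \<longlonglongrightarrow> v x"
    and le: "\<And>n. L2_inner M (u n) (u n) \<le> K n" and K: "K \<longlonglongrightarrow> k"
  shows "v \<in> L2 M" "L2_inner M v v \<le> k"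
proof -
  have [measurable]: "u n \<in> borel_measurable M" for n
    using u by (simp add: L2_def)
  note [measurable] = v
  have eq: "(\<integral>\<^sup>+x. ennreal ((u n x)\<^sup>2) \<partial>M) = ennreal (L2_inner M (u n) (u n))" for n
    using u[of n] by (subst nn_integral_eq_integral) (auto simp: L2_def L2_inner_def power2_eq_square)
  have k: "k \<ge> 0"
    using le L2_inner_nonneg[of M] by (intro LIMSEQ_le_const[OF K]) (metis order_trans)
  have "(\<integral>\<^sup>+x. ennreal ((v x)\<^sup>2) \<partial>M) = (\<integral>\<^sup>+x. liminf (\<lambda>n. ennreal ((u n x)\<^sup>2)) \<partial>M)"
  proof (rule nn_integral_cong_AE)
    show "AE x in M. ennreal ((v x)\<^sup>2) = liminf (\<lambda>n. ennreal ((u n x)\<^sup>2))"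
      using conv
    proof eventually_elim
      case (elim x)
      then have "(\<lambda>n. ennreal ((u n x)\<^sup>2)) \<longlonglongrightarrow> ennreal ((v x)\<^sup>2)"
        by (intro tendsto_intros)
      then show ?case
        by (intro lim_imp_Liminf[symmetric]) simp_all
    qed
  qed
  also have "\<dots> \<le> liminf (\<lambda>n. \<integral>\<^sup>+x. ennreal ((u n x)\<^sup>2) \<partial>M)"
    by (rule nn_integral_liminf) measurable
  also have "\<dots> \<le> liminf (\<lambda>n. ennreal (K n))"
    unfolding eq by (intro Liminf_mono always_eventually allI ennreal_leI le)
  also have "\<dots> = ennreal k"
    by (intro lim_imp_Liminf tendsto_ennrealI K) simp
  finally have *: "(\<integral>\<^sup>+x. ennreal ((v x)\<^sup>2) \<partial>M) \<le> ennreal k" .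
  then have "integrable M (\<lambda>x. (v x)\<^sup>2)"
    by (intro integrableI_bounded) (auto simp: top.not_eq_extremum[symmetric] top_unique)
  then show "v \<in> L2 M"
    using v by (simp add: L2_def)
  then have "(\<integral>\<^sup>+x. ennreal ((v x)\<^sup>2) \<partial>M) = ennreal (L2_inner M v v)"
    by (subst nn_integral_eq_integral) (auto simp: L2_def L2_inner_def power2_eq_square)
  with * k show "L2_inner M v v \<le> k"
    by simp
qed

text \<open>
  Convergence of the squares in \<open>L\<^sup>1\<close> provides the almost everywhere convergent subsequence.
\<close>

lemma L2_AE_subseq:
  assumes u: "\<And>n. u n \<in> L2 M" and v: "v \<in> L2 M"
    and conv: "(\<lambda>n. L2_sqdist M (u n) v) \<longlonglongrightarrow> 0"
  obtains r :: "nat \<Rightarrow> nat" where "strict_mono r" "AE x in M. (\<lambda>n. u (r n) x) \<longlonglongrightarrow> v x"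
proof -
  have int: "integrable M (\<lambda>x. (u n x - v x)\<^sup>2)" for n
    using L2_diff[OF u v, of n] by (simp add: L2_def)
  have "(\<lambda>n. \<integral>x. norm ((u n x - v x)\<^sup>2) \<partial>M) \<longlonglongrightarrow> 0"
    using conv by (simp add: L2_sqdist_def L2_inner_def power2_eq_square)
  from tendsto_L1_AE_subseq[OF int this] obtain r where r: "strict_mono r"
    "AE x in M. (\<lambda>n. (u (r n) x - v x)\<^sup>2) \<longlonglongrightarrow> 0" by auto
  have "AE x in M. (\<lambda>n. u (r n) x) \<longlonglongrightarrow> v x"
    using r(2)
  proof eventually_elim
    case (elim x)
    then have "(\<lambda>n. sqrt ((u (r n) x - v x)\<^sup>2)) \<longlonglongrightarrow> sqrt 0"
      by (intro tendsto_intros)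
    then have "(\<lambda>n. u (r n) x - v x) \<longlonglongrightarrow> 0"
      by (simp add: tendsto_rabs_zero_iff)
    then show ?case
      by (simp add: LIM_zero_iff)
  qed
  with r(1) that show thesis by blast
qed

lemma L2_inner_tendsto:
  assumes u: "\<And>n. u n \<in> L2 M" and v: "v \<in> L2 M" and g: "g \<in> L2 M"
    and conv: "(\<lambda>n. L2_sqdist M (u n) v) \<longlonglongrightarrow> 0"
  shows "(\<lambda>n. L2_inner M (u n) g) \<longlonglongrightarrow> L2_inner M v g"
proof -
  have "(\<lambda>n. \<bar>L2_inner M (u n) g - L2_inner M v g\<bar>) \<longlonglongrightarrow> 0"
  proof (rule tendsto_sandwich[OF always_eventually always_eventually tendsto_const])
    show "\<forall>n. \<bar>L2_inner M (u n) g - L2_inner M v g\<bar> \<le> sqrt (L2_sqdist M (u n) v * L2_inner M g g)"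
      using L2_Cauchy_Schwarz[OF L2_diff[OF u v] g]
      by (auto simp: L2_inner_diff_left u v g L2_sqdist_def intro!: real_le_rsqrt)
    have "(\<lambda>n. sqrt (L2_sqdist M (u n) v * L2_inner M g g)) \<longlonglongrightarrow> sqrt (0 * L2_inner M g g)"
      by (intro tendsto_intros conv)
    then show "(\<lambda>n. sqrt (L2_sqdist M (u n) v * L2_inner M g g)) \<longlonglongrightarrow> 0" by simp
  qed auto
  then show ?thesis
    by (simp add: tendsto_rabs_zero_iff LIM_zero_iff)
qed

lemma L2_inner_self_tendsto:
  assumes u: "\<And>n. u n \<in> L2 M" and v: "v \<in> L2 M"
    and conv: "(\<lambda>n. L2_sqdist M (u n) v) \<longlonglongrightarrow> 0"
  shows "(\<lambda>n. L2_inner M (u n) (u n)) \<longlonglongrightarrow> L2_inner M v v"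
proof -
  have "L2_inner M (u n) (u n) = L2_sqdist M (u n) v + 2 * L2_inner M (u n) v - L2_inner M v v" for n
    using L2_inner_self_diff[OF u v, of n] by (simp add: L2_sqdist_def)
  moreover have "(\<lambda>n. L2_sqdist M (u n) v + 2 * L2_inner M (u n) v - L2_inner M v v)
      \<longlonglongrightarrow> 0 + 2 * L2_inner M v v - L2_inner M v v"
    by (intro tendsto_intros conv L2_inner_tendsto u v)
  ultimately show ?thesis by simp
qed

text \<open>
  Along a subsequence with increments of norm at most \<open>2\<^sup>-\<^sup>k\<close> the increments are summable in \<open>L\<^sup>1\<close>,
  because the measure is finite; hence the subsequence converges almost everywhere, and Fatou's
  lemma controls the distance to the limit.
\<close>

lemma (in finite_measure) L2_complete:
  fixes f :: "nat \<Rightarrow> 'a \<Rightarrow> real"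
  assumes f: "\<And>n. f n \<in> L2 M"
    and Cauchy: "\<And>\<epsilon>. \<epsilon> > 0 \<Longrightarrow> \<exists>N. \<forall>m\<ge>N. \<forall>n\<ge>N. L2_sqdist M (f m) (f n) \<le> \<epsilon>"
  obtains h where "h \<in> L2 M" "(\<lambda>n. L2_sqdist M (f n) h) \<longlonglongrightarrow> 0"
proof -
  have [measurable]: "f n \<in> borel_measurable M" for n
    using f by (simp add: L2_def)
  have "\<forall>k. \<exists>N. \<forall>m\<ge>N. \<forall>n\<ge>N. L2_sqdist M (f m) (f n) \<le> ((1/2)^k)\<^sup>2"
    by (intro allI Cauchy) simp
  then obtain N where N: "\<And>k m n. m \<ge> N k \<Longrightarrow> n \<ge> N k \<Longrightarrow> L2_sqdist M (f m) (f n) \<le> ((1/2)^k)\<^sup>2"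
    by metis
  \<comment> \<open>an increasing choice of indices with \<open>r k \<ge> N k\<close>\<close>
  define r where "r k = (\<Sum>j\<le>k. N j) + k" for k
  have rN: "r k \<ge> N k" for k
    by (simp add: r_def trans_le_add1 member_le_sum)
  have r_Suc: "r (Suc k) \<ge> r k" for k
    by (simp add: r_def)
  have r_mono: "r k \<le> r j" if "k \<le> j" for k j
    using r_Suc that by (rule lift_Suc_mono_le)
  have one: "(\<lambda>x. 1) \<in> L2 M"
    by (simp add: L2_def)
  define c where "c = sqrt (measure M (space M))"
  define g where "g k x = f (r (Suc k)) x - f (r k) x" for k x
  have g: "g k \<in> L2 M" for k
    unfolding g_def by (intro L2_diff f)
  have gm[measurable]: "g k \<in> borel_measurable M" for k
    using g by (simp add: L2_def)
  have ga: "(\<lambda>x. \<bar>g k x\<bar>) \<in> L2 M" for k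
    using g[of k] by (auto simp: L2_def)
  have gint: "integrable M (\<lambda>x. \<bar>g k x\<bar>)" for k
    using L2_mult_integrable[OF ga one] by simp
  have gle: "(\<integral>x. \<bar>g k x\<bar> \<partial>M) \<le> (1/2)^k * c" for k
  proof -
    have 1: "L2_inner M (\<lambda>x. \<bar>g k x\<bar>) (\<lambda>x. \<bar>g k x\<bar>) \<le> ((1/2)^k)\<^sup>2"
      using N[of k "r (Suc k)" "r k"] rN[of k] order_trans[OF rN[of k] r_Suc[of k]]
      by (simp add: L2_sqdist_def L2_inner_def g_def)
    have "(\<integral>x. \<bar>g k x\<bar> \<partial>M)\<^sup>2 \<le> L2_inner M (\<lambda>x. \<bar>g k x\<bar>) (\<lambda>x. \<bar>g k x\<bar>) * measure M (space M)"
      using L2_Cauchy_Schwarz[OF ga one] by (simp add: L2_inner_def)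
    also have "\<dots> \<le> ((1/2)^k)\<^sup>2 * measure M (space M)"
      by (intro mult_right_mono 1) simp
    finally have "(\<integral>x. \<bar>g k x\<bar> \<partial>M)\<^sup>2 \<le> ((1/2)^k * c)\<^sup>2"
      by (simp add: power_mult_distrib c_def)
    then show ?thesis
      by (rule power2_le_imp_le) (simp add: c_def)
  qed
  have "(\<integral>\<^sup>+x. (\<Sum>k. ennreal \<bar>g k x\<bar>) \<partial>M) = (\<Sum>k. \<integral>\<^sup>+x. ennreal \<bar>g k x\<bar> \<partial>M)"
    by (rule nn_integral_suminf) measurable
  also have "\<dots> = (\<Sum>k. ennreal (\<integral>x. \<bar>g k x\<bar> \<partial>M))"
    by (subst nn_integral_eq_integral[OF gint]) auto
  also have "\<dots> \<le> (\<Sum>k. ennreal ((1/2)^k * c))"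
    by (intro suminf_le allI ennreal_leI gle) auto
  also have "\<dots> = ennreal (\<Sum>k. (1/2)^k * c)"
    by (intro suminf_ennreal2 summable_mult2 summable_geometric) (auto simp: c_def)
  also have "\<dots> < \<infinity>" by simp
  finally have "(\<integral>\<^sup>+x. (\<Sum>k. ennreal \<bar>g k x\<bar>) \<partial>M) \<noteq> \<infinity>" by simp
  then have AE1: "AE x in M. (\<Sum>k. ennreal \<bar>g k x\<bar>) \<noteq> \<infinity>"
    by (intro nn_integral_noteq_infinite) auto
  define h where "h x = lim (\<lambda>k. f (r k) x)" for x
  have hm[measurable]: "h \<in> borel_measurable M"
    unfolding h_def by measurable
  have AE2: "AE x in M. (\<lambda>k. f (r k) x) \<longlonglongrightarrow> h x"
    using AE1
  proof eventually_elim
    case (elim x)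
    then have "summable (\<lambda>k. \<bar>g k x\<bar>)"
      by (intro summable_suminf_not_top) auto
    then have "summable (\<lambda>k. g k x)"
      by (rule summable_rabs_cancel)
    then have "(\<lambda>n. \<Sum>k<n. g k x) \<longlonglongrightarrow> (\<Sum>k. g k x)"
      by (rule summable_LIMSEQ)
    moreover have "(\<Sum>k<n. g k x) = f (r n) x - f (r 0) x" for n
      unfolding g_def by (induction n) auto
    ultimately have "(\<lambda>n. f (r n) x - f (r 0) x + f (r 0) x) \<longlonglongrightarrow> (\<Sum>k. g k x) + f (r 0) x"
      by (intro tendsto_intros) simp
    then have "convergent (\<lambda>n. f (r n) x)"
      by (auto simp: convergent_def)
    then show ?case
      by (simp add: h_def convergent_LIMSEQ_iff)
  qed
  have key: "(\<lambda>x. f m x - h x) \<in> L2 M \<and> L2_sqdist M (f m) h \<le> ((1/2)^k)\<^sup>2" if "m \<ge> N k" for m k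
  proof -
    have 1: "(\<lambda>x. f m x - f (r (j + k)) x) \<in> L2 M" for j
      by (intro L2_diff f)
    have 2: "AE x in M. (\<lambda>j. f m x - f (r (j + k)) x) \<longlonglongrightarrow> f m x - h x"
      using AE2 by eventually_elim (intro tendsto_intros LIMSEQ_ignore_initial_segment)
    have 3: "L2_inner M (\<lambda>x. f m x - f (r (j + k)) x) (\<lambda>x. f m x - f (r (j + k)) x) \<le> ((1/2)^k)\<^sup>2" for j
      using N[of k m "r (j + k)"] that order_trans[OF rN[of k] r_mono[of k "j + k"]]
      by (simp add: L2_sqdist_def)
    show ?thesis
      unfolding L2_sqdist_def using L2_Fatou[OF 1 _ 2 3 tendsto_const] by simp
  qed
  have "(\<lambda>x. f (N 0) x - (f (N 0) x - h x)) \<in> L2 M"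
    by (rule L2_diff[OF f]) (use key[of 0 "N 0"] in auto)
  then have h: "h \<in> L2 M" by simp
  have "(\<lambda>n. L2_sqdist M (f n) h) \<longlonglongrightarrow> 0"
  proof (rule LIMSEQ_I)
    fix e :: real assume "e > 0"
    then obtain k where k: "(1/4)^k < e"
      using real_arch_pow_inv[of e "1/4"] by auto
    have "\<forall>n\<ge>N k. norm (L2_sqdist M (f n) h - 0) < e"
    proof (intro allI impI)
      fix n assume "n \<ge> N k"
      with key[of k n] have "L2_sqdist M (f n) h \<le> (1/4)^k"
        by (simp add: power_mult[symmetric] power2_eq_square power_mult_distrib[symmetric])
      with k show "norm (L2_sqdist M (f n) h - 0) < e"
        by (simp add: L2_sqdist_nonneg)
    qed
    then show "\<exists>N. \<forall>n\<ge>N. norm (L2_sqdist M (f n) h - 0) < e" by blast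
  qed
  with h that show thesis by blast
qed

text \<open>
  Completeness in the form in which both compactness proofs use it: the sequence is Cauchy because it
  stays uniformly close to convergent ones.
\<close>

lemma (in finite_measure) L2_convergent_of_approx:
  fixes f :: "nat \<Rightarrow> 'a \<Rightarrow> real"
  assumes f: "\<And>n. f n \<in> L2 M"
    and approx: "\<And>\<epsilon>. \<epsilon> > 0 \<Longrightarrow> \<exists>g h. h \<in> L2 M \<and> (\<forall>n. g n \<in> L2 M \<and> L2_sqdist M (f n) (g n) \<le> \<epsilon>) \<and>
        (\<lambda>n. L2_sqdist M (g n) h) \<longlonglongrightarrow> 0"
  obtains h where "h \<in> L2 M" "(\<lambda>n. L2_sqdist M (f n) h) \<longlonglongrightarrow> 0"
proof (rule L2_complete[OF f])
  fix \<epsilon> :: real assume \<epsilon>: "\<epsilon> > 0"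
  then obtain g h where gh: "h \<in> L2 M" "\<And>n. g n \<in> L2 M" "\<And>n. L2_sqdist M (f n) (g n) \<le> \<epsilon> / 16"
      "(\<lambda>n. L2_sqdist M (g n) h) \<longlonglongrightarrow> 0"
    using approx[of "\<epsilon> / 16"] by auto
  have "eventually (\<lambda>n. L2_sqdist M (g n) h < \<epsilon> / 16) sequentially"
    using gh(4) \<epsilon> by (intro order_tendstoD) auto
  then obtain N where N: "\<And>n. n \<ge> N \<Longrightarrow> L2_sqdist M (g n) h < \<epsilon> / 16"
    by (auto simp: eventually_sequentially)
  have fh: "4 * L2_sqdist M (f n) h \<le> \<epsilon>" if "n \<ge> N" for n
    using L2_sqdist_triangle[OF f[of n] gh(2)[of n] gh(1)] gh(3)[of n] N[OF that] by simp
  have "L2_sqdist M (f m) (f n) \<le> \<epsilon>" if "m \<ge> N" "n \<ge> N" for m n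
    using L2_sqdist_triangle[OF f[of m] gh(1) f[of n]] fh[OF that(1)] fh[OF that(2)]
    by (simp add: L2_sqdist_commute)
  then show "\<exists>N. \<forall>m\<ge>N. \<forall>n\<ge>N. L2_sqdist M (f m) (f n) \<le> \<epsilon>"
    by blast
qed (use that in blast)

section \<open>The energy form\<close>

locale ahlfors_regular_space =
  fixes \<delta> :: real and M :: "'a::{metric_space, second_countable_topology} measure"
  assumes \<delta>_pos: "\<delta> > 0"
    and mms: "metric_measure_space M"
    and regular: "ahlfors_regular \<delta> M"
begin

sublocale finite_measure M
  using mms by (simp add: metric_measure_space_def)

lemma sets_M[measurable_cong]: "sets M = sets borel"
  using mms by (simp add: metric_measure_space_def)

lemma space_M[simp]: "space M = UNIV"
  using sets_eq_imp_space_eq[OF sets_M] by simp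

sublocale pair: pair_sigma_finite M M ..

sublocale square: finite_measure "M \<Otimes>\<^sub>M M"
  by (rule finite_measure_pair_measure) unfold_locales

text \<open>
  The energy is half the \<open>L\<^sup>2\<close> inner product of these functions on the square of the space, so
  bilinearity, the Cauchy-Schwarz inequality and Fatou's lemma carry over from \<open>L\<^sup>2\<close>. On the diagonal
  the quotient is \<open>0 / 0 = 0\<close>, which agrees with integrating over the complement of the diagonal.
\<close>

definition diff_quotient :: "('a \<Rightarrow> real) \<Rightarrow> 'a \<times> 'a \<Rightarrow> real" where
  "diff_quotient f = (\<lambda>(x, y). (f x - f y) / dist x y powr (\<delta> / 2))"

lemma diff_quotient_measurable[measurable]:
  assumes [measurable]: "f \<in> borel_measurable M"
  shows "diff_quotient f \<in> borel_measurable (M \<Otimes>\<^sub>M M)"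
proof -
  have [measurable]: "(\<lambda>p. dist (fst p) (snd p)) \<in> borel_measurable (M \<Otimes>\<^sub>M M)"
    by (rule borel_measurable_dist) (simp_all add: measurable_cong_sets[OF refl sets_M[symmetric]])
  show ?thesis
    unfolding diff_quotient_def case_prod_beta by measurable
qed

lemma diff_quotient_mult:
  "diff_quotient f (x, y) * diff_quotient g (x, y) = (f x - f y) * (g x - g y) / dist x y powr \<delta>"
  by (simp add: diff_quotient_def powr_add[symmetric])

lemma diff_quotient_square:
  "(diff_quotient f (x, y))\<^sup>2 = (f x - f y)\<^sup>2 / dist x y powr \<delta>"
  using diff_quotient_mult[of f x y f] by (simp add: power2_eq_square)

lemma diff_quotient_lin:
  "diff_quotient (\<lambda>x. a * f x + b * g x) = (\<lambda>p. a * diff_quotient f p + b * diff_quotient g p)"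
  by (auto simp: diff_quotient_def fun_eq_iff add_divide_distrib[symmetric] algebra_simps)

lemma form_domain_iff: "f \<in> form_domain \<delta> M \<longleftrightarrow> f \<in> L2 M \<and> diff_quotient f \<in> L2 (M \<Otimes>\<^sub>M M)"
proof (cases "f \<in> L2 M")
  case True
  then have [measurable]: "f \<in> borel_measurable M" by (simp add: L2_def)
  have "(\<integral>\<^sup>+x. (\<integral>\<^sup>+y\<in>-{x}. ennreal (\<bar>f x - f y\<bar>\<^sup>2 / dist x y powr \<delta>) \<partial>M) \<partial>M)
      = (\<integral>\<^sup>+x. \<integral>\<^sup>+y. ennreal ((diff_quotient f (x, y))\<^sup>2) \<partial>M \<partial>M)"
    by (intro nn_integral_cong) (auto simp: indicator_def diff_quotient_square)
  also have "\<dots> = (\<integral>\<^sup>+p. ennreal ((diff_quotient f p)\<^sup>2) \<partial>(M \<Otimes>\<^sub>M M))"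
    by (rule nn_integral_fst) measurable
  finally show ?thesis
    using True by (simp add: form_domain_def L2_def integrable_iff_bounded)
qed (simp add: form_domain_def)

lemma energy_form_eq:
  assumes "f \<in> form_domain \<delta> M" "g \<in> form_domain \<delta> M"
  shows "energy_form \<delta> M f g = 1/2 * L2_inner (M \<Otimes>\<^sub>M M) (diff_quotient f) (diff_quotient g)"
proof -
  have int: "integrable (M \<Otimes>\<^sub>M M) (\<lambda>p. diff_quotient f p * diff_quotient g p)"
    using assms by (intro L2_mult_integrable) (auto simp: form_domain_iff)
  have "(\<integral>x. (LINT y:-{x}|M. (f x - f y) * (g x - g y) / dist x y powr \<delta>) \<partial>M)
    = (\<integral>x. (\<integral>y. diff_quotient f (x, y) * diff_quotient g (x, y) \<partial>M) \<partial>M)"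
    unfolding set_lebesgue_integral_def
    by (intro Bochner_Integration.integral_cong refl)
      (auto simp: indicator_def diff_quotient_mult)
  also have "\<dots> = L2_inner (M \<Otimes>\<^sub>M M) (diff_quotient f) (diff_quotient g)"
    unfolding L2_inner_def using pair.integral_fst'[OF int] by simp
  finally show ?thesis
    by (simp add: energy_form_def)
qed

lemma form_domain_L2: "f \<in> form_domain \<delta> M \<Longrightarrow> f \<in> L2 M"
  by (simp add: form_domain_def)

lemma form_domain_lin:
  assumes "f \<in> form_domain \<delta> M" "g \<in> form_domain \<delta> M"
  shows "(\<lambda>x. a * f x + b * g x) \<in> form_domain \<delta> M"
  using assms by (simp add: form_domain_iff L2_lin diff_quotient_lin)

lemma form_domain_scale: "f \<in> form_domain \<delta> M \<Longrightarrow> (\<lambda>x. a * f x) \<in> form_domain \<delta> M"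
  using form_domain_lin[of f f a 0] by simp

lemma form_domain_add:
  "f \<in> form_domain \<delta> M \<Longrightarrow> g \<in> form_domain \<delta> M \<Longrightarrow> (\<lambda>x. f x + g x) \<in> form_domain \<delta> M"
  using form_domain_lin[of f g 1 1] by simp

lemma form_domain_diff:
  "f \<in> form_domain \<delta> M \<Longrightarrow> g \<in> form_domain \<delta> M \<Longrightarrow> (\<lambda>x. f x - g x) \<in> form_domain \<delta> M"
  using form_domain_lin[of f g 1 "-1"] by simp

lemma form_domain_zero: "(\<lambda>x. 0) \<in> form_domain \<delta> M"
proof -
  have "diff_quotient (\<lambda>x. 0) = (\<lambda>p. 0)"
    by (simp add: diff_quotient_def fun_eq_iff)
  then show ?thesis
    by (simp add: form_domain_iff L2_zero)
qed

lemma form_domain_sum: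
  assumes "\<And>i. i \<in> I \<Longrightarrow> f i \<in> form_domain \<delta> M"
  shows "(\<lambda>x. \<Sum>i\<in>I. a i * f i x) \<in> form_domain \<delta> M"
  using assms
  by (induction I rule: infinite_finite_induct)
    (auto intro!: form_domain_zero form_domain_add form_domain_scale)

lemma energy_form_commute: "energy_form \<delta> M f g = energy_form \<delta> M g f"
  by (simp add: energy_form_def mult.commute)

lemma energy_form_nonneg: "f \<in> form_domain \<delta> M \<Longrightarrow> energy_form \<delta> M f f \<ge> 0"
  by (simp add: energy_form_eq L2_inner_nonneg)

lemma energy_form_lin_left:
  assumes "f \<in> form_domain \<delta> M" "g \<in> form_domain \<delta> M" "h \<in> form_domain \<delta> M"
  shows "energy_form \<delta> M (\<lambda>x. a * f x + b * g x) h = a * energy_form \<delta> M f h + b * energy_form \<delta> M g h"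
proof -
  have "diff_quotient f \<in> L2 (M \<Otimes>\<^sub>M M)" "diff_quotient g \<in> L2 (M \<Otimes>\<^sub>M M)" "diff_quotient h \<in> L2 (M \<Otimes>\<^sub>M M)"
    using assms by (simp_all add: form_domain_iff)
  then show ?thesis
    using assms by (simp add: energy_form_eq form_domain_lin diff_quotient_lin L2_inner_lin_left)
qed

lemma energy_form_diff_left:
  assumes "f \<in> form_domain \<delta> M" "g \<in> form_domain \<delta> M" "h \<in> form_domain \<delta> M"
  shows "energy_form \<delta> M (\<lambda>x. f x - g x) h = energy_form \<delta> M f h - energy_form \<delta> M g h"
  using energy_form_lin_left[OF assms, of 1 "-1"] by simp

lemma energy_form_add_left:
  assumes "f \<in> form_domain \<delta> M" "g \<in> form_domain \<delta> M" "h \<in> form_domain \<delta> M"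
  shows "energy_form \<delta> M (\<lambda>x. f x + g x) h = energy_form \<delta> M f h + energy_form \<delta> M g h"
  using energy_form_lin_left[OF assms, of 1 1] by simp

lemma energy_form_zero: "energy_form \<delta> M (\<lambda>x. 0) h = 0"
  by (simp add: energy_form_def set_lebesgue_integral_def)

lemma energy_form_scale_left:
  assumes "f \<in> form_domain \<delta> M" "h \<in> form_domain \<delta> M"
  shows "energy_form \<delta> M (\<lambda>x. a * f x) h = a * energy_form \<delta> M f h"
  using energy_form_lin_left[OF assms(1,1,2), of a 0] by simp

lemma energy_form_sum_left:
  assumes "\<And>i. i \<in> I \<Longrightarrow> f i \<in> form_domain \<delta> M" "h \<in> form_domain \<delta> M"
  shows "energy_form \<delta> M (\<lambda>x. \<Sum>i\<in>I. a i * f i x) h = (\<Sum>i\<in>I. a i * energy_form \<delta> M (f i) h)"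
  using assms
proof (induction I rule: infinite_finite_induct)
  case (insert i I)
  have "energy_form \<delta> M (\<lambda>x. a i * f i x + (\<Sum>i\<in>I. a i * f i x)) h
      = energy_form \<delta> M (\<lambda>x. a i * f i x) h + energy_form \<delta> M (\<lambda>x. \<Sum>i\<in>I. a i * f i x) h"
    using insert.prems by (intro energy_form_add_left form_domain_scale form_domain_sum) auto
  with insert show ?case
    by (simp add: energy_form_scale_left)
qed (simp_all add: energy_form_zero)

lemma energy_form_self_lin:
  assumes "f \<in> form_domain \<delta> M" "g \<in> form_domain \<delta> M"
  shows "energy_form \<delta> M (\<lambda>x. a * f x + b * g x) (\<lambda>x. a * f x + b * g x) =
    a\<^sup>2 * energy_form \<delta> M f f + 2 * a * b * energy_form \<delta> M f g + b\<^sup>2 * energy_form \<delta> M g g"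
proof -
  have "energy_form \<delta> M f (\<lambda>x. a * f x + b * g x) = a * energy_form \<delta> M f f + b * energy_form \<delta> M f g"
    "energy_form \<delta> M g (\<lambda>x. a * f x + b * g x) = a * energy_form \<delta> M f g + b * energy_form \<delta> M g g"
    using energy_form_lin_left[OF assms assms(1)] energy_form_lin_left[OF assms assms(2)]
    by (simp_all add: energy_form_commute)
  then show ?thesis
    using assms by (simp add: energy_form_lin_left form_domain_lin power2_eq_square algebra_simps)
qed

lemma energy_form_Cauchy_Schwarz:
  assumes "f \<in> form_domain \<delta> M" "g \<in> form_domain \<delta> M"
  shows "(energy_form \<delta> M f g)\<^sup>2 \<le> energy_form \<delta> M f f * energy_form \<delta> M g g"
  using L2_Cauchy_Schwarz[of "diff_quotient f" "M \<Otimes>\<^sub>M M" "diff_quotient g"] assms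
  by (simp add: energy_form_eq form_domain_iff power2_eq_square)

lemma AE_pair_both:
  assumes "AE x in M. Q x"
  shows "AE p in M \<Otimes>\<^sub>M M. Q (fst p) \<and> Q (snd p)"
proof -
  obtain N where N: "N \<in> null_sets M" "{x. \<not> Q x} \<subseteq> N"
    using assms by (auto elim!: AE_E simp: null_sets_def)
  have 1: "N \<times> UNIV \<in> null_sets (M \<Otimes>\<^sub>M M)" "UNIV \<times> N \<in> null_sets (M \<Otimes>\<^sub>M M)"
    using N(1) emeasure_pair_measure_Times[of N M UNIV] emeasure_pair_measure_Times[of UNIV M N]
    by (auto simp: null_sets_def sets_M)
  show ?thesis
    by (rule AE_I'[OF null_sets.Un[OF 1]]) (use N(2) in auto)
qed

text \<open>
  A subsequence converges almost everywhere, hence so do the difference quotients, and Fatou's lemma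
  applies on the square. This is the closedness of the form.
\<close>

lemma energy_lower_semicontinuous:
  fixes u :: "nat \<Rightarrow> 'a \<Rightarrow> real"
  assumes u: "\<And>n. u n \<in> form_domain \<delta> M" and v: "v \<in> L2 M"
    and conv: "(\<lambda>n. L2_sqdist M (u n) v) \<longlonglongrightarrow> 0"
    and le: "\<And>n. energy_form \<delta> M (u n) (u n) \<le> K n" and K: "K \<longlonglongrightarrow> k"
  shows "v \<in> form_domain \<delta> M" "energy_form \<delta> M v v \<le> k"
proof -
  obtain r where r: "strict_mono r" "AE x in M. (\<lambda>n. u (r n) x) \<longlonglongrightarrow> v x"
    using L2_AE_subseq[OF _ v conv] u form_domain_L2 by blast
  have 1: "diff_quotient (u (r n)) \<in> L2 (M \<Otimes>\<^sub>M M)" for n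
    using u by (simp add: form_domain_iff)
  have 2: "AE p in M \<Otimes>\<^sub>M M. (\<lambda>n. diff_quotient (u (r n)) p) \<longlonglongrightarrow> diff_quotient v p"
    using AE_pair_both[OF r(2)]
  proof eventually_elim
    case (elim p)
    then show ?case
      unfolding diff_quotient_def case_prod_beta divide_inverse
      by (intro tendsto_mult tendsto_diff tendsto_const) auto
  qed
  have 3: "L2_inner (M \<Otimes>\<^sub>M M) (diff_quotient (u (r n))) (diff_quotient (u (r n))) \<le> 2 * K (r n)" for n
    using le[of "r n"] by (simp add: energy_form_eq u)
  have 4: "(\<lambda>n. 2 * K (r n)) \<longlonglongrightarrow> 2 * k"
    by (intro tendsto_intros LIMSEQ_subseq_LIMSEQ[OF K r(1), unfolded comp_def])
  have 5: "diff_quotient v \<in> borel_measurable (M \<Otimes>\<^sub>M M)"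
    using v by (intro diff_quotient_measurable L2_measurable)
  note * = L2_Fatou[OF 1 5 2 3 4]
  show v': "v \<in> form_domain \<delta> M"
    using *(1) v by (simp add: form_domain_iff)
  show "energy_form \<delta> M v v \<le> k"
    using *(2) by (simp add: energy_form_eq v')
qed

end

section \<open>Compactness of the embedding of the form domain\<close>

lemma convergent_of_uniform_approx:
  fixes s :: "nat \<Rightarrow> real"
  assumes "\<And>\<epsilon>. \<epsilon> > 0 \<Longrightarrow> \<exists>a. convergent a \<and> (\<forall>n. \<bar>s n - a n\<bar> \<le> \<epsilon>)"
  shows "convergent s"
proof -
  have "Cauchy s"
  proof (rule metric_CauchyI)
    fix e :: real assume "e > 0"
    then obtain a where a: "convergent a" "\<And>n. \<bar>s n - a n\<bar> \<le> e / 4"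
      using assms[of "e / 4"] by auto
    then have "Cauchy a" by (simp add: Cauchy_convergent_iff)
    then obtain N where N: "\<And>m n. m \<ge> N \<Longrightarrow> n \<ge> N \<Longrightarrow> dist (a m) (a n) < e / 4"
      using metric_CauchyD[of a "e / 4"] \<open>e > 0\<close> by auto
    show "\<exists>N. \<forall>m\<ge>N. \<forall>n\<ge>N. dist (s m) (s n) < e"
    proof (intro exI allI impI)
      fix m n assume "m \<ge> N" "n \<ge> N"
      then show "dist (s m) (s n) < e"
        using N[of m n] a(2)[of m] a(2)[of n] \<open>e > 0\<close> unfolding dist_real_def by linarith
    qed
  qed
  then show ?thesis by (simp add: Cauchy_convergent_iff)
qed

text \<open>
  The finite intersections of members of a countable base. Countability permits a diagonal argument
  and stability under intersections an induction over all Borel sets.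
\<close>

lemma borel_countable_Int_stable_generator:
  obtains G :: "'a::second_countable_topology set set"
  where "countable G" "Int_stable G" "sets borel = sigma_sets UNIV G" "UNIV \<in> G"
proof -
  obtain B :: "'a set set" where B: "countable B" "topological_basis B"
    using ex_countable_basis by blast
  define G where "G = Inter ` {F. finite F \<and> F \<subseteq> B}"
  have "countable G"
    unfolding G_def by (intro countable_image countable_Collect_finite_subset B(1))
  moreover have "Int_stable G"
  proof (rule Int_stableI)
    fix a b assume "a \<in> G" "b \<in> G"
    then obtain F H where "finite F" "F \<subseteq> B" "a = \<Inter>F" "finite H" "H \<subseteq> B" "b = \<Inter>H"
      by (auto simp: G_def)
    then show "a \<inter> b \<in> G"
      by (auto simp: G_def image_iff intro!: exI[of _ "F \<union> H"])
  qed
  moreover have "sets borel = sigma_sets UNIV G"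
  proof
    have "B \<subseteq> G"
      unfolding G_def by (auto intro!: image_eqI[of _ _ "{b}" for b])
    then have "sigma_sets UNIV B \<subseteq> sigma_sets UNIV G"
      by (intro sigma_sets_mono) auto
    then show "sets borel \<subseteq> sigma_sets UNIV G"
      by (simp add: borel_eq_countable_basis[OF B])
    have "open a" if "a \<in> G" for a
      using that by (auto simp: G_def intro!: open_Inter intro: topological_basis_open[OF B(2)])
    then have "G \<subseteq> sets borel" by auto
    then show "sigma_sets UNIV G \<subseteq> sets borel"
      using sets.sigma_sets_subset[of G borel] by simp
  qed
  moreover have "UNIV \<in> G"
    unfolding G_def by (auto intro!: image_eqI[of _ _ "{}"])
  ultimately show thesis by (rule that)
qed

lemma (in finite_measure) L2_dominated:
  fixes g :: "nat \<Rightarrow> 'a \<Rightarrow> real"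
  assumes [measurable]: "\<And>n. g n \<in> borel_measurable M"
    and bound: "\<And>n x. \<bar>g n x\<bar> \<le> B" and conv: "\<And>x. (\<lambda>n. g n x) \<longlonglongrightarrow> h x"
  shows "h \<in> L2 M" "\<And>n. g n \<in> L2 M" "(\<lambda>n. L2_sqdist M (g n) h) \<longlonglongrightarrow> 0"
proof -
  have [measurable]: "h \<in> borel_measurable M"
    by (rule borel_measurable_LIMSEQ_real[OF conv]) measurable
  have hB: "\<bar>h x\<bar> \<le> B" for x
    by (rule LIMSEQ_le_const2[OF tendsto_rabs[OF conv[of x]]]) (use bound in auto)
  show "h \<in> L2 M" "g n \<in> L2 M" for n
    by (rule L2_bounded[OF finite_measure_axioms _ hB], measurable)
       (rule L2_bounded[OF finite_measure_axioms _ bound], measurable)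
  have "(\<lambda>n. \<integral>x. (g n x - h x)\<^sup>2 \<partial>M) \<longlonglongrightarrow> (\<integral>x. 0 \<partial>M)"
  proof (rule integral_dominated_convergence[where w = "\<lambda>x. (2 * B)\<^sup>2"])
    show "AE x in M. (\<lambda>n. (g n x - h x)\<^sup>2) \<longlonglongrightarrow> 0"
    proof (rule AE_I2)
      fix x
      have "(\<lambda>n. (g n x - h x)\<^sup>2) \<longlonglongrightarrow> (h x - h x)\<^sup>2"
        by (intro tendsto_power tendsto_diff conv tendsto_const)
      then show "(\<lambda>n. (g n x - h x)\<^sup>2) \<longlonglongrightarrow> 0" by simp
    qed
    show "AE x in M. norm ((g n x - h x)\<^sup>2) \<le> (2 * B)\<^sup>2" for n
    proof (rule AE_I2)
      fix x
      have "\<bar>g n x - h x\<bar> \<le> \<bar>2 * B\<bar>"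
        using bound[of n x] hB[of x] by linarith
      then show "norm ((g n x - h x)\<^sup>2) \<le> (2 * B)\<^sup>2"
        by (simp add: abs_le_square_iff)
    qed
  qed simp_all
  then show "(\<lambda>n. L2_sqdist M (g n) h) \<longlonglongrightarrow> 0"
    by (simp add: L2_sqdist_def L2_inner_def power2_eq_square)
qed

context ahlfors_regular_space
begin

lemma indicator_L2: "B \<in> sets borel \<Longrightarrow> (indicator B :: 'a \<Rightarrow> real) \<in> L2 M"
  by (rule L2_bounded[where B = 1]) (unfold_locales, auto simp: sets_M indicator_def)

lemma indicator_inner_bound:
  assumes "f \<in> L2 M" "L2_inner M f f \<le> K" "B \<in> sets borel"
  shows "\<bar>L2_inner M (indicator B) f\<bar> \<le> sqrt (measure M B * K)"
proof -
  have "(L2_inner M (indicator B) f)\<^sup>2 \<le> L2_inner M (indicator B) (indicator B) * L2_inner M f f"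
    using assms by (intro L2_Cauchy_Schwarz indicator_L2)
  also have "L2_inner M (indicator B) (indicator B) = measure M B"
    using assms(3) by (simp add: L2_inner_def indicator_inter_arith[symmetric] sets_M)
  also have "measure M B * L2_inner M f f \<le> measure M B * K"
    by (intro mult_left_mono assms) simp
  finally show ?thesis
    by (intro real_le_rsqrt) simp
qed

text \<open>
  This replaces weak sequential compactness of balls in \<open>L\<^sup>2\<close>. A diagonal argument yields convergence on a
  countable generator. The sets for which it holds are closed under complements and disjoint
  unions: by the Cauchy-Schwarz inequality, small sets have uniformly small integrals, so the tail of a
  disjoint union can be cut off.
\<close>

lemma subseq_set_integrals_convergent:
  fixes f :: "nat \<Rightarrow> 'a \<Rightarrow> real"
  assumes f: "\<And>n. f n \<in> L2 M" and K: "\<And>n. L2_inner M (f n) (f n) \<le> K"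
  obtains r :: "nat \<Rightarrow> nat" where "strict_mono r"
    "\<And>B. B \<in> sets borel \<Longrightarrow> convergent (\<lambda>n. L2_inner M (indicator B) (f (r n)))"
proof -
  obtain G :: "'a set set" where G: "countable G" "Int_stable G" "sets borel = sigma_sets UNIV G" "UNIV \<in> G"
    by (rule borel_countable_Int_stable_generator)
  have GB: "B \<in> sets borel" if "B \<in> G" for B
    using that G(3) by auto
  have K0: "K \<ge> 0"
    using K[of 0] L2_inner_nonneg[of M "f 0"] by linarith
  have bd: "norm (L2_inner M (indicator B) (f n)) \<le> sqrt (measure M UNIV * K)" if "B \<in> G" for B n
  proof -
    have "\<bar>L2_inner M (indicator B) (f n)\<bar> \<le> sqrt (measure M B * K)"
      by (rule indicator_inner_bound[OF f K GB[OF that]])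
    also have "\<dots> \<le> sqrt (measure M UNIV * K)"
      using K0 bounded_measure[of B] by (intro real_sqrt_le_mono mult_right_mono) auto
    finally show ?thesis by simp
  qed
  obtain r where r: "strict_mono r"
      "\<And>B. B \<in> G \<Longrightarrow> \<exists>l. (\<lambda>n. L2_inner M (indicator B) (f (r n))) \<longlonglongrightarrow> l"
    using function_convergent_subsequence[OF G(1), of "\<lambda>n B. L2_inner M (indicator B) (f n)", OF bd]
    by metis
  have "convergent (\<lambda>n. L2_inner M (indicator B) (f (r n)))" if B: "B \<in> sets borel" for B
  proof -
    have "B \<in> sigma_sets UNIV G"
      using B by (simp add: G(3))
    from G(2) subset_UNIV[of G, folded Pow_UNIV] this show ?thesis
    proof (induction rule: sigma_sets_induct_disjoint)
      case (basic A)
      then show ?case using r(2) by (auto simp: convergent_def)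
    next
      case empty
      then show ?case by (simp add: L2_inner_def convergent_const)
    next
      case (compl A)
      have A: "A \<in> sets borel" using compl by (simp add: G(3))
      have ind: "(indicator (UNIV - A) :: 'a \<Rightarrow> real) = (\<lambda>x. indicator UNIV x - indicator A x)"
        by (auto simp: indicator_def fun_eq_iff)
      have "L2_inner M (indicator (UNIV - A)) (f (r n)) =
          L2_inner M (indicator UNIV) (f (r n)) - L2_inner M (indicator A) (f (r n))" for n
        unfolding ind by (rule L2_inner_diff_left[OF indicator_L2 indicator_L2 f]) (simp_all add: A)
      moreover have "convergent (\<lambda>n. L2_inner M (indicator UNIV) (f (r n)))"
        using r(2)[OF G(4)] by (auto simp: convergent_def)
      ultimately show ?case
        using convergent_diff[OF _ compl(2)] by auto
    next
      case (union A)
      have A: "A i \<in> sets borel" for i using union by (auto simp: G(3))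
      have U: "(\<Union>i. A i) \<in> sets borel" using A by auto
      show ?case
      proof (rule convergent_of_uniform_approx)
        fix \<epsilon> :: real assume \<epsilon>: "\<epsilon> > 0"
        define R where "R N = (\<Union>i. A i) - (\<Union>i<N. A i)" for N
        have R: "R N \<in> sets borel" for N
          unfolding R_def using A by auto
        have mR: "measure M (R N) = measure M (\<Union>i. A i) - (\<Sum>i<N. measure M (A i))" for N
        proof -
          have "measure M (R N) = measure M (\<Union>i. A i) - measure M (\<Union>i<N. A i)"
            unfolding R_def using A U by (intro finite_measure_Diff) (auto simp: sets_M)
          also have "measure M (\<Union>i<N. A i) = (\<Sum>i<N. measure M (A i))"
            using A union(1) by (intro finite_measure_finite_Union)
              (auto simp: sets_M disjoint_family_on_def)
          finally show ?thesis .
        qed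
        have "(\<lambda>i. measure M (A i)) sums measure M (\<Union>i. A i)"
          using A union(1) by (intro finite_measure_UNION) (auto simp: sets_M)
        then have "(\<lambda>N. measure M (\<Union>i. A i) - (\<Sum>i<N. measure M (A i))) \<longlonglongrightarrow>
            measure M (\<Union>i. A i) - measure M (\<Union>i. A i)"
          unfolding sums_def by (intro tendsto_intros)
        then have "(\<lambda>N. sqrt (measure M (R N) * K)) \<longlonglongrightarrow> sqrt (0 * K)"
          unfolding mR by (intro tendsto_intros) simp
        then have "eventually (\<lambda>N. sqrt (measure M (R N) * K) < \<epsilon>) sequentially"
          using \<epsilon> by (intro order_tendstoD) auto
        then obtain N where N: "sqrt (measure M (R N) * K) < \<epsilon>"
          by (auto simp: eventually_sequentially)
        have "(indicator (\<Union>i. A i) :: 'a \<Rightarrow> real) = (\<lambda>x. (\<Sum>i<N. 1 * indicator (A i) x) + indicator (R N) x)"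
        proof
          fix x
          have "(\<Sum>i<N. indicator (A i) x) = (indicator (\<Union>i<N. A i) x :: real)"
            using union(1) by (subst indicator_UN_disjoint) (auto simp: disjoint_family_on_def)
          then show "(indicator (\<Union>i. A i) x :: real) = (\<Sum>i<N. 1 * indicator (A i) x) + indicator (R N) x"
            by (auto simp: R_def indicator_def)
        qed
        moreover have "L2_inner M (\<lambda>x. (\<Sum>i<N. 1 * indicator (A i) x) + indicator (R N) x) (f (r n))
            = (\<Sum>i<N. 1 * L2_inner M (indicator (A i)) (f (r n))) + L2_inner M (indicator (R N)) (f (r n))" for n
          using L2_inner_add_left[OF L2_sum[of "{..<N}", OF indicator_L2[OF A]] indicator_L2[OF R] f]
            L2_inner_sum_left[of "{..<N}", OF indicator_L2[OF A] f]
          by (simp only:)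
        ultimately have eq: "L2_inner M (indicator (\<Union>i. A i)) (f (r n)) =
            (\<Sum>i<N. L2_inner M (indicator (A i)) (f (r n))) + L2_inner M (indicator (R N)) (f (r n))" for n
          by simp
        have "\<bar>L2_inner M (indicator (R N)) (f (r n))\<bar> \<le> \<epsilon>" for n
          using indicator_inner_bound[OF f K R, of N "r n"] N by linarith
        then show "\<exists>a. convergent a \<and> (\<forall>n. \<bar>L2_inner M (indicator (\<Union>i. A i)) (f (r n)) - a n\<bar> \<le> \<epsilon>)"
          using union(3) by (intro exI[of _ "\<lambda>n. \<Sum>i<N. L2_inner M (indicator (A i)) (f (r n))"])
            (auto simp: eq intro!: convergent_sum)
      qed
    qed
  qed
  with r(1) that show thesis by blast
qed

text \<open>
  The kernel \<open>d(x, y)\<^sup>-\<^sup>\<delta>\<close> is replaced by a minorant that is constant on annuli. In this form an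
  average is a finite combination of integrals over Borel sets.
\<close>

definition annulus :: "(nat \<Rightarrow> real) \<Rightarrow> nat \<Rightarrow> 'a \<Rightarrow> 'a set" where
  "annulus \<rho> k x = cball x (\<rho> k) - cball x (\<rho> (Suc k))"

definition annular_weight :: "(nat \<Rightarrow> real) \<Rightarrow> nat \<Rightarrow> 'a \<Rightarrow> 'a \<Rightarrow> real" where
  "annular_weight \<rho> N x y = (\<Sum>k<N. \<rho> k powr (-\<delta>) * indicator (annulus \<rho> k x) y)"

definition annular_mass :: "(nat \<Rightarrow> real) \<Rightarrow> nat \<Rightarrow> 'a \<Rightarrow> real" where
  "annular_mass \<rho> N x = (\<integral>y. annular_weight \<rho> N x y \<partial>M)"

definition annular_average :: "(nat \<Rightarrow> real) \<Rightarrow> nat \<Rightarrow> ('a \<Rightarrow> real) \<Rightarrow> 'a \<Rightarrow> real" where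
  "annular_average \<rho> N f x = (\<integral>y. annular_weight \<rho> N x y * f y \<partial>M) / annular_mass \<rho> N x"

lemma annulus_borel[measurable]: "annulus \<rho> k x \<in> sets borel"
  unfolding annulus_def by measurable

lemma annular_weight_measurable[measurable]:
  "(\<lambda>(x, y). annular_weight \<rho> N x y) \<in> borel_measurable (M \<Otimes>\<^sub>M M)"
proof -
  have [measurable]: "(\<lambda>p. dist (fst p) (snd p)) \<in> borel_measurable (M \<Otimes>\<^sub>M M)"
    by (rule borel_measurable_dist) (simp_all add: measurable_cong_sets[OF refl sets_M[symmetric]])
  have ind: "indicator (annulus \<rho> k x) y =
      (if dist x y \<le> \<rho> k \<and> \<not> dist x y \<le> \<rho> (Suc k) then 1 else 0 :: real)" for k x y
    by (simp add: annulus_def indicator_def)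
  show ?thesis
    unfolding annular_weight_def case_prod_beta ind by measurable
qed

lemma annular_weight_section_measurable[measurable]:
  "annular_weight \<rho> N x \<in> borel_measurable M"
  unfolding annular_weight_def[abs_def] by (measurable; simp add: sets_M)

lemma annular_weight_nonneg: "annular_weight \<rho> N x y \<ge> 0"
  unfolding annular_weight_def by (intro sum_nonneg) auto

lemma annular_weight_bound: "annular_weight \<rho> N x y \<le> (\<Sum>k<N. \<rho> k powr (-\<delta>))"
  unfolding annular_weight_def by (intro sum_mono) (auto simp: indicator_def)

lemma annular_weight_le:
  assumes pos: "\<And>k. \<rho> k > 0" and dec: "\<And>k. \<rho> (Suc k) \<le> \<rho> k"
  shows "annular_weight \<rho> N x y \<le> (if \<rho> N < dist x y then dist x y powr (-\<delta>) else 0)"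
proof (induction N)
  case 0
  then show ?case by (simp add: annular_weight_def)
next
  case (Suc N)
  have "annular_weight \<rho> (Suc N) x y =
      annular_weight \<rho> N x y + (if \<rho> (Suc N) < dist x y \<and> dist x y \<le> \<rho> N then \<rho> N powr (-\<delta>) else 0)"
    by (auto simp: annular_weight_def annulus_def indicator_def)
  moreover have "\<rho> N powr (-\<delta>) \<le> dist x y powr (-\<delta>)" if "\<rho> (Suc N) < dist x y" "dist x y \<le> \<rho> N"
    using that pos[of "Suc N"] \<delta>_pos by (intro powr_mono2') auto
  ultimately show ?case
    using Suc dec[of N] by (auto split: if_splits)
qed

lemma annular_weight_square_le:
  assumes pos: "\<And>k. \<rho> k > 0" and dec: "\<And>k. \<rho> (Suc k) \<le> \<rho> k"
  shows "annular_weight \<rho> N x y * (f x - f y)\<^sup>2 \<le> (diff_quotient f (x, y))\<^sup>2"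
proof (cases "\<rho> N < dist x y")
  case True
  then have "annular_weight \<rho> N x y * (f x - f y)\<^sup>2 \<le> dist x y powr (-\<delta>) * (f x - f y)\<^sup>2"
    using annular_weight_le[of \<rho> N x y, OF assms] by (intro mult_right_mono) auto
  then show ?thesis
    by (simp add: diff_quotient_square powr_minus divide_inverse mult.commute)
next
  case False
  then have "annular_weight \<rho> N x y = 0"
    using annular_weight_le[of \<rho> N x y, OF assms] annular_weight_nonneg[of \<rho> N x y] by auto
  then show ?thesis by simp
qed

lemma integrable_annular_weight_mult:
  assumes "integrable M f"
  shows "integrable M (\<lambda>y. annular_weight \<rho> N x y * f y)"
proof (rule Bochner_Integration.integrable_bound)
  show "integrable M (\<lambda>y. (\<Sum>k<N. \<rho> k powr (-\<delta>)) * f y)"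
    using assms by simp
  show "(\<lambda>y. annular_weight \<rho> N x y * f y) \<in> borel_measurable M"
    using assms by measurable
  show "AE y in M. norm (annular_weight \<rho> N x y * f y) \<le> norm ((\<Sum>k<N. \<rho> k powr (-\<delta>)) * f y)"
  proof (rule AE_I2)
    fix y
    have "\<bar>annular_weight \<rho> N x y\<bar> \<le> \<bar>\<Sum>k<N. \<rho> k powr (-\<delta>)\<bar>"
      using annular_weight_nonneg[of \<rho> N x y] annular_weight_bound[of \<rho> N x y] by linarith
    then show "norm (annular_weight \<rho> N x y * f y) \<le> norm ((\<Sum>k<N. \<rho> k powr (-\<delta>)) * f y)"
      unfolding real_norm_def abs_mult by (rule mult_right_mono) simp
  qed
qed

lemma annular_weight_integral:
  assumes "f \<in> L2 M"
  shows "(\<integral>y. annular_weight \<rho> N x y * f y \<partial>M) =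
    (\<Sum>k<N. \<rho> k powr (-\<delta>) * L2_inner M (indicator (annulus \<rho> k x)) f)"
  using L2_inner_sum_left[of "{..<N}" "\<lambda>k. indicator (annulus \<rho> k x)" M f "\<lambda>k. \<rho> k powr (-\<delta>)"]
    assms indicator_L2[OF annulus_borel]
  by (simp add: L2_inner_def annular_weight_def)

lemma annular_mass_eq: "annular_mass \<rho> N x = (\<Sum>k<N. \<rho> k powr (-\<delta>) * measure M (annulus \<rho> k x))"
proof -
  have "(\<lambda>y. 1 :: real) \<in> L2 M"
    by (simp add: L2_def)
  from annular_weight_integral[OF this, of \<rho> N x] show ?thesis
    by (simp add: annular_mass_def L2_inner_def sets_M)
qed

text \<open>
  The variance inequality for the measure with density the annular weight: the mean of
  \<open>f x - f y\<close> is \<open>f x - annular_average \<rho> N f x\<close>, and its square is at most the mean square.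
\<close>

lemma annular_average_pointwise:
  assumes f: "f \<in> L2 M" and mass: "annular_mass \<rho> N x > 0"
  shows "annular_mass \<rho> N x * (f x - annular_average \<rho> N f x)\<^sup>2 \<le>
    (\<integral>y. annular_weight \<rho> N x y * (f x - f y)\<^sup>2 \<partial>M)"
proof -
  define w where "w = annular_weight \<rho> N x"
  define Z where "Z = annular_mass \<rho> N x"
  define m where "m = f x - annular_average \<rho> N f x"
  define h where "h y = f x - f y" for y
  have one: "(\<lambda>y. c) \<in> L2 M" for c :: real
    by (simp add: L2_def)
  have hL: "h \<in> L2 M"
    unfolding h_def by (intro L2_diff one f)
  have fi: "integrable M f"
    using L2_mult_integrable[OF f one[of 1]] by simp
  have hi: "integrable M h" "integrable M (\<lambda>y. (h y)\<^sup>2)"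
    using L2_mult_integrable[OF hL one[of 1]] L2_mult_integrable[OF hL hL] by (simp_all add: power2_eq_square)
  have wi: "integrable M w"
    using integrable_annular_weight_mult[of "\<lambda>y. 1" \<rho> N x] by (simp add: w_def)
  have wf: "integrable M (\<lambda>y. w y * f y)" and wh: "integrable M (\<lambda>y. w y * h y)"
    and wh2: "integrable M (\<lambda>y. w y * (h y)\<^sup>2)"
    unfolding w_def by (intro integrable_annular_weight_mult fi hi)+
  have Z: "(\<integral>y. w y \<partial>M) = Z" by (simp add: w_def Z_def annular_mass_def)
  have "(\<integral>y. w y * h y \<partial>M) = (\<integral>y. f x * w y - w y * f y \<partial>M)"
    by (simp add: h_def algebra_simps)
  also have "\<dots> = f x * Z - (\<integral>y. w y * f y \<partial>M)"
    using wi wf Z by simp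
  also have "\<dots> = Z * m"
    using mass by (simp add: m_def annular_average_def w_def Z_def field_simps)
  finally have whm: "(\<integral>y. w y * h y \<partial>M) = Z * m" .
  have "0 \<le> (\<integral>y. w y * (h y - m)\<^sup>2 \<partial>M)"
    unfolding w_def by (intro Bochner_Integration.integral_nonneg mult_nonneg_nonneg annular_weight_nonneg) auto
  also have "\<dots> = (\<integral>y. w y * (h y)\<^sup>2 - 2 * m * (w y * h y) + m\<^sup>2 * w y \<partial>M)"
    by (simp add: power2_eq_square algebra_simps)
  also have "\<dots> = (\<integral>y. w y * (h y)\<^sup>2 \<partial>M) - 2 * m * (Z * m) + m\<^sup>2 * Z"
    using wi wh wh2 Z whm by simp
  finally show ?thesis
    by (simp add: w_def Z_def m_def h_def power2_eq_square algebra_simps)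
qed

lemma annular_average_measurable[measurable]:
  assumes "f \<in> L2 M"
  shows "annular_average \<rho> N f \<in> borel_measurable M"
proof -
  have [measurable]: "f \<in> borel_measurable M" using assms by (rule L2_measurable)
  have [measurable]: "(\<lambda>p. annular_weight \<rho> N (fst p) (snd p)) \<in> borel_measurable (M \<Otimes>\<^sub>M M)"
    using annular_weight_measurable[of \<rho> N] by (simp add: case_prod_beta')
  show ?thesis
    unfolding annular_average_def[abs_def] annular_mass_def[abs_def]
    by (intro borel_measurable_divide borel_measurable_lebesgue_integral; simp add: case_prod_beta'; measurable)
qed

lemma annular_average_bound:
  assumes f: "f \<in> L2 M" "L2_inner M f f \<le> K" and mass: "annular_mass \<rho> N x \<ge> c" and c: "c > 0"
  shows "\<bar>annular_average \<rho> N f x\<bar> \<le> (\<Sum>k<N. \<rho> k powr (-\<delta>) * sqrt (measure M UNIV * K)) / c"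
proof -
  have K0: "K \<ge> 0"
    using f(2) L2_inner_nonneg[of M f] by linarith
  have 1: "\<bar>L2_inner M (indicator (annulus \<rho> k x)) f\<bar> \<le> sqrt (measure M UNIV * K)" for k
  proof -
    have "\<bar>L2_inner M (indicator (annulus \<rho> k x)) f\<bar> \<le> sqrt (measure M (annulus \<rho> k x) * K)"
      by (rule indicator_inner_bound[OF f annulus_borel])
    also have "\<dots> \<le> sqrt (measure M UNIV * K)"
      using K0 bounded_measure[of "annulus \<rho> k x"] by (intro real_sqrt_le_mono mult_right_mono) auto
    finally show ?thesis .
  qed
  have "\<bar>\<integral>y. annular_weight \<rho> N x y * f y \<partial>M\<bar> \<le> (\<Sum>k<N. \<rho> k powr (-\<delta>) * sqrt (measure M UNIV * K))"
    unfolding annular_weight_integral[OF f(1)]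
    by (rule order_trans[OF sum_abs sum_mono]) (simp add: abs_mult 1 mult_left_mono)
  then show ?thesis
    unfolding annular_average_def abs_divide using mass c
    by (intro frac_le) (auto intro!: sum_nonneg mult_nonneg_nonneg K0)
qed

text \<open>
  Integrating the variance inequality over \<open>x\<close>: the weight is at most \<open>d(x, y)\<^sup>-\<^sup>\<delta>\<close>, so the right-hand
  side becomes the energy, and a large mass gives a small error.
\<close>

lemma annular_average_error:
  assumes f: "f \<in> form_domain \<delta> M"
    and pos: "\<And>k. \<rho> k > 0" and dec: "\<And>k. \<rho> (Suc k) \<le> \<rho> k"
    and mass: "\<And>x. annular_mass \<rho> N x \<ge> c" and c: "c > 0"
  shows "annular_average \<rho> N f \<in> L2 M"
    and "L2_sqdist M f (annular_average \<rho> N f) \<le> 2 * energy_form \<delta> M f f / c"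
proof -
  have fL: "f \<in> L2 M" using f by (rule form_domain_L2)
  note [measurable] = L2_measurable[OF fL] annular_average_measurable[OF fL]
  show aL: "annular_average \<rho> N f \<in> L2 M"
    by (rule L2_bounded[OF finite_measure_axioms annular_average_measurable[OF fL]
          annular_average_bound[OF fL order_refl mass c]])
  have int: "integrable (M \<Otimes>\<^sub>M M) (\<lambda>p. (diff_quotient f p)\<^sup>2)"
    using f by (simp add: form_domain_iff L2_def)
  have AE: "AE x in M. integrable M (\<lambda>y. (diff_quotient f (x, y))\<^sup>2)"
    by (rule pair.AE_integrable_fst'[OF int])
  have "(\<integral>x. c * (f x - annular_average \<rho> N f x)\<^sup>2 \<partial>M) \<le> (\<integral>x. \<integral>y. (diff_quotient f (x, y))\<^sup>2 \<partial>M \<partial>M)"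
  proof (rule integral_mono_AE)
    show "integrable M (\<lambda>x. c * (f x - annular_average \<rho> N f x)\<^sup>2)"
      using L2_diff[OF fL aL] by (simp add: L2_def)
    show "integrable M (\<lambda>x. \<integral>y. (diff_quotient f (x, y))\<^sup>2 \<partial>M)"
      by (rule pair.integrable_fst'[OF int])
    show "AE x in M. c * (f x - annular_average \<rho> N f x)\<^sup>2 \<le> (\<integral>y. (diff_quotient f (x, y))\<^sup>2 \<partial>M)"
      using AE
    proof eventually_elim
      case (elim x)
      have Z: "annular_mass \<rho> N x > 0" using mass[of x] c by linarith
      have h2: "integrable M (\<lambda>y. (f x - f y)\<^sup>2)"
        using L2_diff[of "\<lambda>_. f x" M f] fL by (simp add: L2_def)
      have "c * (f x - annular_average \<rho> N f x)\<^sup>2 \<le> annular_mass \<rho> N x * (f x - annular_average \<rho> N f x)\<^sup>2"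
        by (intro mult_right_mono mass) simp
      also have "\<dots> \<le> (\<integral>y. annular_weight \<rho> N x y * (f x - f y)\<^sup>2 \<partial>M)"
        by (rule annular_average_pointwise[OF fL Z])
      also have "\<dots> \<le> (\<integral>y. (diff_quotient f (x, y))\<^sup>2 \<partial>M)"
        by (intro integral_mono integrable_annular_weight_mult h2 elim annular_weight_square_le pos dec)
      finally show ?case .
    qed
  qed
  also have "\<dots> = 2 * energy_form \<delta> M f f"
    using pair.integral_fst'[OF int] by (simp add: energy_form_eq f L2_inner_def power2_eq_square)
  finally have "c * L2_sqdist M f (annular_average \<rho> N f) \<le> 2 * energy_form \<delta> M f f"
    by (simp add: L2_sqdist_def L2_inner_def power2_eq_square)
  then show "L2_sqdist M f (annular_average \<rho> N f) \<le> 2 * energy_form \<delta> M f f / c"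
    using c by (simp add: field_simps)
qed

lemma annular_average_convergent:
  assumes f: "\<And>n. f n \<in> L2 M"
    and conv: "\<And>B. B \<in> sets borel \<Longrightarrow> convergent (\<lambda>n. L2_inner M (indicator B) (f n))"
  shows "convergent (\<lambda>n. annular_average \<rho> N (f n) x)"
  unfolding annular_average_def annular_weight_integral[OF f] divide_inverse
  by (intro convergent_mult convergent_sum convergent_const conv annulus_borel)

text \<open>
  In a space with two distinct points the regularity estimate holds up to a positive radius, here half
  of their distance.
\<close>

lemma ball_measure_bounds:
  assumes "a \<noteq> (b :: 'a)"
  obtains C r0 where "C \<ge> 1" "r0 > 0"
    "\<And>x r. 0 \<le> r \<Longrightarrow> r \<le> r0 \<Longrightarrow> inverse C * r powr \<delta> \<le> measure M (cball x r)"
    "\<And>x r. 0 \<le> r \<Longrightarrow> r \<le> r0 \<Longrightarrow> measure M (cball x r) \<le> C * r powr \<delta>"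
proof -
  obtain C where C: "C \<ge> 1" "\<And>x r. 0 \<le> r \<and> ereal r < ediameter (UNIV :: 'a set) \<Longrightarrow>
        inverse C * r powr \<delta> \<le> measure M (cball x r) \<and> measure M (cball x r) \<le> C * r powr \<delta>"
    using regular unfolding ahlfors_regular_def by blast
  have "ereal (dist a b) \<le> ediameter (UNIV :: 'a set)"
    unfolding ediameter_def by (rule SUP_upper2[of "(a, b)"]) auto
  moreover have "ereal r < ereal (dist a b)" if "r \<le> dist a b / 2" for r
  proof -
    have "dist a b > 0" using assms by simp
    with that have "r < dist a b" by linarith
    then show ?thesis by simp
  qed
  ultimately have "ereal r < ediameter (UNIV :: 'a set)" if "r \<le> dist a b / 2" for r
    using that less_le_trans by blast
  with C show thesis
    by (intro that[of C "dist a b / 2"]) (use assms in auto)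
qed

text \<open>
  The logarithmic divergence on which everything rests: each of the \<open>N\<close> annuli contributes at least
  \<open>c\<close>, whatever its radius.
\<close>

lemma annular_mass_unbounded:
  assumes "a \<noteq> (b :: 'a)"
  obtains \<rho> :: "nat \<Rightarrow> real" and c :: real
  where "\<And>k. \<rho> k > 0" "\<And>k. \<rho> (Suc k) \<le> \<rho> k" "c > 0" "\<And>N x. annular_mass \<rho> N x \<ge> real N * c"
proof -
  obtain C r0 where C: "C \<ge> 1" "r0 > 0"
    "\<And>x r. 0 \<le> r \<Longrightarrow> r \<le> r0 \<Longrightarrow> inverse C * r powr \<delta> \<le> measure M (cball x r)"
    "\<And>x r. 0 \<le> r \<Longrightarrow> r \<le> r0 \<Longrightarrow> measure M (cball x r) \<le> C * r powr \<delta>"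
    using ball_measure_bounds[OF assms] by metis
  \<comment> \<open>the inner ball of an annulus has at most half of the guaranteed measure of the outer one\<close>
  define \<theta> where "\<theta> = (1 / (2 * C\<^sup>2)) powr (1 / \<delta>)"
  have C2: "1 / (2 * C\<^sup>2) > 0" "1 / (2 * C\<^sup>2) \<le> 1"
    using C(1) mult_mono[of 1 C 1 C] by (auto simp: field_simps power2_eq_square)
  have \<theta>: "\<theta> > 0" "\<theta> \<le> 1" "\<theta> powr \<delta> = 1 / (2 * C\<^sup>2)"
    using C2 \<delta>_pos by (auto simp: \<theta>_def powr_powr intro!: powr_le1)
  define \<rho> where "\<rho> k = r0 * \<theta> ^ k" for k
  have pos: "\<rho> k > 0" for k using C(2) \<theta>(1) by (simp add: \<rho>_def)
  have Suc: "\<rho> (Suc k) = \<theta> * \<rho> k" for k by (simp add: \<rho>_def)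
  have dec: "\<rho> (Suc k) \<le> \<rho> k" for k
    unfolding Suc using pos[of k] \<theta>(2) by simp
  have le: "\<rho> k \<le> r0" for k
    using \<theta> C(2) power_le_one[of \<theta> k] by (simp add: \<rho>_def)
  have ann: "\<rho> k powr (-\<delta>) * measure M (annulus \<rho> k x) \<ge> 1 / (2 * C)" for k x
  proof -
    have "measure M (annulus \<rho> k x) = measure M (cball x (\<rho> k)) - measure M (cball x (\<rho> (Suc k)))"
      unfolding annulus_def using dec[of k] by (intro finite_measure_Diff) (auto simp: sets_M)
    also have "\<dots> \<ge> inverse C * \<rho> k powr \<delta> - C * \<rho> (Suc k) powr \<delta>"
      using C(3)[of "\<rho> k" x] C(4)[of "\<rho> (Suc k)" x] pos le by (intro diff_mono) (auto intro: less_imp_le)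
    also have "\<rho> (Suc k) powr \<delta> = 1 / (2 * C\<^sup>2) * \<rho> k powr \<delta>"
      unfolding Suc using \<theta> pos[of k] by (simp add: powr_mult)
    also have "inverse C * \<rho> k powr \<delta> - C * (1 / (2 * C\<^sup>2) * \<rho> k powr \<delta>) = 1 / (2 * C) * \<rho> k powr \<delta>"
      using C(1) by (simp add: field_simps power2_eq_square)
    finally have "\<rho> k powr (-\<delta>) * measure M (annulus \<rho> k x) \<ge> \<rho> k powr (-\<delta>) * (1 / (2 * C) * \<rho> k powr \<delta>)"
      by (intro mult_left_mono) auto
    also have "\<rho> k powr (-\<delta>) * (1 / (2 * C) * \<rho> k powr \<delta>) = 1 / (2 * C)"
      using pos[of k] by (simp add: powr_minus)
    finally show ?thesis .
  qed
  have "annular_mass \<rho> N x \<ge> real N * (1 / (2 * C))" for N x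
    unfolding annular_mass_eq using sum_bounded_below[of "{..<N}" "1 / (2 * C)", OF ann] by simp
  with pos dec C(1) that[of \<rho> "1 / (2 * C)"] show thesis by simp
qed

text \<open>
  Along a subsequence the averages converge pointwise and boundedly, hence in \<open>L\<^sup>2\<close>, and they are uniformly
  close to the given functions. In a one-point space the form vanishes and gives no information, but there convergence
  of integrals is already convergence in \<open>L\<^sup>2\<close>.
\<close>

theorem form_domain_compact_embedding:
  fixes f :: "nat \<Rightarrow> 'a \<Rightarrow> real"
  assumes f: "\<And>n. f n \<in> form_domain \<delta> M"
    and norm: "\<And>n. L2_inner M (f n) (f n) \<le> K" and energy: "\<And>n. energy_form \<delta> M (f n) (f n) \<le> K"
  obtains r :: "nat \<Rightarrow> nat" and h where "strict_mono r" "h \<in> L2 M" "(\<lambda>n. L2_sqdist M (f (r n)) h) \<longlonglongrightarrow> 0"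
proof -
  have fL: "f n \<in> L2 M" for n using f by (rule form_domain_L2)
  obtain r where r: "strict_mono r"
    "\<And>B. B \<in> sets borel \<Longrightarrow> convergent (\<lambda>n. L2_inner M (indicator B) (f (r n)))"
    by (rule subseq_set_integrals_convergent[of f K, OF fL norm]) blast
  have "\<exists>h. h \<in> L2 M \<and> (\<lambda>n. L2_sqdist M (f (r n)) h) \<longlonglongrightarrow> 0"
  proof (cases "\<exists>a b :: 'a. a \<noteq> b")
    case True
    then obtain a b :: 'a where "a \<noteq> b" by blast
    then obtain \<rho> c where \<rho>: "\<And>k. \<rho> k > 0" "\<And>k. \<rho> (Suc k) \<le> \<rho> k" "c > 0"
        "\<And>N x. annular_mass \<rho> N x \<ge> real N * c"
      by (rule annular_mass_unbounded) blast
    have "\<exists>g h. h \<in> L2 M \<and> (\<forall>n. g n \<in> L2 M \<and> L2_sqdist M (f (r n)) (g n) \<le> \<epsilon>) \<and>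
        (\<lambda>n. L2_sqdist M (g n) h) \<longlonglongrightarrow> 0" if \<epsilon>: "\<epsilon> > 0" for \<epsilon> :: real
    proof -
      obtain N where N: "2 * K / (c * \<epsilon>) < real N"
        using reals_Archimedean2 by blast
      have K0: "K \<ge> 0"
        using norm[of 0] L2_inner_nonneg[of M "f 0"] by linarith
      have N0: "real N > 0"
        using N K0 \<rho>(3) \<epsilon> by (smt (verit) divide_nonneg_pos mult_pos_pos)
      then have Nc: "real N * c > 0" using \<rho>(3) by simp
      have le: "2 * K / (real N * c) \<le> \<epsilon>"
        using N Nc \<rho>(3) \<epsilon> by (simp add: field_simps)
      define g where "g n = annular_average \<rho> N (f (r n))" for n
      define h where "h x = lim (\<lambda>n. g n x)" for x
      have "g n \<in> L2 M \<and> L2_sqdist M (f (r n)) (g n) \<le> \<epsilon>" for n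
      proof -
        have "2 * energy_form \<delta> M (f (r n)) (f (r n)) / (real N * c) \<le> 2 * K / (real N * c)"
          using Nc energy[of "r n"] by (intro divide_right_mono) auto
        with annular_average_error[OF f \<rho>(1,2,4) Nc, of "r n"] le show ?thesis
          by (auto simp: g_def)
      qed
      moreover have "h \<in> L2 M" "(\<lambda>n. L2_sqdist M (g n) h) \<longlonglongrightarrow> 0"
      proof -
        have 1: "g n \<in> borel_measurable M" for n
          unfolding g_def by (rule annular_average_measurable[OF fL])
        have 2: "\<bar>g n x\<bar> \<le> (\<Sum>k<N. \<rho> k powr (-\<delta>) * sqrt (measure M UNIV * K)) / (real N * c)" for n x
          unfolding g_def by (rule annular_average_bound[OF fL norm \<rho>(4) Nc])
        have 3: "(\<lambda>n. g n x) \<longlonglongrightarrow> h x" for x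
          unfolding h_def g_def using annular_average_convergent[OF fL r(2)]
          by (simp add: convergent_LIMSEQ_iff)
        show "h \<in> L2 M" "(\<lambda>n. L2_sqdist M (g n) h) \<longlonglongrightarrow> 0"
          using L2_dominated[OF 1 2 3] by auto
      qed
      ultimately show ?thesis by blast
    qed
    then show ?thesis
      by (rule L2_convergent_of_approx[of "\<lambda>n. f (r n)", OF fL]) blast+
  next
    case False
    then have sing: "x = y" for x y :: 'a by blast
    have const: "g = (\<lambda>_. g x)" for g :: "'a \<Rightarrow> real" and x
      using sing by (metis (full_types))
    fix x :: 'a
    define \<mu> where "\<mu> = measure M UNIV"
    define h where "h = (\<lambda>_::'a. lim (\<lambda>n. f (r n) x))"
    have h: "h \<in> L2 M" by (simp add: h_def L2_def)
    have sq: "L2_sqdist M (f (r n)) h = (f (r n) x - h x)\<^sup>2 * \<mu>" for n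
      unfolding L2_sqdist_def L2_inner_def
      by (subst const[of "\<lambda>y. (f (r n) y - h y) * (f (r n) y - h y)" x]) (simp add: \<mu>_def power2_eq_square)
    have "(\<lambda>n. (f (r n) x - h x)\<^sup>2 * \<mu>) \<longlonglongrightarrow> 0"
    proof (cases "\<mu> = 0")
      case False
      have "L2_inner M (indicator UNIV) (f (r n)) = f (r n) x * \<mu>" for n
        unfolding L2_inner_def
        by (subst const[of "\<lambda>y. indicator UNIV y * f (r n) y" x]) (simp add: \<mu>_def)
      with r(2)[of UNIV] have "convergent (\<lambda>n. f (r n) x * \<mu>)" by simp
      then have "convergent (\<lambda>n. f (r n) x * \<mu> * inverse \<mu>)"
        by (rule convergent_mult[OF _ convergent_const])
      then have "convergent (\<lambda>n. f (r n) x)"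
        by (simp only: mult.assoc right_inverse[OF False] mult_1_right)
      then have "(\<lambda>n. f (r n) x) \<longlonglongrightarrow> h x"
        by (simp add: h_def convergent_LIMSEQ_iff)
      then have "(\<lambda>n. (f (r n) x - h x)\<^sup>2 * \<mu>) \<longlonglongrightarrow> (h x - h x)\<^sup>2 * \<mu>"
        by (intro tendsto_mult tendsto_power tendsto_diff tendsto_const)
      then show ?thesis by simp
    qed simp
    with h sq show ?thesis by auto
  qed
  with r(1) that show thesis by blast
qed

end

section \<open>Density of the form domain\<close>

lemma dyadic_scale:
  fixes d r0 :: real
  assumes "0 < d" "d \<le> r0"
  obtains j :: nat where "r0 * (1/2) ^ Suc j < d" "d \<le> r0 * (1/2) ^ j"
proof -
  have r0: "r0 > 0" using assms by linarith
  obtain n where n: "(1/2 :: real) ^ n < d / r0"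
    using real_arch_pow_inv[of "d / r0" "1/2"] assms r0 by auto
  define m where "m = (LEAST n. r0 * (1/2) ^ n < d)"
  have "r0 * (1/2) ^ n < d"
    using n r0 by (simp add: field_simps)
  then have m: "r0 * (1/2) ^ m < d"
    unfolding m_def by (rule LeastI)
  have "m \<noteq> 0"
    using m assms by (intro notI) simp
  then obtain j where j: "m = Suc j"
    by (cases m) auto
  have "\<not> r0 * (1/2) ^ j < d"
    using not_less_Least[of j "\<lambda>n. r0 * (1/2) ^ n < d"] j by (simp add: m_def)
  with m j that show thesis by auto
qed

context ahlfors_regular_space
begin

text \<open>
  A dyadic decomposition around \<open>x\<close>: the Lipschitz bound controls the quotient at scale \<open>\<rho>\<close> by a
  multiple of \<open>\<rho>\<^sup>2 / \<rho>\<^sup>\<delta>\<close>, and boundedness suffices at distances above \<open>r0\<close>.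
\<close>

lemma lipschitz_diff_quotient_bound:
  assumes lip: "\<And>x y. \<bar>f x - f y\<bar> \<le> L * dist x y" and bd: "\<And>x y. \<bar>f x - f y\<bar> \<le> B" and r0: "r0 > 0"
  shows "ennreal ((diff_quotient f (x, y))\<^sup>2) \<le> ennreal (B\<^sup>2 / r0 powr \<delta>) +
    (\<Sum>j. ennreal (L\<^sup>2 * 2 powr \<delta> * (r0 * (1/2)^j)\<^sup>2 / (r0 * (1/2)^j) powr \<delta>) *
      indicator (cball x (r0 * (1/2)^j)) y)"
    (is "_ \<le> _ + (\<Sum>j. ?t j)")
proof -
  consider "dist x y = 0" | "dist x y > r0" | "0 < dist x y" "dist x y \<le> r0"
    by fastforce
  then show ?thesis
  proof cases
    case 1
    then show ?thesis by (simp add: diff_quotient_def)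
  next
    case 2
    have "(f x - f y)\<^sup>2 / dist x y powr \<delta> \<le> B\<^sup>2 / r0 powr \<delta>"
    proof (rule frac_le)
      have "\<bar>f x - f y\<bar> \<le> \<bar>B\<bar>" using bd[of x y] by linarith
      then show "(f x - f y)\<^sup>2 \<le> B\<^sup>2" by (simp add: abs_le_square_iff)
      show "r0 powr \<delta> \<le> dist x y powr \<delta>"
        using 2 r0 \<delta>_pos by (intro powr_mono2) auto
    qed (use r0 in auto)
    then have "ennreal ((diff_quotient f (x, y))\<^sup>2) \<le> ennreal (B\<^sup>2 / r0 powr \<delta>)"
      unfolding diff_quotient_square by (rule ennreal_leI)
    then show ?thesis
      by (rule order_trans) simp
  next
    case 3
    then obtain j where j: "r0 * (1/2) ^ Suc j < dist x y" "dist x y \<le> r0 * (1/2) ^ j"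
      by (rule dyadic_scale)
    define \<rho> where "\<rho> = r0 * (1/2) ^ j"
    have \<rho>: "\<rho> > 0" "\<rho> / 2 < dist x y" "dist x y \<le> \<rho>"
      using j r0 by (simp_all add: \<rho>_def)
    have "(f x - f y)\<^sup>2 / dist x y powr \<delta> \<le> (L\<^sup>2 * \<rho>\<^sup>2) / (\<rho> / 2) powr \<delta>"
    proof (rule frac_le)
      have "\<bar>f x - f y\<bar> \<le> \<bar>L * \<rho>\<bar>"
        using lip[of x y] mult_left_mono[OF \<rho>(3) abs_ge_zero[of L]]
          mult_right_mono[OF abs_ge_self[of L] zero_le_dist[of x y]] \<rho>(1)
        unfolding abs_mult by linarith
      then show "(f x - f y)\<^sup>2 \<le> L\<^sup>2 * \<rho>\<^sup>2"
        by (simp add: abs_le_square_iff power_mult_distrib)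
      show "(\<rho> / 2) powr \<delta> \<le> dist x y powr \<delta>"
        using \<rho> \<delta>_pos by (intro powr_mono2) auto
    qed (use \<rho> in auto)
    also have "(L\<^sup>2 * \<rho>\<^sup>2) / (\<rho> / 2) powr \<delta> = L\<^sup>2 * 2 powr \<delta> * \<rho>\<^sup>2 / \<rho> powr \<delta>"
      using \<rho> by (simp add: powr_divide)
    finally have "ennreal ((diff_quotient f (x, y))\<^sup>2) \<le> ?t j"
      using \<rho>(3) unfolding diff_quotient_square by (auto simp: \<rho>_def[symmetric] intro!: ennreal_leI)
    also have "?t j \<le> (\<Sum>j. ?t j)"
    proof -
      have "(\<Sum>i\<in>{j}. ?t i) \<le> (\<Sum>j. ?t j)"
        by (rule sum_le_suminf) auto
      moreover have "(\<Sum>i\<in>{j}. g i) = g j" for g :: "nat \<Rightarrow> ennreal"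
        by simp
      ultimately show ?thesis by metis
    qed
    also have "\<dots> \<le> ennreal (B\<^sup>2 / r0 powr \<delta>) + (\<Sum>j. ?t j)" by simp
    finally show ?thesis .
  qed
qed

text \<open>
  By regularity the ball of radius \<open>\<rho>\<close> has measure at most a multiple of \<open>\<rho>\<^sup>\<delta>\<close>, so scale \<open>\<rho>\<close> contributes
  a multiple of \<open>\<rho>\<^sup>2\<close>, which is summable over dyadic scales.
\<close>

lemma lipschitz_in_form_domain:
  fixes f :: "'a \<Rightarrow> real"
  assumes lip: "\<And>x y. \<bar>f x - f y\<bar> \<le> L * dist x y" and bd: "\<And>x. \<bar>f x\<bar> \<le> B"
  shows "f \<in> form_domain \<delta> M"
proof -
  have "continuous_on UNIV f"
  proof (rule lipschitz_on_continuous_on)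
    have "\<bar>f x - f y\<bar> \<le> \<bar>L\<bar> * dist x y" for x y
      using lip[of x y] mult_right_mono[OF abs_ge_self[of L] zero_le_dist[of x y]] by linarith
    then show "\<bar>L\<bar>-lipschitz_on UNIV f"
      by (simp add: lipschitz_on_def dist_real_def)
  qed
  then have [measurable]: "f \<in> borel_measurable M"
    using borel_measurable_continuous_onI measurable_cong_sets[OF sets_M refl] by blast
  have fL: "f \<in> L2 M"
    by (rule L2_bounded[OF finite_measure_axioms _ bd]) measurable
  have "\<exists>K. \<forall>x. (\<integral>\<^sup>+y. ennreal ((diff_quotient f (x, y))\<^sup>2) \<partial>M) \<le> ennreal K"
  proof (cases "\<exists>a b :: 'a. a \<noteq> b")
    case False
    then have "f x = f y" for x y by metis
    then have "diff_quotient f p = 0" for p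
      by (cases p) (simp add: diff_quotient_def)
    then show ?thesis by simp
  next
    case True
    then obtain a b :: 'a where "a \<noteq> b" by blast
    then obtain C r0 where C: "C \<ge> 1" "r0 > 0"
      "\<And>x r. 0 \<le> r \<Longrightarrow> r \<le> r0 \<Longrightarrow> measure M (cball x r) \<le> C * r powr \<delta>"
      by (rule ball_measure_bounds) blast
    define \<rho> where "\<rho> j = r0 * (1/2)^j" for j :: nat
    have \<rho>: "\<rho> j > 0" "\<rho> j \<le> r0" for j
      using C(2) power_le_one[of "1/2 :: real" j] by (auto simp: \<rho>_def)
    define K1 where "K1 = (2 * B)\<^sup>2 / r0 powr \<delta> * measure M UNIV"
    define K2 where "K2 j = L\<^sup>2 * 2 powr \<delta> * C * r0\<^sup>2 * (1/4)^j" for j :: nat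
    have sumK2: "summable K2"
      unfolding K2_def by (intro summable_mult summable_geometric) simp
    have "(\<integral>\<^sup>+y. ennreal ((diff_quotient f (x, y))\<^sup>2) \<partial>M) \<le> ennreal (K1 + (\<Sum>j. K2 j))" for x
    proof -
      have bd': "\<bar>f x - f y\<bar> \<le> 2 * B" for x y
        using bd[of x] bd[of y] by linarith
      have "(\<integral>\<^sup>+y. ennreal ((diff_quotient f (x, y))\<^sup>2) \<partial>M) \<le>
          (\<integral>\<^sup>+y. ennreal ((2 * B)\<^sup>2 / r0 powr \<delta>) +
            (\<Sum>j. ennreal (L\<^sup>2 * 2 powr \<delta> * (\<rho> j)\<^sup>2 / \<rho> j powr \<delta>) * indicator (cball x (\<rho> j)) y) \<partial>M)"
        unfolding \<rho>_def by (intro nn_integral_mono lipschitz_diff_quotient_bound lip bd' C(2))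
      also have "\<dots> = ennreal ((2 * B)\<^sup>2 / r0 powr \<delta>) * emeasure M UNIV +
          (\<Sum>j. ennreal (L\<^sup>2 * 2 powr \<delta> * (\<rho> j)\<^sup>2 / \<rho> j powr \<delta>) * emeasure M (cball x (\<rho> j)))"
      proof -
        have ball: "cball x (\<rho> j) \<in> sets M" for j
          by (simp add: sets_M)
        have tm: "(\<lambda>y. c * indicator (cball x (\<rho> j)) y) \<in> borel_measurable M" for c :: ennreal and j
          using ball by (intro borel_measurable_times_ennreal borel_measurable_indicator) auto
        show ?thesis
          by (subst nn_integral_add[OF _ borel_measurable_suminf_order[OF tm]], simp,
              subst nn_integral_suminf[OF tm], simp only: nn_integral_cmult_indicator[OF ball]
                nn_integral_const space_M)
      qed
      also have "\<dots> \<le> ennreal K1 + (\<Sum>j. ennreal (K2 j))"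
      proof (intro add_mono suminf_le allI)
        show "ennreal ((2 * B)\<^sup>2 / r0 powr \<delta>) * emeasure M UNIV \<le> ennreal K1"
          by (simp only: K1_def emeasure_eq_measure ennreal_mult''[OF measure_nonneg] order_refl)
        fix j
        have "ennreal (L\<^sup>2 * 2 powr \<delta> * (\<rho> j)\<^sup>2 / \<rho> j powr \<delta>) * emeasure M (cball x (\<rho> j))
            = ennreal (L\<^sup>2 * 2 powr \<delta> * (\<rho> j)\<^sup>2 / \<rho> j powr \<delta> * measure M (cball x (\<rho> j)))"
          by (simp only: emeasure_eq_measure ennreal_mult''[OF measure_nonneg])
        also have "\<dots> \<le> ennreal (L\<^sup>2 * 2 powr \<delta> * (\<rho> j)\<^sup>2 / \<rho> j powr \<delta> * (C * \<rho> j powr \<delta>))"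
          using \<rho>[of j] by (intro ennreal_leI mult_left_mono C(3)) auto
        also have "L\<^sup>2 * 2 powr \<delta> * (\<rho> j)\<^sup>2 / \<rho> j powr \<delta> * (C * \<rho> j powr \<delta>) = K2 j"
        proof -
          have "(\<rho> j)\<^sup>2 = r0\<^sup>2 * (1/4)^j"
            by (simp add: \<rho>_def power_mult_distrib power_mult[symmetric] mult.commute[of _ 2])
              (simp add: power_mult power2_eq_square)
          then show ?thesis
            using \<rho>[of j] by (simp add: K2_def)
        qed
        finally show "ennreal (L\<^sup>2 * 2 powr \<delta> * (\<rho> j)\<^sup>2 / \<rho> j powr \<delta>) * emeasure M (cball x (\<rho> j)) \<le> ennreal (K2 j)" .
      qed auto
      also have "(\<Sum>j. ennreal (K2 j)) = ennreal (\<Sum>j. K2 j)"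
        by (intro suminf_ennreal2 sumK2) (use C in \<open>auto simp: K2_def\<close>)
      also have "ennreal K1 + ennreal (\<Sum>j. K2 j) = ennreal (K1 + (\<Sum>j. K2 j))"
        using C by (intro ennreal_plus[symmetric] suminf_nonneg sumK2) (auto simp: K1_def K2_def)
      finally show ?thesis .
    qed
    then show ?thesis by blast
  qed
  then obtain K where K: "\<And>x. (\<integral>\<^sup>+y. ennreal ((diff_quotient f (x, y))\<^sup>2) \<partial>M) \<le> ennreal K"
    by blast
  have "(\<integral>\<^sup>+p. ennreal ((diff_quotient f p)\<^sup>2) \<partial>(M \<Otimes>\<^sub>M M)) =
      (\<integral>\<^sup>+x. \<integral>\<^sup>+y. ennreal ((diff_quotient f (x, y))\<^sup>2) \<partial>M \<partial>M)"
    by (rule nn_integral_fst[symmetric]) measurable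
  also have "\<dots> \<le> (\<integral>\<^sup>+x. ennreal K \<partial>M)"
    by (intro nn_integral_mono K)
  also have "\<dots> < \<infinity>"
    by (simp add: emeasure_eq_measure ennreal_mult_less_top)
  finally have "diff_quotient f \<in> L2 (M \<Otimes>\<^sub>M M)"
    by (simp add: L2_def integrable_iff_bounded)
  with fL show ?thesis
    by (simp add: form_domain_iff)
qed

text \<open>
  Density of the form domain, stated through orthogonal complements. Indicators of closed sets are
  limits of bounded Lipschitz functions, so the integral of \<open>h\<close> over every closed set vanishes, hence
  over every Borel set, in particular where \<open>h\<close> is positive and where it is negative.
\<close>

lemma orthogonal_form_domain_imp_zero:
  assumes h: "h \<in> L2 M" and orth: "\<And>g. g \<in> form_domain \<delta> M \<Longrightarrow> L2_inner M h g = 0"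
  shows "AE x in M. h x = 0"
proof -
  note [measurable] = L2_measurable[OF h]
  have hint: "integrable M h"
    using L2_mult_integrable[OF h indicator_L2[of UNIV]] by simp
  have hset: "set_integrable M A h" if "A \<in> sets borel" for A
    using L2_mult_integrable[OF h indicator_L2[OF that]]
    by (simp add: set_integrable_def mult.commute)
  have closed: "(LINT x:F|M. h x) = 0" if F: "closed F" for F
  proof (cases "F = {}")
    case True
    then show ?thesis by (simp add: set_lebesgue_integral_def)
  next
    case False
    define \<phi> where "\<phi> n x = max 0 (1 - real n * infdist x F)" for n x
    have \<phi>01: "0 \<le> \<phi> n x" "\<phi> n x \<le> 1" for n x
      by (auto simp: \<phi>_def infdist_nonneg)
    have \<phi>: "\<phi> n \<in> form_domain \<delta> M" for n
    proof (rule lipschitz_in_form_domain)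
      show "\<bar>\<phi> n x\<bar> \<le> 1" for x using \<phi>01[of n x] by simp
      fix x y
      have "\<bar>\<phi> n x - \<phi> n y\<bar> \<le> \<bar>real n * infdist x F - real n * infdist y F\<bar>"
        unfolding \<phi>_def by linarith
      also have "\<dots> = real n * \<bar>infdist x F - infdist y F\<bar>"
        by (simp add: right_diff_distrib[symmetric] abs_mult)
      also have "\<dots> \<le> real n * dist x y"
        by (intro mult_left_mono infdist_triangle_abs) simp
      finally show "\<bar>\<phi> n x - \<phi> n y\<bar> \<le> real n * dist x y" .
    qed
    have lim: "(\<lambda>n. \<phi> n x) \<longlonglongrightarrow> indicator F x" for x
    proof (cases "x \<in> F")
      case True
      then show ?thesis by (simp add: \<phi>_def)
    next
      case notF: False
      then have d: "infdist x F > 0"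
        using infdist_pos_not_in_closed[OF F False] by simp
      obtain N where N: "1 / infdist x F < real N"
        using reals_Archimedean2 by blast
      have "\<phi> n x = 0" if "n \<ge> N" for n
      proof -
        have "1 \<le> real N * infdist x F" using N d by (simp add: field_simps)
        also have "\<dots> \<le> real n * infdist x F" using that d by (intro mult_right_mono) auto
        finally show ?thesis by (simp add: \<phi>_def)
      qed
      then have "eventually (\<lambda>n. \<phi> n x = indicator F x) sequentially"
        using notF by (auto simp: eventually_sequentially)
      then show ?thesis by (rule tendsto_eventually)
    qed
    have "(\<lambda>n. \<integral>x. h x * \<phi> n x \<partial>M) \<longlonglongrightarrow> (\<integral>x. h x * indicator F x \<partial>M)"
    proof (rule integral_dominated_convergence[where w = "\<lambda>x. \<bar>h x\<bar>"])
      show "AE x in M. (\<lambda>n. h x * \<phi> n x) \<longlonglongrightarrow> h x * indicator F x"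
        by (intro AE_I2 tendsto_mult_left lim)
      show "AE x in M. norm (h x * \<phi> n x) \<le> \<bar>h x\<bar>" for n
        using \<phi>01 by (intro AE_I2) (simp add: abs_mult mult_left_le)
      have "F \<in> sets M" using F by (simp add: sets_M)
      then show "(\<lambda>x. h x * indicator F x) \<in> borel_measurable M" by measurable
      show "(\<lambda>x. h x * \<phi> n x) \<in> borel_measurable M" for n
        using L2_measurable[OF form_domain_L2[OF \<phi>[of n]]] by measurable
    qed (use hint in auto)
    moreover have "(\<integral>x. h x * \<phi> n x \<partial>M) = 0" for n
      using orth[OF \<phi>[of n]] by (simp add: L2_inner_def)
    ultimately show ?thesis
      by (simp add: set_lebesgue_integral_def mult.commute LIMSEQ_const_iff)
  qed
  have all: "(LINT x:A|M. h x) = 0" if "A \<in> sets borel" for A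
  proof -
    have *: "Int_stable (Collect closed :: 'a set set)" "Collect closed \<subseteq> Pow (UNIV :: 'a set)"
      by (auto simp: Int_stable_def)
    have sets: "(sets borel :: 'a set set) = sigma_sets UNIV (Collect closed)"
      unfolding borel_eq_closed by simp
    have "A \<in> sigma_sets UNIV (Collect closed)" using that sets by simp
    with * show ?thesis
    proof (induction rule: sigma_sets_induct_disjoint)
      case (basic A)
      then show ?case by (simp add: closed)
    next
      case empty
      then show ?case by (simp add: set_lebesgue_integral_def)
    next
      case (compl A)
      have A: "A \<in> sets M" using compl by (simp add: sets sets_M)
      have "(LINT x:UNIV|M. h x) = (LINT x:A \<union> (UNIV - A)|M. h x)" by simp
      also have "\<dots> = (LINT x:A|M. h x) + (LINT x:UNIV - A|M. h x)"
        using A by (intro set_integral_Un hset) (auto simp: sets_M)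
      finally show ?case
        using compl closed[of UNIV] by simp
    next
      case (union A)
      have A: "A i \<in> sets M" for i using union by (auto simp: sets sets_M)
      have "(LINT x:(\<Union>i. A i)|M. h x) = (\<Sum>i. (LINT x:(A i)|M. h x))"
        using A union by (intro lebesgue_integral_countable_add hset) (auto simp: disjoint_family_on_def sets_M)
      then show ?case using union by simp
    qed
  qed
  have pos: "AE x in M. s * h x \<le> 0" for s :: real
  proof -
    have A: "{x. s * h x > 0} \<in> sets M"
      using borel_measurable_less[of "\<lambda>_. 0" M "\<lambda>x. s * h x"] by (simp add: space_M)
    then have A': "{x. s * h x > 0} \<in> sets borel" by (simp add: sets_M)
    have int: "integrable M (\<lambda>x. s * (indicator {x. s * h x > 0} x * h x))"
      using hset[OF A'] by (simp add: set_integrable_def)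
    have "(\<integral>x. s * (indicator {x. s * h x > 0} x * h x) \<partial>M) = 0"
      using all[OF A'] by (simp add: set_lebesgue_integral_def)
    then have "AE x in M. s * (indicator {x. s * h x > 0} x * h x) = 0"
      by (subst (asm) integral_nonneg_eq_0_iff_AE[OF int]) (auto simp: indicator_def)
    then show ?thesis
      by eventually_elim (auto simp: indicator_def split: if_splits)
  qed
  show ?thesis
    using pos[of 1] pos[of "-1"] by eventually_elim auto
qed

end

section \<open>An orthonormal basis of eigenfunctions\<close>

text \<open>
  Vectors may vanish. This allows the index set to be the natural numbers even when \<open>L\<^sup>2\<close> has finite
  dimension, as it does over a one-point space.
\<close>

locale L2_orthonormal = finite_measure M for M :: "'a measure" +
  fixes e :: "nat \<Rightarrow> 'a \<Rightarrow> real"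
  assumes e_L2: "\<And>k. e k \<in> L2 M"
    and e_orth: "\<And>i j. i \<noteq> j \<Longrightarrow> L2_inner M (e i) (e j) = 0"
    and e_norm: "\<And>k. L2_inner M (e k) (e k) = 1 \<or> L2_inner M (e k) (e k) = 0"
begin

lemma coeff_absorb:
  assumes "u \<in> L2 M"
  shows "L2_inner M u (e k) * L2_inner M (e k) (e k) = L2_inner M u (e k)"
  using e_norm[of k] L2_inner_null[OF e_L2 assms, of k] by (auto simp: L2_inner_commute)

lemma coeff_partial_sum:
  assumes "finite I"
  shows "L2_inner M (\<lambda>x. \<Sum>k\<in>I. a k * e k x) (e i) = (if i \<in> I then a i * L2_inner M (e i) (e i) else 0)"
proof -
  have "L2_inner M (\<lambda>x. \<Sum>k\<in>I. a k * e k x) (e i) = (\<Sum>k\<in>I. a k * L2_inner M (e k) (e i))"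
    by (intro L2_inner_sum_left e_L2)
  also have "\<dots> = (\<Sum>k\<in>I. if k = i then a i * L2_inner M (e i) (e i) else 0)"
    by (intro sum.cong refl) (simp add: e_orth)
  also have "\<dots> = (if i \<in> I then a i * L2_inner M (e i) (e i) else 0)"
    using assms by simp
  finally show ?thesis .
qed

end

locale L2_eigenbasis = L2_orthonormal +
  fixes lam :: "nat \<Rightarrow> real"
  assumes complete: "\<And>u. u \<in> L2 M \<Longrightarrow> (\<And>k. L2_inner M u (e k) = 0) \<Longrightarrow> AE x in M. u x = 0"
    and lam_at_top: "filterlim lam at_top sequentially"

context ahlfors_regular_space
begin

text \<open>
  The Rayleigh principle for the \<open>n\<close>-th eigenpair. When the orthogonal complement of the previous
  functions contains no nonzero vector, the eigenfunction is \<open>0\<close>, and the value \<open>n\<close> keeps the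
  eigenvalues tending to infinity.
\<close>

definition constrained_minimizer ::
    "(nat \<Rightarrow> 'a \<Rightarrow> real) \<Rightarrow> nat \<Rightarrow> ('a \<Rightarrow> real) \<Rightarrow> real \<Rightarrow> bool" where
  "constrained_minimizer prev n e l \<longleftrightarrow>
     e \<in> form_domain \<delta> M \<and> (\<forall>j<n. L2_inner M e (prev j) = 0) \<and> l \<ge> 0 \<and>
     (\<forall>g\<in>form_domain \<delta> M. (\<forall>j<n. L2_inner M g (prev j) = 0) \<longrightarrow>
        l * L2_inner M g g \<le> energy_form \<delta> M g g) \<and>
     (L2_inner M e e = 1 \<and> energy_form \<delta> M e e = l \<or> e = (\<lambda>x. 0) \<and> l = real n)"

text \<open>
  The direct method: a minimizing sequence has bounded norm and energy, hence a subsequence converging in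
  \<open>L\<^sup>2\<close>. The constraints are continuous and the energy is lower semicontinuous.
\<close>

lemma constrained_minimizer_exists:
  assumes prev: "\<And>j. j < n \<Longrightarrow> prev j \<in> L2 M"
  shows "\<exists>e l. constrained_minimizer prev n e l"
proof -
  define S where "S = {g \<in> form_domain \<delta> M. (\<forall>j<n. L2_inner M g (prev j) = 0) \<and> L2_inner M g g = 1}"
  have normalize: "\<exists>a. a > 0 \<and> a\<^sup>2 * L2_inner M g g = 1 \<and> (\<lambda>x. a * g x) \<in> S"
    if g: "g \<in> form_domain \<delta> M" "\<And>j. j < n \<Longrightarrow> L2_inner M g (prev j) = 0" "L2_inner M g g \<noteq> 0" for g
  proof -
    have pos: "L2_inner M g g > 0"
      using g(3) L2_inner_nonneg[of M g] by linarith
    define a where "a = 1 / sqrt (L2_inner M g g)"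
    have a: "a > 0" "a\<^sup>2 * L2_inner M g g = 1"
      using pos by (simp_all add: a_def power_divide)
    then have "(\<lambda>x. a * g x) \<in> S"
      using g by (simp add: S_def form_domain_scale L2_inner_scale_left L2_inner_scale_right power2_eq_square mult.assoc)
    with a show ?thesis by blast
  qed
  show ?thesis
  proof (cases "S = {}")
    case True
    have "real n * L2_inner M g g \<le> energy_form \<delta> M g g"
      if g: "g \<in> form_domain \<delta> M" "\<And>j. j < n \<Longrightarrow> L2_inner M g (prev j) = 0" for g
      using normalize[OF g] True energy_form_nonneg[OF g(1)] by (cases "L2_inner M g g = 0") auto
    then have "constrained_minimizer prev n (\<lambda>x. 0) (real n)"
      by (simp add: constrained_minimizer_def form_domain_zero L2_inner_zero)
    then show ?thesis by blast
  next
    case False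
    define l where "l = Inf ((\<lambda>g. energy_form \<delta> M g g) ` S)"
    have SD: "g \<in> form_domain \<delta> M" if "g \<in> S" for g
      using that by (simp add: S_def)
    have bdd: "bdd_below ((\<lambda>g. energy_form \<delta> M g g) ` S)"
      by (rule bdd_belowI[of _ 0]) (auto intro: energy_form_nonneg SD)
    have l_le: "l \<le> energy_form \<delta> M g g" if "g \<in> S" for g
      unfolding l_def using that bdd by (intro cInf_lower) auto
    have l0: "l \<ge> 0"
      unfolding l_def using False by (intro cInf_greatest) (auto intro: energy_form_nonneg SD)
    have "\<exists>g\<in>S. energy_form \<delta> M g g \<le> l + 1 / real (Suc m)" for m
    proof -
      have "\<exists>y\<in>(\<lambda>g. energy_form \<delta> M g g) ` S. y < l + 1 / real (Suc m)"
        unfolding l_def using False by (intro cInf_lessD) auto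
      then show ?thesis by (auto intro: less_imp_le)
    qed
    then obtain g where g: "\<And>m. g m \<in> S" "\<And>m. energy_form \<delta> M (g m) (g m) \<le> l + 1 / real (Suc m)"
      by metis
    have gD: "g m \<in> form_domain \<delta> M" for m using g(1) by (rule SD)
    have gL: "g m \<in> L2 M" for m using gD by (rule form_domain_L2)
    have 1: "L2_inner M (g m) (g m) \<le> l + 1" for m
      using g(1)[of m] l0 by (simp add: S_def)
    have 2: "energy_form \<delta> M (g m) (g m) \<le> l + 1" for m
    proof -
      have "1 / real (Suc m) \<le> 1" by simp
      with g(2)[of m] show ?thesis by linarith
    qed
    obtain r h where r: "strict_mono r" and h: "h \<in> L2 M" "(\<lambda>n. L2_sqdist M (g (r n)) h) \<longlonglongrightarrow> 0"
      by (rule form_domain_compact_embedding[of g "l + 1", OF gD 1 2])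
    have "(\<lambda>m. l + 1 / real (Suc m)) \<longlonglongrightarrow> l + 0"
      by (intro tendsto_add tendsto_const LIMSEQ_Suc lim_1_over_n)
    then have "(\<lambda>m. l + 1 / real (Suc (r m))) \<longlonglongrightarrow> l"
      using LIMSEQ_subseq_LIMSEQ[OF _ r, of "\<lambda>m. l + 1 / real (Suc m)" l] by (simp add: comp_def)
    note lsc = energy_lower_semicontinuous[of "\<lambda>n. g (r n)", OF gD h g(2) this]
    have "(\<lambda>m. L2_inner M (g (r m)) (g (r m))) \<longlonglongrightarrow> L2_inner M h h"
      by (rule L2_inner_self_tendsto[OF gL h])
    moreover have "L2_inner M (g m) (g m) = 1" for m
      using g(1)[of m] by (simp add: S_def)
    ultimately have hn: "L2_inner M h h = 1"
      by (simp add: LIMSEQ_const_iff)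
    have ho: "L2_inner M h (prev j) = 0" if "j < n" for j
    proof -
      have "(\<lambda>m. L2_inner M (g (r m)) (prev j)) \<longlonglongrightarrow> L2_inner M h (prev j)"
        by (rule L2_inner_tendsto[OF gL h(1) prev[OF that] h(2)])
      moreover have "L2_inner M (g m) (prev j) = 0" for m
        using g(1)[of m] that by (simp add: S_def)
      ultimately show ?thesis by (simp add: LIMSEQ_const_iff)
    qed
    have "h \<in> S" using lsc(1) hn ho by (simp add: S_def)
    then have hE: "energy_form \<delta> M h h = l"
      using lsc(2) l_le by fastforce
    have "l * L2_inner M g g \<le> energy_form \<delta> M g g"
      if g: "g \<in> form_domain \<delta> M" "\<And>j. j < n \<Longrightarrow> L2_inner M g (prev j) = 0" for g
    proof (cases "L2_inner M g g = 0")
      case True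
      then show ?thesis using energy_form_nonneg[OF g(1)] by simp
    next
      case False
      from normalize[OF g this] obtain a where a: "a > 0" "a\<^sup>2 * L2_inner M g g = 1" "(\<lambda>x. a * g x) \<in> S"
        by blast
      have "l \<le> a\<^sup>2 * energy_form \<delta> M g g"
        using l_le[OF a(3)] energy_form_self_lin[OF g(1) g(1), of a 0] by simp
      then have "a\<^sup>2 * (l * L2_inner M g g) \<le> a\<^sup>2 * energy_form \<delta> M g g"
        using a(2) by (simp add: mult.left_commute)
      then show ?thesis using a(1) by simp
    qed
    then have "constrained_minimizer prev n h l"
      using lsc(1) hn ho hE l0 by (simp add: constrained_minimizer_def)
    then show ?thesis by blast
  qed
qed

lemma minimizing_sequence_exists:
  obtains e :: "nat \<Rightarrow> 'a \<Rightarrow> real" and lam :: "nat \<Rightarrow> real"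
  where "\<And>n. constrained_minimizer e n (e n) (lam n)"
proof -
  define P where "P f n p \<longleftrightarrow> constrained_minimizer (\<lambda>j. fst (f j)) n (fst p) (snd p)"
    for f :: "nat \<Rightarrow> ('a \<Rightarrow> real) \<times> real" and n p
  have "\<exists>f. \<forall>n. P f n (f n)"
  proof (rule dependent_wellorder_choice)
    fix r and f g :: "nat \<Rightarrow> ('a \<Rightarrow> real) \<times> real" and n
    assume "\<And>y. y < n \<Longrightarrow> f y = g y"
    then show "P f n r = P g n r"
      by (simp add: P_def constrained_minimizer_def)
  next
    fix n and f :: "nat \<Rightarrow> ('a \<Rightarrow> real) \<times> real"
    assume "\<And>y. y < n \<Longrightarrow> P f y (f y)"
    then have "fst (f y) \<in> L2 M" if "y < n" for y
      using that by (auto simp: P_def constrained_minimizer_def intro: form_domain_L2)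
    from constrained_minimizer_exists[of n "\<lambda>j. fst (f j)", OF this]
    obtain e l where "constrained_minimizer (\<lambda>j. fst (f j)) n e l" by blast
    then show "\<exists>p. P f n p"
      by (intro exI[of _ "(e, l)"]) (simp add: P_def)
  qed
  then obtain f where "\<And>n. P f n (f n)" by blast
  then show thesis
    by (intro that[of "\<lambda>n. fst (f n)" "\<lambda>n. snd (f n)"]) (simp add: P_def)
qed

text \<open>
  The eigenvalue equation is the first-order condition at the minimum for variations orthogonal to the
  previous eigenfunctions, and holds by induction for the remaining directions. Infinitely many eigenvalues below a
  bound would give an orthonormal sequence of bounded energy, which has no convergent subsequence.
  Finally the remainder of the expansion of \<open>g\<close> after \<open>n\<close> terms has energy at most \<open>\<E>(g, g)\<close>, hence squared norm
  at most \<open>\<E>(g, g) / \<lambda>\<^sub>n\<close>; so the expansion converges on the form domain, and completeness follows by density.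
\<close>

theorem eigenbasis_exists:
  obtains e :: "nat \<Rightarrow> 'a \<Rightarrow> real" and lam :: "nat \<Rightarrow> real"
  where "L2_eigenbasis M e lam" "\<And>k. e k \<in> form_domain \<delta> M"
    "\<And>k g. g \<in> form_domain \<delta> M \<Longrightarrow> energy_form \<delta> M (e k) g = lam k * L2_inner M (e k) g"
proof -
  obtain e lam where min: "\<And>n. constrained_minimizer e n (e n) (lam n)"
    by (rule minimizing_sequence_exists) blast
  note min = min[unfolded constrained_minimizer_def]
  have eD: "e k \<in> form_domain \<delta> M" for k
    using min[of k] by blast
  have eL: "e k \<in> L2 M" for k
    using eD by (rule form_domain_L2)
  have lam0: "lam k \<ge> 0" for k
    using min[of k] by blast
  have e_cases: "L2_inner M (e k) (e k) = 1 \<and> energy_form \<delta> M (e k) (e k) = lam k \<or>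
      e k = (\<lambda>x. 0) \<and> lam k = real k" for k
    using min[of k] by blast
  have min_le: "lam n * L2_inner M g g \<le> energy_form \<delta> M g g"
    if "g \<in> form_domain \<delta> M" "\<And>j. j < n \<Longrightarrow> L2_inner M g (e j) = 0" for n g
    using min[of n] that by blast
  have orth_less: "L2_inner M (e i) (e j) = 0" if "j < i" for i j
    using min[of i] that by blast
  have orth: "L2_inner M (e i) (e j) = 0" if "i \<noteq> j" for i j
    using that orth_less[of i j] orth_less[of j i] by (cases "i < j") (auto simp: L2_inner_commute)
  interpret on: L2_orthonormal M e
  proof unfold_locales
    show "L2_inner M (e k) (e k) = 1 \<or> L2_inner M (e k) (e k) = 0" for k
      using e_cases[of k]
    proof
      assume "e k = (\<lambda>x. 0) \<and> lam k = real k"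
      then have "e k = (\<lambda>x. 0)" ..
      then show ?thesis by (simp only: L2_inner_zero simp_thms)
    qed blast
  qed (use eL orth in auto)
  define pr where "pr n g x = (\<Sum>k<n. L2_inner M g (e k) * e k x)" for n :: nat and g x
  have prD: "pr n g \<in> form_domain \<delta> M" for n g
    unfolding pr_def by (intro form_domain_sum eD)
  have prL: "pr n g \<in> L2 M" for n g using prD by (rule form_domain_L2)
  have pr_coeff: "L2_inner M (pr n g) (e i) = (if i < n then L2_inner M g (e i) else 0)"
    if "g \<in> L2 M" for n g i
    unfolding pr_def using that by (simp add: on.coeff_partial_sum on.coeff_absorb)
  have res_orth: "L2_inner M (\<lambda>x. g x - pr n g x) (e j) = 0" if "g \<in> L2 M" "j < n" for g n j
    using that by (simp add: L2_inner_diff_left prL eL pr_coeff)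
  have eigen: "\<forall>g\<in>form_domain \<delta> M. energy_form \<delta> M (e k) g = lam k * L2_inner M (e k) g" for k
  proof (induction k rule: less_induct)
    case (less k)
    show ?case
    proof
      fix g assume g: "g \<in> form_domain \<delta> M"
      have gL: "g \<in> L2 M" using g by (rule form_domain_L2)
      from e_cases[of k] show "energy_form \<delta> M (e k) g = lam k * L2_inner M (e k) g"
      proof
        assume "e k = (\<lambda>x. 0) \<and> lam k = real k"
        then show ?thesis by (simp add: energy_form_zero L2_inner_zero)
      next
        assume k: "L2_inner M (e k) (e k) = 1 \<and> energy_form \<delta> M (e k) (e k) = lam k"
        define g' where "g' x = g x - pr k g x" for x
        have g': "g' \<in> form_domain \<delta> M"
          unfolding g'_def by (intro form_domain_diff g prD)
        have g'L: "g' \<in> L2 M" using g' by (rule form_domain_L2)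
        have g'o: "L2_inner M g' (e j) = 0" if "j < k" for j
          unfolding g'_def using gL that by (rule res_orth)
        have "(energy_form \<delta> M (e k) g' - lam k * L2_inner M (e k) g')\<^sup>2 \<le>
            0 * (energy_form \<delta> M g' g' - lam k * L2_inner M g' g')"
        proof (rule quadratic_nonneg_discriminant)
          show "0 \<le> energy_form \<delta> M g' g' - lam k * L2_inner M g' g'"
            using min_le[OF g' g'o] by simp
          fix t
          have D: "(\<lambda>x. 1 * e k x + t * g' x) \<in> form_domain \<delta> M"
            by (intro form_domain_lin eD g')
          have "L2_inner M (\<lambda>x. 1 * e k x + t * g' x) (e j) = 0" if "j < k" for j
            using that by (subst L2_inner_lin_left) (auto simp: eL g'L g'o orth)
          from min_le[OF D this]
          have "lam k * L2_inner M (\<lambda>x. 1 * e k x + t * g' x) (\<lambda>x. 1 * e k x + t * g' x) \<le>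
              energy_form \<delta> M (\<lambda>x. 1 * e k x + t * g' x) (\<lambda>x. 1 * e k x + t * g' x)" .
          then show "0 \<le> 0 + 2 * (energy_form \<delta> M (e k) g' - lam k * L2_inner M (e k) g') * t +
              (energy_form \<delta> M g' g' - lam k * L2_inner M g' g') * t\<^sup>2"
            unfolding energy_form_self_lin[OF eD g'] L2_inner_self_lin[OF eL g'L]
            using k by (simp add: algebra_simps)
        qed
        then have eq': "energy_form \<delta> M (e k) g' = lam k * L2_inner M (e k) g'"
          by simp
        have "energy_form \<delta> M (pr k g) (e k) = (\<Sum>j<k. L2_inner M g (e j) * energy_form \<delta> M (e j) (e k))"
          unfolding pr_def by (intro energy_form_sum_left eD)
        also have "\<dots> = 0"
          using less.IH eD orth by (intro sum.neutral) auto
        finally have 1: "energy_form \<delta> M (e k) (pr k g) = 0"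
          by (simp add: energy_form_commute)
        have 2: "L2_inner M (e k) (pr k g) = 0"
          using pr_coeff[OF gL, of k k] by (simp add: L2_inner_commute)
        have "energy_form \<delta> M (e k) g' = energy_form \<delta> M (e k) g"
          unfolding g'_def using energy_form_diff_left[OF g prD eD] 1 by (simp add: energy_form_commute)
        moreover have "L2_inner M (e k) g' = L2_inner M (e k) g"
          unfolding g'_def using 2 by (simp add: L2_inner_diff_right gL prL eL)
        ultimately show ?thesis using eq' by simp
      qed
    qed
  qed
  have lam_top: "filterlim lam at_top sequentially"
  proof (rule ccontr)
    assume "\<not> filterlim lam at_top sequentially"
    then obtain Z where "\<not> eventually (\<lambda>k. Z \<le> lam k) sequentially"
      by (auto simp: filterlim_at_top)
    then have inf: "\<exists>k\<ge>N. lam k < Z" for N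
      by (auto simp: eventually_sequentially not_le)
    define A where "A = {k. lam k < Z \<and> L2_inner M (e k) (e k) = 1 \<and> energy_form \<delta> M (e k) (e k) = lam k}"
    have "infinite A"
      unfolding infinite_nat_iff_unbounded_le
    proof
      fix m
      obtain k where k: "k \<ge> max m (nat \<lceil>Z\<rceil>)" "lam k < Z" using inf by blast
      \<comment> \<open>this index is too large for the exceptional eigenvalue \<open>k\<close> of a vanishing \<open>e k\<close>\<close>
      then have "real k \<ge> Z" by linarith
      with k(2) e_cases[of k] have "k \<in> A" by (auto simp: A_def)
      with k(1) show "\<exists>n\<ge>m. n \<in> A" by auto
    qed
    then obtain s :: "nat \<Rightarrow> nat" where s: "strict_mono s" "\<And>n. s n \<in> A"
      using infinite_enumerate by blast
    have 1: "L2_inner M (e (s n)) (e (s n)) \<le> max 1 Z" "energy_form \<delta> M (e (s n)) (e (s n)) \<le> max 1 Z" for n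
      using s(2)[of n] by (auto simp: A_def)
    obtain r h where r: "strict_mono r" "h \<in> L2 M" "(\<lambda>n. L2_sqdist M (e (s (r n))) h) \<longlonglongrightarrow> 0"
      by (rule form_domain_compact_embedding[of "\<lambda>n. e (s n)" "max 1 Z", OF eD 1])
    have "eventually (\<lambda>n. L2_sqdist M (e (s (r n))) h < 1/4) sequentially"
      using r(3) by (intro order_tendstoD) auto
    then obtain N where N: "\<And>n. n \<ge> N \<Longrightarrow> L2_sqdist M (e (s (r n))) h < 1/4"
      by (auto simp: eventually_sequentially)
    define i j where "i = s (r N)" and "j = s (r (Suc N))"
    have "i < j"
      using r(1) s(1) by (simp add: i_def j_def strict_mono_def)
    then have "L2_sqdist M (e i) (e j) = 2"
      using s(2)[of "r N"] s(2)[of "r (Suc N)"]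
      by (simp add: L2_sqdist_def L2_inner_self_diff eL orth A_def i_def[symmetric] j_def[symmetric])
    moreover have "L2_sqdist M (e i) (e j) \<le> 2 * L2_sqdist M (e i) h + 2 * L2_sqdist M h (e j)"
      by (intro L2_sqdist_triangle eL r(2))
    ultimately show False
      using N[of N] N[of "Suc N"] by (simp add: i_def j_def L2_sqdist_commute)
  qed
  have pr_tendsto: "(\<lambda>n. L2_sqdist M (pr n g) g) \<longlonglongrightarrow> 0" if g: "g \<in> form_domain \<delta> M" for g
  proof (rule tendsto_sandwich[OF _ _ tendsto_const])
    have gL: "g \<in> L2 M" using g by (rule form_domain_L2)
    have le: "lam n * L2_sqdist M (pr n g) g \<le> energy_form \<delta> M g g" for n
    proof -
      have D: "(\<lambda>x. g x - pr n g x) \<in> form_domain \<delta> M"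
        by (intro form_domain_diff g prD)
      have E1: "energy_form \<delta> M (pr n g) h = (\<Sum>k<n. L2_inner M g (e k) * (lam k * L2_inner M (e k) h))"
        if "h \<in> form_domain \<delta> M" for h
        unfolding pr_def using eigen that by (subst energy_form_sum_left) (auto simp: eD)
      have "lam n * L2_sqdist M (pr n g) g \<le> energy_form \<delta> M (\<lambda>x. g x - pr n g x) (\<lambda>x. g x - pr n g x)"
        by (subst L2_sqdist_commute, unfold L2_sqdist_def) (rule min_le[OF D res_orth[OF gL]])
      also have "\<dots> = energy_form \<delta> M g g - 2 * energy_form \<delta> M (pr n g) g + energy_form \<delta> M (pr n g) (pr n g)"
        using energy_form_self_lin[OF g prD, of 1 "-1"] by (simp add: energy_form_commute)
      also have "energy_form \<delta> M (pr n g) (pr n g) = energy_form \<delta> M (pr n g) g"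
        unfolding E1[OF g] E1[OF prD] using pr_coeff[OF gL]
        by (intro sum.cong) (auto simp: L2_inner_commute)
      also have "energy_form \<delta> M (pr n g) g = (\<Sum>k<n. lam k * (L2_inner M g (e k))\<^sup>2)"
        unfolding E1[OF g] by (intro sum.cong) (auto simp: L2_inner_commute power2_eq_square)
      also have "energy_form \<delta> M g g - 2 * (\<Sum>k<n. lam k * (L2_inner M g (e k))\<^sup>2) + (\<Sum>k<n. lam k * (L2_inner M g (e k))\<^sup>2)
          \<le> energy_form \<delta> M g g"
        using sum_nonneg[of "{..<n}" "\<lambda>k. lam k * (L2_inner M g (e k))\<^sup>2"] lam0 by simp
      finally show ?thesis .
    qed
    show "eventually (\<lambda>n. L2_sqdist M (pr n g) g \<le> energy_form \<delta> M g g / lam n) sequentially"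
      using filterlim_at_top_dense[THEN iffD1, OF lam_top, rule_format, of 0]
    proof eventually_elim
      case (elim n)
      with le[of n] show ?case by (simp add: field_simps)
    qed
    show "(\<lambda>n. energy_form \<delta> M g g / lam n) \<longlonglongrightarrow> 0"
      by (intro tendsto_divide_0[OF tendsto_const] filterlim_at_top_imp_at_infinity lam_top)
  qed (auto simp: L2_sqdist_nonneg)
  have complete: "AE x in M. u x = 0" if u: "u \<in> L2 M" "\<And>k. L2_inner M u (e k) = 0" for u
  proof (rule orthogonal_form_domain_imp_zero[OF u(1)])
    fix g assume g: "g \<in> form_domain \<delta> M"
    have "(\<lambda>n. L2_inner M (pr n g) u) \<longlonglongrightarrow> L2_inner M g u"
      by (rule L2_inner_tendsto[OF prL form_domain_L2[OF g] u(1) pr_tendsto[OF g]])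
    moreover have "L2_inner M (pr n g) u = 0" for n
    proof -
      have "L2_inner M (pr n g) u = (\<Sum>k<n. L2_inner M g (e k) * L2_inner M (e k) u)"
        unfolding pr_def by (intro L2_inner_sum_left eL u(1))
      also have "\<dots> = 0" using u(2) by (simp add: L2_inner_commute)
      finally show ?thesis .
    qed
    ultimately show "L2_inner M u g = 0"
      by (simp add: LIMSEQ_const_iff L2_inner_commute)
  qed
  have "L2_eigenbasis M e lam"
    by unfold_locales (use complete lam_top in auto)
  with eD eigen that show thesis by blast
qed

end

section \<open>Operators that are diagonal in an eigenbasis\<close>

context L2_eigenbasis
begin

abbreviation coeff :: "('a \<Rightarrow> real) \<Rightarrow> nat \<Rightarrow> real" where
  "coeff u k \<equiv> L2_inner M u (e k)"

lemma coeff_lin: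
  "u \<in> L2 M \<Longrightarrow> v \<in> L2 M \<Longrightarrow> coeff (\<lambda>x. a * u x + b * v x) k = a * coeff u k + b * coeff v k"
  by (rule L2_inner_lin_left[OF _ _ e_L2])

lemma L2_eqI:
  assumes "u \<in> L2 M" "v \<in> L2 M" "\<And>k. coeff u k = coeff v k"
  shows "AE x in M. u x = v x"
proof -
  have "AE x in M. u x - v x = 0"
    using assms by (intro complete L2_diff) (simp_all add: L2_inner_diff_left e_L2)
  then show ?thesis by simp
qed

lemma partial_sum_L2: "(\<lambda>x. \<Sum>k\<in>I. a k * e k x) \<in> L2 M"
  by (intro L2_sum e_L2)

lemma partial_sum_self:
  assumes "finite I"
  shows "L2_inner M (\<lambda>x. \<Sum>k\<in>I. a k * e k x) (\<lambda>x. \<Sum>k\<in>I. a k * e k x) = (\<Sum>k\<in>I. (a k)\<^sup>2 * coeff (e k) k)"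
proof -
  have "L2_inner M (\<lambda>x. \<Sum>k\<in>I. a k * e k x) (\<lambda>x. \<Sum>k\<in>I. a k * e k x) =
      (\<Sum>k\<in>I. a k * L2_inner M (e k) (\<lambda>x. \<Sum>k\<in>I. a k * e k x))"
    by (intro L2_inner_sum_left e_L2 partial_sum_L2)
  also have "\<dots> = (\<Sum>k\<in>I. (a k)\<^sup>2 * coeff (e k) k)"
    using assms by (intro sum.cong refl)
      (subst L2_inner_commute, simp add: coeff_partial_sum power2_eq_square mult.assoc)
  finally show ?thesis .
qed

text \<open>
  The second hypothesis says that \<open>a\<close> vanishes where the basis vector does.
\<close>

lemma Riesz_Fischer:
  assumes sum: "summable (\<lambda>k. (a k)\<^sup>2)" and a: "\<And>k. a k * coeff (e k) k = a k"
  obtains w where "w \<in> L2 M" "\<And>k. coeff w k = a k"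
    "(\<lambda>n. L2_sqdist M (\<lambda>x. \<Sum>k<n. a k * e k x) w) \<longlonglongrightarrow> 0"
proof -
  define S where "S n x = (\<Sum>k<n. a k * e k x)" for n :: nat and x
  have SL: "S n \<in> L2 M" for n
    unfolding S_def by (rule partial_sum_L2)
  have dist: "L2_sqdist M (S n) (S m) = (\<Sum>k\<in>{m..<n}. (a k)\<^sup>2)" if "m \<le> n" for m n
  proof -
    have "S n x - S m x = (\<Sum>k\<in>{m..<n}. a k * e k x)" for x
      unfolding S_def using sum_diff_nat_ivl[of 0 m n "\<lambda>k. a k * e k x"] that
      by (simp add: lessThan_atLeast0)
    then have "L2_sqdist M (S n) (S m) = (\<Sum>k\<in>{m..<n}. (a k)\<^sup>2 * coeff (e k) k)"
      by (simp add: L2_sqdist_def partial_sum_self)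
    also have "\<dots> = (\<Sum>k\<in>{m..<n}. (a k)\<^sup>2)"
      by (intro sum.cong refl) (simp add: power2_eq_square mult.assoc a)
    finally show ?thesis .
  qed
  have "\<exists>N. \<forall>m\<ge>N. \<forall>n\<ge>N. L2_sqdist M (S m) (S n) \<le> \<epsilon>" if "\<epsilon> > 0" for \<epsilon> :: real
  proof -
    obtain N where N: "\<And>m n. m \<ge> N \<Longrightarrow> norm (\<Sum>k\<in>{m..<n}. (a k)\<^sup>2) < \<epsilon>"
      using sum \<open>\<epsilon> > 0\<close> unfolding summable_Cauchy by blast
    have "L2_sqdist M (S m) (S n) \<le> \<epsilon>" if mn: "m \<ge> N" "n \<ge> N" for m n
    proof (cases "m \<le> n")
      case True
      then show ?thesis
        using dist[OF True] N[OF mn(1), of n] by (simp add: L2_sqdist_commute)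
    next
      case False
      then show ?thesis
        using dist[of n m] N[OF mn(2), of m] by simp
    qed
    then show ?thesis by blast
  qed
  from L2_complete[of S, OF SL this] obtain w where
    w: "w \<in> L2 M" "(\<lambda>n. L2_sqdist M (S n) w) \<longlonglongrightarrow> 0" by blast
  have "coeff w k = a k" for k
  proof -
    have "(\<lambda>n. coeff (S n) k) \<longlonglongrightarrow> coeff w k"
      by (rule L2_inner_tendsto[OF SL w(1) e_L2 w(2)])
    moreover have "coeff (S n) k = a k" if "n > k" for n
      unfolding S_def using that by (simp add: coeff_partial_sum a)
    then have "(\<lambda>n. coeff (S n) k) \<longlonglongrightarrow> a k"
      by (intro tendsto_eventually) (auto simp: eventually_sequentially intro!: exI[of _ "Suc k"])
    ultimately show ?thesis by (rule LIMSEQ_unique)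
  qed
  with w that show thesis by (simp add: S_def[abs_def])
qed

lemma Bessel_summable:
  assumes u: "u \<in> L2 M"
  shows "summable (\<lambda>k. (coeff u k)\<^sup>2)"
proof (rule summableI_nonneg_bounded)
  fix n
  define S where "S x = (\<Sum>k<n. coeff u k * e k x)" for x
  have SL: "S \<in> L2 M"
    unfolding S_def by (rule partial_sum_L2)
  have "L2_inner M S S = (\<Sum>k<n. (coeff u k)\<^sup>2)"
    unfolding S_def by (simp add: partial_sum_self power2_eq_square mult.assoc coeff_absorb[OF u])
  moreover have "L2_inner M S u = (\<Sum>k<n. coeff u k * L2_inner M (e k) u)"
    unfolding S_def by (intro L2_inner_sum_left e_L2 u)
  then have "L2_inner M u S = (\<Sum>k<n. (coeff u k)\<^sup>2)"
    by (simp only: L2_inner_commute[of M u] power2_eq_square)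
  ultimately show "(\<Sum>k<n. (coeff u k)\<^sup>2) \<le> L2_inner M u u"
    using L2_inner_self_diff[OF u SL] L2_inner_nonneg[of M "\<lambda>x. u x - S x"] by simp
qed simp

lemma expansion:
  assumes u: "u \<in> L2 M"
  shows "(\<lambda>n. L2_sqdist M (\<lambda>x. \<Sum>k<n. coeff u k * e k x) u) \<longlonglongrightarrow> 0"
proof -
  obtain w where w: "w \<in> L2 M" "\<And>k. coeff w k = coeff u k"
    "(\<lambda>n. L2_sqdist M (\<lambda>x. \<Sum>k<n. coeff u k * e k x) w) \<longlonglongrightarrow> 0"
    using Riesz_Fischer[of "coeff u", OF Bessel_summable[OF u] coeff_absorb[OF u]] by blast
  have AE: "AE x in M. w x = u x"
    using w u by (intro L2_eqI) auto
  have "L2_sqdist M (\<lambda>x. \<Sum>k<n. coeff u k * e k x) w = L2_sqdist M (\<lambda>x. \<Sum>k<n. coeff u k * e k x) u" for n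
    unfolding L2_sqdist_def using AE
    by (intro L2_inner_cong_AE L2_diff partial_sum_L2 w u) (auto elim: eventually_mono)
  with w(3) show ?thesis by simp
qed

lemma Parseval:
  assumes u: "u \<in> L2 M" and v: "v \<in> L2 M"
  shows "(\<lambda>k. coeff u k * coeff v k) sums L2_inner M u v"
proof -
  have "(\<lambda>n. L2_inner M (\<lambda>x. \<Sum>k<n. coeff u k * e k x) v) \<longlonglongrightarrow> L2_inner M u v"
    by (rule L2_inner_tendsto[OF partial_sum_L2 u v expansion[OF u]])
  moreover have "L2_inner M (\<lambda>x. \<Sum>k<n. coeff u k * e k x) v = (\<Sum>k<n. coeff u k * coeff v k)" for n
    using L2_inner_sum_left[of "{..<n}" e M v "coeff u", OF e_L2 v] by (simp only: L2_inner_commute[of M v])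
  ultimately show ?thesis by (simp add: sums_def)
qed

lemma Parseval_self: "u \<in> L2 M \<Longrightarrow> (\<lambda>k. (coeff u k)\<^sup>2) sums L2_inner M u u"
  using Parseval[of u u] by (simp add: power2_eq_square)

lemma summable_coeff_mult:
  assumes "u \<in> L2 M" "v \<in> L2 M"
  shows "summable (\<lambda>k. \<bar>coeff u k * coeff v k\<bar>)"
proof (rule summable_comparison_test')
  show "summable (\<lambda>k. (coeff u k)\<^sup>2 + (coeff v k)\<^sup>2)"
    by (intro summable_add Bessel_summable assms)
  fix k
  have "2 * (\<bar>coeff u k\<bar> * \<bar>coeff v k\<bar>) \<le> (coeff u k)\<^sup>2 + (coeff v k)\<^sup>2"
    using sum_squares_bound[of "\<bar>coeff u k\<bar>" "\<bar>coeff v k\<bar>"] by (simp add: mult.assoc)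
  moreover have "0 \<le> \<bar>coeff u k\<bar> * \<bar>coeff v k\<bar>" by simp
  ultimately show "norm \<bar>coeff u k * coeff v k\<bar> \<le> (coeff u k)\<^sup>2 + (coeff v k)\<^sup>2"
    unfolding real_norm_def abs_abs abs_mult by linarith
qed

definition diagonal_graph :: "(nat \<Rightarrow> real) \<Rightarrow> 'a L2_graph" where
  "diagonal_graph m = {(u, w). u \<in> L2 M \<and> w \<in> L2 M \<and> (\<forall>k. coeff w k = m k * coeff u k)}"

lemma diagonal_graph_total:
  assumes u: "u \<in> L2 M" and m: "summable (\<lambda>k. (m k * coeff u k)\<^sup>2)"
  shows "\<exists>w. (u, w) \<in> diagonal_graph m"
proof -
  have "m k * coeff u k * coeff (e k) k = m k * coeff u k" for k
    using coeff_absorb[OF u, of k] by (simp add: mult.assoc)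
  from Riesz_Fischer[of "\<lambda>k. m k * coeff u k", OF m this] obtain w
    where "w \<in> L2 M" "\<And>k. coeff w k = m k * coeff u k" by blast
  with u show ?thesis by (auto simp: diagonal_graph_def)
qed

text \<open>
  The coordinates of a bounded sequence converge along a diagonal subsequence. The first \<open>N\<close> coordinates
  of the images then converge in norm, and the remaining ones are uniformly small because the multipliers are.
\<close>

theorem diagonal_graph_compact:
  assumes m: "m \<longlonglongrightarrow> 0"
  shows "compact_operator M (diagonal_graph m)"
  unfolding compact_operator_def
proof (intro conjI allI impI)
  have sq: "summable (\<lambda>k. (m k * coeff u k)\<^sup>2)" if u: "u \<in> L2 M" for u
  proof -
    from m have "Bseq m" by (rule convergent_imp_Bseq[OF convergentI])
    then obtain B where B: "\<And>k. \<bar>m k\<bar> \<le> B" by (auto simp: Bseq_def)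
    show ?thesis
    proof (rule summable_comparison_test')
      show "summable (\<lambda>k. B\<^sup>2 * (coeff u k)\<^sup>2)"
        by (intro summable_mult Bessel_summable u)
      fix k
      have "(m k)\<^sup>2 \<le> B\<^sup>2"
        using B[of k] by (simp add: abs_le_square_iff[symmetric])
      then show "norm ((m k * coeff u k)\<^sup>2) \<le> B\<^sup>2 * (coeff u k)\<^sup>2"
        by (simp add: power_mult_distrib mult_right_mono)
    qed
  qed
  show "everywhere_defined_operator M (diagonal_graph m)"
    unfolding everywhere_defined_operator_def
  proof (intro conjI)
    show "diagonal_graph m \<subseteq> L2 M \<times> L2 M"
      by (auto simp: diagonal_graph_def)
    show "\<forall>u\<in>L2 M. \<exists>w. (u, w) \<in> diagonal_graph m"
      using diagonal_graph_total sq by blast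
    have "AE x in M. w x = w' x"
      if "(u, w) \<in> diagonal_graph m" "(u', w') \<in> diagonal_graph m" "AE x in M. u x = u' x" for u w u' w'
    proof (rule L2_eqI)
      have "coeff u k = coeff u' k" for k
        using that by (intro L2_inner_cong_AE e_L2) (auto simp: diagonal_graph_def)
      then show "coeff w k = coeff w' k" for k
        using that by (simp add: diagonal_graph_def)
    qed (use that in \<open>auto simp: diagonal_graph_def\<close>)
    then show "\<forall>(u, w)\<in>diagonal_graph m. \<forall>(u', w')\<in>diagonal_graph m.
        (AE x in M. u x = u' x) \<longrightarrow> (AE x in M. w x = w' x)" by blast
    show "\<forall>(u, w)\<in>diagonal_graph m. \<forall>(u', w')\<in>diagonal_graph m. \<forall>a b.
        ((\<lambda>x. a * u x + b * u' x), (\<lambda>x. a * w x + b * w' x)) \<in> diagonal_graph m"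
      by (auto simp: diagonal_graph_def coeff_lin L2_lin algebra_simps)
  qed
  fix u w :: "nat \<Rightarrow> 'a \<Rightarrow> real"
  assume "(\<forall>n. (u n, w n) \<in> diagonal_graph m) \<and> (\<exists>K. \<forall>n. L2_norm M (u n) \<le> K)"
  then obtain K where uw: "\<And>n. u n \<in> L2 M" "\<And>n. w n \<in> L2 M" "\<And>n k. coeff (w n) k = m k * coeff (u n) k"
    and K: "\<And>n. L2_norm M (u n) \<le> K" by (auto simp: diagonal_graph_def)
  have K2: "L2_inner M (u n) (u n) \<le> K\<^sup>2" for n
    using K[of n] by (simp add: L2_norm_def sqrt_le_D)
  have cK: "norm (coeff (u n) k) \<le> \<bar>K\<bar>" for n k
  proof -
    have "(coeff (u n) k)\<^sup>2 \<le> L2_inner M (u n) (u n) * coeff (e k) k"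
      by (rule L2_Cauchy_Schwarz[OF uw(1) e_L2])
    also have "\<dots> \<le> L2_inner M (u n) (u n)"
      using e_norm[of k] L2_inner_nonneg[of M "u n"] by auto
    finally have "(coeff (u n) k)\<^sup>2 \<le> K\<^sup>2" using K2[of n] by linarith
    then show ?thesis by (simp add: abs_le_square_iff)
  qed
  obtain r :: "nat \<Rightarrow> nat" where r: "strict_mono r" "\<And>k. \<exists>l. (\<lambda>n. coeff (u (r n)) k) \<longlonglongrightarrow> l"
    using function_convergent_subsequence[of UNIV "\<lambda>n k. coeff (u n) k", OF _ cK] by auto
  then obtain l where l: "\<And>k. (\<lambda>n. coeff (u (r n)) k) \<longlonglongrightarrow> l k" by metis
  have "\<exists>g h. h \<in> L2 M \<and> (\<forall>n. g n \<in> L2 M \<and> L2_sqdist M (w (r n)) (g n) \<le> \<epsilon>) \<and>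
      (\<lambda>n. L2_sqdist M (g n) h) \<longlonglongrightarrow> 0" if \<epsilon>: "\<epsilon> > 0" for \<epsilon> :: real
  proof -
    define q where "q = \<epsilon> / (K\<^sup>2 + 1)"
    have pos: "K\<^sup>2 + 1 > 0" by (simp add: add_nonneg_pos)
    have "\<epsilon> * K\<^sup>2 \<le> \<epsilon> * (K\<^sup>2 + 1)" using \<epsilon> by (intro mult_left_mono) auto
    then have q: "q > 0" "q * K\<^sup>2 \<le> \<epsilon>"
      using \<epsilon> pos by (simp_all add: q_def pos_divide_le_eq[OF pos])
    have "(\<lambda>k. (m k)\<^sup>2) \<longlonglongrightarrow> 0\<^sup>2"
      by (intro tendsto_power m)
    then have "eventually (\<lambda>k. (m k)\<^sup>2 < q) sequentially"
      using q(1) by (intro order_tendstoD) auto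
    then obtain N where N: "\<And>k. k \<ge> N \<Longrightarrow> (m k)\<^sup>2 < q"
      by (auto simp: eventually_sequentially)
    define g where "g n x = (\<Sum>k<N. coeff (w (r n)) k * e k x)" for n x
    define h where "h x = (\<Sum>k<N. (m k * l k) * e k x)" for x
    have gL: "g n \<in> L2 M" for n unfolding g_def by (rule partial_sum_L2)
    have hL: "h \<in> L2 M" unfolding h_def by (rule partial_sum_L2)
    have "L2_sqdist M (w (r n)) (g n) \<le> \<epsilon>" for n
    proof -
      have D: "(\<lambda>x. w (r n) x - g n x) \<in> L2 M" by (intro L2_diff uw gL)
      have c: "coeff (\<lambda>x. w (r n) x - g n x) k = (if k < N then 0 else m k * coeff (u (r n)) k)" for k
      proof -
        have "coeff (g n) k = (if k < N then coeff (w (r n)) k else 0)"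
          unfolding g_def by (simp add: coeff_partial_sum coeff_absorb[OF uw(2)])
        then show ?thesis
          by (simp add: L2_inner_diff_left uw(1,2) gL e_L2) (simp add: uw(3))
      qed
      have "L2_sqdist M (w (r n)) (g n) \<le> q * L2_inner M (u (r n)) (u (r n))"
        unfolding L2_sqdist_def
      proof (rule sums_le[OF _ Parseval_self[OF D] sums_mult[OF Parseval_self[OF uw(1)]]])
        fix k
        show "(coeff (\<lambda>x. w (r n) x - g n x) k)\<^sup>2 \<le> q * (coeff (u (r n)) k)\<^sup>2"
          unfolding c using N[of k] q(1) by (auto simp: power_mult_distrib intro!: mult_right_mono)
      qed
      also have "\<dots> \<le> q * K\<^sup>2" using K2 q(1) by (intro mult_left_mono) auto
      finally show ?thesis using q(2) by linarith
    qed
    moreover have "(\<lambda>n. L2_sqdist M (g n) h) \<longlonglongrightarrow> 0"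
    proof -
      have eq: "L2_sqdist M (g n) h = (\<Sum>k<N. (m k * coeff (u (r n)) k - m k * l k)\<^sup>2 * coeff (e k) k)" for n
      proof -
        have "g n x - h x = (\<Sum>k<N. (m k * coeff (u (r n)) k - m k * l k) * e k x)" for x
          by (simp add: g_def h_def uw sum_subtractf left_diff_distrib)
        then show ?thesis by (simp add: L2_sqdist_def partial_sum_self)
      qed
      have "(\<lambda>n. \<Sum>k<N. (m k * coeff (u (r n)) k - m k * l k)\<^sup>2 * coeff (e k) k) \<longlonglongrightarrow>
          (\<Sum>k<N. (m k * l k - m k * l k)\<^sup>2 * coeff (e k) k)"
        by (intro tendsto_sum tendsto_mult tendsto_power tendsto_diff tendsto_const l)
      then show ?thesis unfolding eq by simp
    qed
    ultimately show ?thesis using gL hL by blast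
  qed
  from L2_convergent_of_approx[of "\<lambda>n. w (r n)", OF uw(2) this]
  obtain h where h: "h \<in> L2 M" "(\<lambda>n. L2_sqdist M (w (r n)) h) \<longlonglongrightarrow> 0" by blast
  have "(\<lambda>n. sqrt (L2_sqdist M (w (r n)) h)) \<longlonglongrightarrow> sqrt 0"
    by (intro tendsto_intros h)
  then have "(\<lambda>n. L2_norm M (\<lambda>x. w (r n) x - h x)) \<longlonglongrightarrow> 0"
    by (simp add: L2_norm_def L2_sqdist_def)
  with r(1) h(1) show "\<exists>(r :: nat \<Rightarrow> nat) h. strict_mono r \<and> h \<in> L2 M \<and>
      (\<lambda>n. L2_norm M (\<lambda>x. w (r n) x - h x)) \<longlonglongrightarrow> 0" by blast
qed

end

section \<open>Spectral calculus of a diagonal resolution of the identity\<close>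

context L2_eigenbasis
begin

text \<open>
  The pure point measure with mass \<open>(coeff u k)\<^sup>2\<close> at \<open>lam k\<close>.
\<close>

definition diagonal_measure :: "('a \<Rightarrow> real) \<Rightarrow> real measure" where
  "diagonal_measure u = distr (density (count_space UNIV) (\<lambda>k. ennreal ((coeff u k)\<^sup>2))) borel lam"

text \<open>
  The spectral integral depends on a family of projections only through these quadratic forms, so this
  suffices to compute the functional calculus.
\<close>

definition diagonal_resolution :: "(real set \<Rightarrow> ('a \<Rightarrow> real) \<Rightarrow> ('a \<Rightarrow> real)) \<Rightarrow> bool" where
  "diagonal_resolution E \<longleftrightarrow>
     (\<forall>B\<in>sets borel. \<forall>u\<in>L2 M. L2_inner M (E B u) u = (\<Sum>k. indicator B (lam k) * (coeff u k)\<^sup>2))"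

lemma summable_indicator_coeff:
  "u \<in> L2 M \<Longrightarrow> summable (\<lambda>k. indicator B (lam k) * (coeff u k)\<^sup>2)"
  by (rule summable_comparison_test'[OF Bessel_summable]) (auto simp: indicator_def)

lemma emeasure_diagonal_measure:
  assumes B: "B \<in> sets borel" and u: "u \<in> L2 M"
  shows "emeasure (diagonal_measure u) B = ennreal (\<Sum>k. indicator B (lam k) * (coeff u k)\<^sup>2)"
proof -
  have "emeasure (diagonal_measure u) B = (\<Sum>k. ennreal ((coeff u k)\<^sup>2) * indicator (lam -` B) k)"
    unfolding diagonal_measure_def using B
    by (simp add: emeasure_distr emeasure_density nn_integral_count_space_nat)
  also have "\<dots> = (\<Sum>k. ennreal (indicator B (lam k) * (coeff u k)\<^sup>2))"
    by (intro suminf_cong) (auto simp: indicator_def)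
  also have "\<dots> = ennreal (\<Sum>k. indicator B (lam k) * (coeff u k)\<^sup>2)"
    by (intro suminf_ennreal2 summable_indicator_coeff u) auto
  finally show ?thesis .
qed

lemma spectral_distribution_diagonal:
  assumes E: "diagonal_resolution E" and u: "u \<in> L2 M"
  shows "spectral_distribution M E u = diagonal_measure u"
proof -
  have "spectral_distribution M E u = measure_of UNIV (sets borel) (emeasure (diagonal_measure u))"
    unfolding spectral_distribution_def
  proof (rule measure_of_eq)
    fix B :: "real set" assume "B \<in> sigma_sets UNIV (sets borel)"
    then have "B \<in> sets borel"
      using sets.sigma_sets_eq[of "borel :: real measure"] by simp
    then show "ennreal (L2_inner M (E B u) u) = emeasure (diagonal_measure u) B"
      using E u by (simp add: diagonal_resolution_def emeasure_diagonal_measure)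
  qed simp
  also have "\<dots> = diagonal_measure u"
    using measure_of_of_measure[of "diagonal_measure u"] by (simp add: diagonal_measure_def)
  finally show ?thesis .
qed

lemma nn_integral_diagonal_measure:
  assumes [measurable]: "\<phi> \<in> borel_measurable borel"
  shows "(\<integral>\<^sup>+s. ennreal ((\<phi> s)\<^sup>2) \<partial>diagonal_measure u) = (\<Sum>k. ennreal ((\<phi> (lam k) * coeff u k)\<^sup>2))"
proof -
  have "(\<integral>\<^sup>+s. ennreal ((\<phi> s)\<^sup>2) \<partial>diagonal_measure u) = (\<Sum>k. ennreal ((coeff u k)\<^sup>2) * ennreal ((\<phi> (lam k))\<^sup>2))"
    unfolding diagonal_measure_def
    by (simp add: nn_integral_distr nn_integral_density nn_integral_count_space_nat)
  also have "\<dots> = (\<Sum>k. ennreal ((\<phi> (lam k) * coeff u k)\<^sup>2))"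
    by (intro suminf_cong) (simp add: ennreal_mult'[symmetric] power_mult_distrib mult.commute)
  finally show ?thesis .
qed

lemma integral_diagonal_measure:
  assumes [measurable]: "\<phi> \<in> borel_measurable borel" and sum: "summable (\<lambda>k. \<bar>(coeff u k)\<^sup>2 * \<phi> (lam k)\<bar>)"
  shows "(\<integral>s. \<phi> s \<partial>diagonal_measure u) = (\<Sum>k. (coeff u k)\<^sup>2 * \<phi> (lam k))"
proof -
  have "(\<integral>s. \<phi> s \<partial>diagonal_measure u) = (\<integral>k. (coeff u k)\<^sup>2 * \<phi> (lam k) \<partial>count_space UNIV)"
    unfolding diagonal_measure_def by (simp add: integral_distr integral_density)
  also have "\<dots> = (\<Sum>k. (coeff u k)\<^sup>2 * \<phi> (lam k))"
    using sum by (intro integral_count_space_nat) (simp add: integrable_count_space_nat_iff)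
  finally show ?thesis .
qed

lemma spectral_domain_diagonal:
  assumes E: "diagonal_resolution E" and \<phi>: "\<phi> \<in> borel_measurable borel"
  shows "spectral_domain M E \<phi> = {u \<in> L2 M. summable (\<lambda>k. (\<phi> (lam k) * coeff u k)\<^sup>2)}"
proof -
  have "(\<integral>\<^sup>+s. ennreal ((\<phi> s)\<^sup>2) \<partial>spectral_distribution M E u) < \<infinity> \<longleftrightarrow>
      summable (\<lambda>k. (\<phi> (lam k) * coeff u k)\<^sup>2)" if u: "u \<in> L2 M" for u
  proof -
    have "(\<Sum>k. ennreal ((\<phi> (lam k) * coeff u k)\<^sup>2)) < \<infinity> \<longleftrightarrow> summable (\<lambda>k. (\<phi> (lam k) * coeff u k)\<^sup>2)"
    proof
      assume "(\<Sum>k. ennreal ((\<phi> (lam k) * coeff u k)\<^sup>2)) < \<infinity>"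
      then show "summable (\<lambda>k. (\<phi> (lam k) * coeff u k)\<^sup>2)"
        by (intro summable_suminf_not_top) auto
    next
      assume "summable (\<lambda>k. (\<phi> (lam k) * coeff u k)\<^sup>2)"
      then have "(\<Sum>k. ennreal ((\<phi> (lam k) * coeff u k)\<^sup>2)) = ennreal (\<Sum>k. (\<phi> (lam k) * coeff u k)\<^sup>2)"
        by (intro suminf_ennreal2) auto
      then show "(\<Sum>k. ennreal ((\<phi> (lam k) * coeff u k)\<^sup>2)) < \<infinity>" by simp
    qed
    then show ?thesis
      by (simp only: spectral_distribution_diagonal[OF E u] nn_integral_diagonal_measure[OF \<phi>])
  qed
  then show ?thesis
    unfolding spectral_domain_def by blast
qed

lemma diagonal_polarization:
  assumes E: "diagonal_resolution E" and \<phi>: "\<phi> \<in> borel_measurable borel"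
    and u: "u \<in> spectral_domain M E \<phi>" and v: "v \<in> spectral_domain M E \<phi>"
  shows "1/4 * ((\<integral>s. \<phi> s \<partial>spectral_distribution M E (\<lambda>x. u x + v x))
       - (\<integral>s. \<phi> s \<partial>spectral_distribution M E (\<lambda>x. u x - v x))) =
     (\<Sum>k. \<phi> (lam k) * coeff u k * coeff v k)"
proof -
  have uL: "u \<in> L2 M" and vL: "v \<in> L2 M"
    and us: "summable (\<lambda>k. (\<phi> (lam k) * coeff u k)\<^sup>2)" and vs: "summable (\<lambda>k. (\<phi> (lam k) * coeff v k)\<^sup>2)"
    using u v by (simp_all add: spectral_domain_diagonal[OF E \<phi>])
  have sum: "summable (\<lambda>k. \<bar>(coeff u k + s * coeff v k)\<^sup>2 * \<phi> (lam k)\<bar>)" if s: "s = 1 \<or> s = -1" for s :: real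
  proof (rule summable_comparison_test')
    show "summable (\<lambda>k. 2 * ((coeff u k)\<^sup>2 + (coeff v k)\<^sup>2 +
        (\<phi> (lam k) * coeff u k)\<^sup>2 + (\<phi> (lam k) * coeff v k)\<^sup>2))"
      by (intro summable_mult summable_add us vs Bessel_summable uL vL)
    fix k
    define a b p where "a = coeff u k" and "b = coeff v k" and "p = \<phi> (lam k)"
    have "(a + s * b)\<^sup>2 \<le> 2 * (a\<^sup>2 + b\<^sup>2)"
      using s sum_squares_bound[of a b] sum_squares_bound[of a "-b"] by (auto simp: power2_sum power2_diff)
    \<comment> \<open>\<open>\<bar>p\<bar> \<le> 1 + p\<^sup>2\<close> turns square summability of \<open>\<phi> (lam k) * coeff u k\<close> into integrability of \<open>\<phi>\<close>\<close>
    moreover have "\<bar>p\<bar> \<le> 1 + p\<^sup>2"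
      using sum_squares_bound[of "\<bar>p\<bar>" 1] by simp
    ultimately have "(a + s * b)\<^sup>2 * \<bar>p\<bar> \<le> (2 * (a\<^sup>2 + b\<^sup>2)) * (1 + p\<^sup>2)"
      by (intro mult_mono) auto
    then show "norm \<bar>(coeff u k + s * coeff v k)\<^sup>2 * \<phi> (lam k)\<bar> \<le> 2 * ((coeff u k)\<^sup>2 + (coeff v k)\<^sup>2 +
        (\<phi> (lam k) * coeff u k)\<^sup>2 + (\<phi> (lam k) * coeff v k)\<^sup>2)"
      by (simp add: a_def[symmetric] b_def[symmetric] p_def[symmetric] abs_mult power_mult_distrib algebra_simps)
  qed
  have int: "(\<integral>t. \<phi> t \<partial>spectral_distribution M E (\<lambda>x. 1 * u x + s * v x)) =
      (\<Sum>k. (coeff u k + s * coeff v k)\<^sup>2 * \<phi> (lam k))" if s: "s = 1 \<or> s = -1" for s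
  proof -
    have L: "(\<lambda>x. 1 * u x + s * v x) \<in> L2 M" by (intro L2_lin uL vL)
    have c: "coeff (\<lambda>x. 1 * u x + s * v x) k = coeff u k + s * coeff v k" for k
      using coeff_lin[OF uL vL, of 1 s k] by (simp only: mult_1_left)
    show ?thesis
      unfolding spectral_distribution_diagonal[OF E L]
      using integral_diagonal_measure[OF \<phi>, of "\<lambda>x. 1 * u x + s * v x", unfolded c, OF sum[OF s]] .
  qed
  note s1 = summable_rabs_cancel[OF sum[OF disjI1[OF refl]]]
    and s2 = summable_rabs_cancel[OF sum[OF disjI2[OF refl]]]
  have "(\<Sum>k. (coeff u k + 1 * coeff v k)\<^sup>2 * \<phi> (lam k)) - (\<Sum>k. (coeff u k + (-1) * coeff v k)\<^sup>2 * \<phi> (lam k)) =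
      (\<Sum>k. (coeff u k + 1 * coeff v k)\<^sup>2 * \<phi> (lam k) - (coeff u k + (-1) * coeff v k)\<^sup>2 * \<phi> (lam k))"
    by (rule suminf_diff[OF s1 s2])
  also have "\<dots> = (\<Sum>k. 4 * (\<phi> (lam k) * coeff u k * coeff v k))"
    by (intro suminf_cong) (simp add: power2_eq_square algebra_simps)
  finally have d: "(\<Sum>k. (coeff u k + 1 * coeff v k)\<^sup>2 * \<phi> (lam k)) - (\<Sum>k. (coeff u k + (-1) * coeff v k)\<^sup>2 * \<phi> (lam k)) =
      (\<Sum>k. 4 * (\<phi> (lam k) * coeff u k * coeff v k))" .
  have "summable (\<lambda>k. (coeff u k + 1 * coeff v k)\<^sup>2 * \<phi> (lam k) - (coeff u k + (-1) * coeff v k)\<^sup>2 * \<phi> (lam k))"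
    by (rule summable_diff[OF s1 s2])
  then have "summable (\<lambda>k. 4 * (\<phi> (lam k) * coeff u k * coeff v k))"
    by (rule summable_cong[THEN iffD1, rotated]) (simp add: power2_eq_square algebra_simps)
  then have "summable (\<lambda>k. \<phi> (lam k) * coeff u k * coeff v k)"
    by (subst (asm) summable_cmult_iff) simp
  then have "(\<Sum>k. 4 * (\<phi> (lam k) * coeff u k * coeff v k)) = 4 * (\<Sum>k. \<phi> (lam k) * coeff u k * coeff v k)"
    by (rule suminf_mult)
  with d int[of 1] int[of "-1"] show ?thesis by simp
qed

text \<open>
  Testing against the eigenfunctions, which lie in every spectral domain, reads off the coordinates;
  Parseval's identity gives the converse.
\<close>

theorem spectral_integral_diagonal:
  assumes E: "diagonal_resolution E" and \<phi>: "\<phi> \<in> borel_measurable borel"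
  shows "spectral_integral M E \<phi> = diagonal_graph (\<lambda>k. \<phi> (lam k))"
proof (intro set_eqI iffI; clarify)
  fix u w assume uw: "(u, w) \<in> spectral_integral M E \<phi>"
  then have u: "u \<in> spectral_domain M E \<phi>" and w: "w \<in> L2 M"
    by (auto simp: spectral_integral_def)
  have eq: "L2_inner M w v = (\<Sum>k. \<phi> (lam k) * coeff u k * coeff v k)"
    if v: "v \<in> spectral_domain M E \<phi>" for v
    using uw v unfolding spectral_integral_def diagonal_polarization[OF E \<phi> u v, symmetric] by blast
  have uL: "u \<in> L2 M" using u by (simp add: spectral_domain_def)
  have "coeff w k = \<phi> (lam k) * coeff u k" for k
  proof -
    have "summable (\<lambda>j. (\<phi> (lam j) * coeff (e k) j)\<^sup>2)"
      by (rule summable_finite[of "{k}"]) (auto simp: e_orth)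
    then have "e k \<in> spectral_domain M E \<phi>"
      by (simp add: spectral_domain_diagonal[OF E \<phi>] e_L2)
    from eq[OF this] have "coeff w k = (\<Sum>j. \<phi> (lam j) * coeff u j * coeff (e k) j)" .
    also have "\<dots> = (\<Sum>j\<in>{k}. \<phi> (lam j) * coeff u j * coeff (e k) j)"
      by (rule suminf_finite) (auto simp: e_orth)
    also have "\<dots> = \<phi> (lam k) * coeff u k"
      by (simp add: mult.assoc coeff_absorb[OF uL])
    finally show ?thesis .
  qed
  with uL w show "(u, w) \<in> diagonal_graph (\<lambda>k. \<phi> (lam k))"
    by (simp add: diagonal_graph_def)
next
  fix u w assume "(u, w) \<in> diagonal_graph (\<lambda>k. \<phi> (lam k))"
  then have uL: "u \<in> L2 M" and wL: "w \<in> L2 M" and c: "\<And>k. coeff w k = \<phi> (lam k) * coeff u k"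
    by (auto simp: diagonal_graph_def)
  have u: "u \<in> spectral_domain M E \<phi>"
    using Bessel_summable[OF wL] by (simp add: spectral_domain_diagonal[OF E \<phi>] uL c)
  have "L2_inner M w v =
      1/4 * ((\<integral>s. \<phi> s \<partial>spectral_distribution M E (\<lambda>x. u x + v x))
        - (\<integral>s. \<phi> s \<partial>spectral_distribution M E (\<lambda>x. u x - v x)))"
    if v: "v \<in> spectral_domain M E \<phi>" for v
  proof -
    have "v \<in> L2 M" using v by (simp add: spectral_domain_def)
    from sums_unique[OF Parseval[OF wL this]] show ?thesis
      unfolding diagonal_polarization[OF E \<phi> u v] by (simp add: c)
  qed
  then show "(u, w) \<in> spectral_integral M E \<phi>"
    unfolding spectral_integral_def using u wL by blast
qed

definition eigenprojection :: "real set \<Rightarrow> ('a \<Rightarrow> real) \<Rightarrow> ('a \<Rightarrow> real)" where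
  "eigenprojection B u = (SOME w. (u, w) \<in> diagonal_graph (\<lambda>k. indicator B (lam k)))"

lemma eigenprojection:
  assumes u: "u \<in> L2 M"
  shows "eigenprojection B u \<in> L2 M" "coeff (eigenprojection B u) k = indicator B (lam k) * coeff u k"
proof -
  have "summable (\<lambda>k. (indicator B (lam k) * coeff u k)\<^sup>2)"
    by (rule summable_comparison_test'[OF Bessel_summable[OF u]]) (auto simp: indicator_def)
  from someI_ex[OF diagonal_graph_total[OF u this]]
  have "(u, eigenprojection B u) \<in> diagonal_graph (\<lambda>k. indicator B (lam k))"
    unfolding eigenprojection_def .
  then show "eigenprojection B u \<in> L2 M" "coeff (eigenprojection B u) k = indicator B (lam k) * coeff u k"
    by (auto simp: diagonal_graph_def)
qed

lemma eigenprojection_inner: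
  assumes u: "u \<in> L2 M" and v: "v \<in> L2 M"
  shows "L2_inner M (eigenprojection B u) v = (\<Sum>k. indicator B (lam k) * (coeff u k * coeff v k))"
  using sums_unique[OF Parseval[OF eigenprojection(1)[OF u] v, of B]]
  by (simp add: eigenprojection(2)[OF u] mult.assoc)

lemma diagonal_resolution_eigenprojection: "diagonal_resolution eigenprojection"
  by (simp add: diagonal_resolution_def eigenprojection_inner power2_eq_square)

text \<open>
  Dominated convergence for the absolutely convergent series of products of coordinates.
\<close>

lemma eigenprojection_countably_additive:
  fixes B :: "nat \<Rightarrow> real set"
  assumes u: "u \<in> L2 M" and v: "v \<in> L2 M" and disj: "disjoint_family B"
  shows "(\<lambda>n. L2_inner M (eigenprojection (B n) u) v) sums L2_inner M (eigenprojection (\<Union>n. B n) u) v"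
proof -
  define a where "a k = coeff u k * coeff v k" for k
  have a: "summable (\<lambda>k. \<bar>a k\<bar>)"
    unfolding a_def by (rule summable_coeff_mult[OF u v])
  have inner: "L2_inner M (eigenprojection A u) v = (\<integral>k. indicator A (lam k) * a k \<partial>count_space UNIV)"
    and int: "integrable (count_space UNIV) (\<lambda>k. indicator A (lam k) * a k)" for A
  proof -
    have "summable (\<lambda>k. \<bar>indicator A (lam k) * a k\<bar>)"
      by (rule summable_comparison_test'[OF a]) (auto simp: indicator_def)
    then show "integrable (count_space UNIV) (\<lambda>k. indicator A (lam k) * a k)"
      by (simp add: integrable_count_space_nat_iff)
    then show "L2_inner M (eigenprojection A u) v = (\<integral>k. indicator A (lam k) * a k \<partial>count_space UNIV)"
      by (simp add: integral_count_space_nat eigenprojection_inner[OF u v] a_def)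
  qed
  have part: "(\<Sum>n<N. L2_inner M (eigenprojection (B n) u) v) =
      (\<integral>k. indicator (\<Union>n<N. B n) (lam k) * a k \<partial>count_space UNIV)" for N
  proof -
    have "(indicator (\<Union>n<N. B n) (lam k) :: real) = (\<Sum>n<N. indicator (B n) (lam k))" for k
      using disj by (intro indicator_UN_disjoint) (auto simp: disjoint_family_on_def)
    then show ?thesis
      unfolding inner
      by (simp only: sum_distrib_right) (rule Bochner_Integration.integral_sum[symmetric], rule int)
  qed
  have "(\<lambda>N. \<integral>k. indicator (\<Union>n<N. B n) (lam k) * a k \<partial>count_space UNIV) \<longlonglongrightarrow>
      (\<integral>k. indicator (\<Union>n. B n) (lam k) * a k \<partial>count_space UNIV)"
  proof (rule integral_dominated_convergence[where w = "\<lambda>k. \<bar>a k\<bar>"])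
    show "integrable (count_space UNIV) (\<lambda>k. \<bar>a k\<bar>)"
      using a by (simp add: integrable_count_space_nat_iff)
    show "AE k in count_space UNIV. (\<lambda>N. indicator (\<Union>n<N. B n) (lam k) * a k) \<longlonglongrightarrow> indicator (\<Union>n. B n) (lam k) * a k"
      by (intro AE_I2 tendsto_mult_right LIMSEQ_indicator_UN)
  qed (auto simp: indicator_def)
  then show ?thesis
    unfolding sums_def part unfolding inner .
qed

theorem projection_valued_measure_eigenprojection:
  "projection_valued_measure M eigenprojection"
  unfolding projection_valued_measure_def L2_projection_def
proof (intro conjI ballI allI impI)
  fix B :: "real set" and u v :: "'a \<Rightarrow> real" assume u: "u \<in> L2 M" and v: "v \<in> L2 M"
  show "eigenprojection B u \<in> L2 M" by (rule eigenprojection(1)[OF u])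
  show "AE x in M. eigenprojection B u x = eigenprojection B v x" if "AE x in M. u x = v x"
  proof (rule L2_eqI)
    have "coeff u k = coeff v k" for k
      using that by (intro L2_inner_cong_AE u v e_L2) auto
    then show "coeff (eigenprojection B u) k = coeff (eigenprojection B v) k" for k
      by (simp add: eigenprojection u v)
  qed (use u v in \<open>auto intro: eigenprojection\<close>)
  show "AE x in M. eigenprojection B (\<lambda>y. a * u y + b * v y) x = a * eigenprojection B u x + b * eigenprojection B v x" for a b
    by (rule L2_eqI) (simp_all add: u v eigenprojection L2_lin coeff_lin algebra_simps)
  show "AE x in M. eigenprojection B (eigenprojection B u) x = eigenprojection B u x"
    by (rule L2_eqI) (simp_all add: u eigenprojection indicator_def)
  show "L2_inner M (eigenprojection B u) v = L2_inner M u (eigenprojection B v)"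
    unfolding L2_inner_commute[of M u] eigenprojection_inner[OF u v] eigenprojection_inner[OF v u]
    by (simp add: mult.commute)
next
  fix u assume u: "u \<in> L2 M"
  show "AE x in M. eigenprojection UNIV u x = u x"
    by (rule L2_eqI) (simp_all add: u eigenprojection)
  fix A B :: "real set"
  show "AE x in M. eigenprojection (A \<inter> B) u x = eigenprojection A (eigenprojection B u) x"
    by (rule L2_eqI) (simp_all add: u eigenprojection indicator_inter_arith)
next
  fix B :: "nat \<Rightarrow> real set" and u v assume "range B \<subseteq> sets borel \<and> disjoint_family B" "u \<in> L2 M" "v \<in> L2 M"
  then show "(\<lambda>n. L2_inner M (eigenprojection (B n) u) v) sums L2_inner M (eigenprojection (\<Union>n. B n) u) v"
    by (intro eigenprojection_countably_additive) auto
qed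

theorem spectral_resolution_eigenprojection:
  "spectral_resolution M (diagonal_graph lam) eigenprojection"
  using projection_valued_measure_eigenprojection
    spectral_integral_diagonal[OF diagonal_resolution_eigenprojection, of "\<lambda>s. s"]
  by (simp add: spectral_resolution_def)

end

section \<open>Uniqueness of the resolution of the identity and the heat operators\<close>

lemma
  assumes "projection_valued_measure M F" and B: "B \<in> sets borel" and u: "u \<in> L2 M"
  shows pvm_L2: "F B u \<in> L2 M"
    and pvm_self_adjoint: "v \<in> L2 M \<Longrightarrow> L2_inner M (F B u) v = L2_inner M u (F B v)"
    and pvm_linear: "v \<in> L2 M \<Longrightarrow> AE x in M. F B (\<lambda>y. a * u y + b * v y) x = a * F B u x + b * F B v x"
    and pvm_UNIV: "AE x in M. F UNIV u x = u x"
    and pvm_Int: "A \<in> sets borel \<Longrightarrow> AE x in M. F (A \<inter> B) u x = F A (F B u) x"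
proof -
  have P: "L2_projection M (F B)"
    using assms by (simp add: projection_valued_measure_def)
  show "F B u \<in> L2 M"
    using P u by (simp add: L2_projection_def)
  show "L2_inner M (F B u) v = L2_inner M u (F B v)" if "v \<in> L2 M"
    using P u that by (simp add: L2_projection_def)
  show "AE x in M. F B (\<lambda>y. a * u y + b * v y) x = a * F B u x + b * F B v x" if "v \<in> L2 M"
    using P u that by (simp add: L2_projection_def)
  show "AE x in M. F UNIV u x = u x"
    using assms by (simp add: projection_valued_measure_def)
  show "AE x in M. F (A \<inter> B) u x = F A (F B u) x" if "A \<in> sets borel"
    using assms that by (simp add: projection_valued_measure_def)
qed

lemma pvm_sums:
  assumes "projection_valued_measure M F" "u \<in> L2 M" "v \<in> L2 M" "range B \<subseteq> sets borel" "disjoint_family B"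
  shows "(\<lambda>n::nat. L2_inner M (F (B n) u) v) sums L2_inner M (F (\<Union>n. B n) u) v"
  using assms by (simp add: projection_valued_measure_def)

context
  fixes M :: "'a measure" and F :: "real set \<Rightarrow> ('a \<Rightarrow> real) \<Rightarrow> 'a \<Rightarrow> real"
  assumes pvm: "projection_valued_measure M F"
begin

lemma pvm_inner_Int:
  assumes "A \<in> sets borel" "B \<in> sets borel" "u \<in> L2 M" "v \<in> L2 M"
  shows "L2_inner M (F A (F B u)) v = L2_inner M (F (A \<inter> B) u) v"
proof (rule L2_inner_cong_AE)
  show "AE x in M. F A (F B u) x = F (A \<inter> B) u x"
    using pvm_Int[OF pvm assms(2,3,1)] by eventually_elim simp
qed (use assms in \<open>auto intro!: pvm_L2[OF pvm] sets.Int\<close>)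

lemma pvm_inner_self:
  assumes "B \<in> sets borel" "u \<in> L2 M"
  shows "L2_inner M (F B u) u = L2_inner M (F B u) (F B u)"
  using pvm_self_adjoint[OF pvm assms(1) pvm_L2[OF pvm assms] assms(2)]
    pvm_inner_Int[OF assms(1,1,2,2)] by simp

lemma pvm_inner_nonneg: "B \<in> sets borel \<Longrightarrow> u \<in> L2 M \<Longrightarrow> L2_inner M (F B u) u \<ge> 0"
  by (simp add: pvm_inner_self L2_inner_nonneg)

lemma pvm_empty:
  assumes "u \<in> L2 M" "v \<in> L2 M"
  shows "L2_inner M (F {} u) v = 0"
proof -
  have "(\<lambda>n::nat. L2_inner M (F {} u) v) sums L2_inner M (F (\<Union>n::nat. {}) u) v"
    by (rule pvm_sums[OF pvm assms]) (auto simp: disjoint_family_on_def)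
  then have "(\<lambda>n::nat. L2_inner M (F {} u) v) \<longlonglongrightarrow> 0"
    by (intro summable_LIMSEQ_zero) (rule sums_summable)
  then show ?thesis by (simp add: LIMSEQ_const_iff)
qed

lemma pvm_Un:
  assumes "A \<in> sets borel" "B \<in> sets borel" "A \<inter> B = {}" "u \<in> L2 M" "v \<in> L2 M"
  shows "L2_inner M (F (A \<union> B) u) v = L2_inner M (F A u) v + L2_inner M (F B u) v"
proof -
  have "(\<lambda>n. L2_inner M (F (binaryset A B n) u) v) sums L2_inner M (F (\<Union>n. binaryset A B n) u) v"
    using assms by (intro pvm_sums[OF pvm]) (auto simp: disjoint_family_on_def binaryset_def)
  moreover have "(\<lambda>n. L2_inner M (F (binaryset A B n) u) v) sums (L2_inner M (F A u) v + L2_inner M (F B u) v)"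
    by (rule binaryset_sums) (rule pvm_empty[OF assms(4,5)])
  ultimately show ?thesis
    by (simp add: UN_binaryset_eq sums_unique2)
qed

lemma sets_spectral_distribution: "sets (spectral_distribution M F u) = sets borel"
  using sets.sigma_sets_eq[of "borel :: real measure"] by (simp add: spectral_distribution_def)

lemma space_spectral_distribution: "space (spectral_distribution M F u) = UNIV"
  using sets_eq_imp_space_eq[OF sets_spectral_distribution[of u]] by simp

lemma emeasure_spectral_distribution:
  assumes u: "u \<in> L2 M" and B: "B \<in> sets borel"
  shows "emeasure (spectral_distribution M F u) B = ennreal (L2_inner M (F B u) u)"
proof (rule emeasure_measure_of[OF spectral_distribution_def])
  show "B \<in> sets (spectral_distribution M F u)"
    using B by (simp add: sets_spectral_distribution)
  show "positive (sets (spectral_distribution M F u)) (\<lambda>B. ennreal (L2_inner M (F B u) u))"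
    by (simp add: positive_def pvm_empty[OF u u])
  show "countably_additive (sets (spectral_distribution M F u)) (\<lambda>B. ennreal (L2_inner M (F B u) u))"
  proof (rule countably_additiveI, goal_cases)
    case (1 A)
    then show ?case
      unfolding sets_spectral_distribution
      by (intro suminf_ennreal_eq pvm_inner_nonneg pvm_sums[OF pvm] u) auto
  qed
qed simp

lemma measure_spectral_distribution:
  assumes "u \<in> L2 M" "B \<in> sets borel"
  shows "measure (spectral_distribution M F u) B = L2_inner M (F B u) u"
  using emeasure_spectral_distribution[OF assms] pvm_inner_nonneg[OF assms(2,1)]
  by (simp add: measure_def)

lemma finite_measure_spectral_distribution:
  "u \<in> L2 M \<Longrightarrow> finite_measure (spectral_distribution M F u)"
  by (intro finite_measureI) (simp add: space_spectral_distribution emeasure_spectral_distribution)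

lemma pvm_inner_combination:
  assumes u: "u \<in> L2 M" and A: "A \<in> sets borel" and B: "B \<in> sets borel"
  shows "L2_inner M (F A (\<lambda>x. a * u x + b * F B u x)) (\<lambda>x. a * u x + b * F B u x) =
    (a + b)\<^sup>2 * L2_inner M (F (A \<inter> B) u) u + a\<^sup>2 * L2_inner M (F (A - B) u) u"
proof -
  note L2s = pvm_L2[OF pvm]
  have v: "F B u \<in> L2 M" by (rule L2s[OF B u])
  have AB: "A \<inter> B \<in> sets borel" using A B by auto
  define w where "w = (\<lambda>x. a * u x + b * F B u x)"
  have w: "w \<in> L2 M" unfolding w_def by (rule L2_lin[OF u v])
  have lin: "AE x in M. F A w x = a * F A u x + b * F A (F B u) x"
    using pvm_linear[OF pvm A u v, of a b] unfolding w_def .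
  have "L2_inner M (F A w) w = L2_inner M (\<lambda>x. a * F A u x + b * F A (F B u) x) w"
    by (rule L2_inner_cong_AE[OF L2s[OF A w] L2_lin[OF L2s[OF A u] L2s[OF A v]] w w lin]) simp
  also have "\<dots> = a * L2_inner M (F A u) w + b * L2_inner M (F A (F B u)) w"
    by (intro L2_inner_lin_left L2s A u v w)
  also have "\<dots> = a * (a * L2_inner M (F A u) u + b * L2_inner M (F A u) (F B u)) +
      b * (a * L2_inner M (F A (F B u)) u + b * L2_inner M (F A (F B u)) (F B u))"
    unfolding w_def by (simp add: L2_inner_lin_right L2s A u v)
  also have "L2_inner M (F A u) (F B u) = L2_inner M (F (A \<inter> B) u) u"
    using pvm_self_adjoint[OF pvm B L2s[OF A u] u] pvm_inner_Int[OF B A u u] by (simp add: Int_commute)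
  also have "L2_inner M (F A (F B u)) (F B u) = L2_inner M (F (A \<inter> B) u) u"
    using pvm_inner_Int[OF A B u v] pvm_self_adjoint[OF pvm B L2s[OF AB u] u] pvm_inner_Int[OF B AB u u]
    by (simp add: Int_left_commute Int_commute)
  also have "L2_inner M (F A (F B u)) u = L2_inner M (F (A \<inter> B) u) u"
    by (rule pvm_inner_Int[OF A B u u])
  also have "L2_inner M (F A u) u = L2_inner M (F (A \<inter> B) u) u + L2_inner M (F (A - B) u) u"
    using pvm_Un[of "A \<inter> B" "A - B" u u] A B u by (simp add: Int_Diff_Un Int_Diff_disjoint)
  finally show ?thesis
    by (simp add: w_def power2_eq_square algebra_simps)
qed

text \<open>
  The vector \<open>a u + b F(B)u\<close> has the part \<open>(a + b) F(B)u\<close> in the range of \<open>F(B)\<close> and \<open>a F(-B)u\<close> in the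
  complementary range, and these parts do not interact. With \<open>a = 1\<close> and \<open>b = \<plusminus>1\<close> these are the two
  measures in the polarization formula of the spectral integral.
\<close>

lemma spectral_distribution_combination:
  assumes u: "u \<in> L2 M" and B: "B \<in> sets borel"
  shows "spectral_distribution M F (\<lambda>x. a * u x + b * F B u x) =
    density (spectral_distribution M F u) (\<lambda>s. if s \<in> B then ennreal ((a + b)\<^sup>2) else ennreal (a\<^sup>2))"
proof (rule measure_eqI)
  let ?\<mu> = "spectral_distribution M F u"
  show "sets (spectral_distribution M F (\<lambda>x. a * u x + b * F B u x)) =
      sets (density ?\<mu> (\<lambda>s. if s \<in> B then ennreal ((a + b)\<^sup>2) else ennreal (a\<^sup>2)))"
    by (simp add: sets_spectral_distribution)
  fix A assume "A \<in> sets (spectral_distribution M F (\<lambda>x. a * u x + b * F B u x))"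
  then have A: "A \<in> sets borel" by (simp add: sets_spectral_distribution)
  have w: "(\<lambda>x. a * u x + b * F B u x) \<in> L2 M"
    by (intro L2_lin u pvm_L2[OF pvm B])
  have s: "A \<inter> B \<in> sets ?\<mu>" "A - B \<in> sets ?\<mu>" "A \<in> sets ?\<mu>" "B \<in> sets ?\<mu>"
    using A B by (auto simp: sets_spectral_distribution)
  have "emeasure (density ?\<mu> (\<lambda>s. if s \<in> B then ennreal ((a + b)\<^sup>2) else ennreal (a\<^sup>2))) A =
      (\<integral>\<^sup>+s. (if s \<in> B then ennreal ((a + b)\<^sup>2) else ennreal (a\<^sup>2)) * indicator A s \<partial>?\<mu>)"
    using s by (intro emeasure_density measurable_If) (auto simp: space_spectral_distribution)
  also have "\<dots> = (\<integral>\<^sup>+s. ennreal ((a + b)\<^sup>2) * indicator (A \<inter> B) s + ennreal (a\<^sup>2) * indicator (A - B) s \<partial>?\<mu>)"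
    by (intro nn_integral_cong) (auto simp: indicator_def)
  also have "\<dots> = ennreal ((a + b)\<^sup>2) * emeasure ?\<mu> (A \<inter> B) + ennreal (a\<^sup>2) * emeasure ?\<mu> (A - B)"
    using s by (subst nn_integral_add) (auto simp: nn_integral_cmult_indicator)
  also have "\<dots> = ennreal ((a + b)\<^sup>2) * ennreal (L2_inner M (F (A \<inter> B) u) u) +
      ennreal (a\<^sup>2) * ennreal (L2_inner M (F (A - B) u) u)"
    using A B u by (simp add: emeasure_spectral_distribution)
  also have "\<dots> = ennreal ((a + b)\<^sup>2 * L2_inner M (F (A \<inter> B) u) u + a\<^sup>2 * L2_inner M (F (A - B) u) u)"
    using A B u by (simp add: ennreal_mult' ennreal_plus pvm_inner_nonneg)
  finally show "emeasure (spectral_distribution M F (\<lambda>x. a * u x + b * F B u x)) A =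
      emeasure (density ?\<mu> (\<lambda>s. if s \<in> B then ennreal ((a + b)\<^sup>2) else ennreal (a\<^sup>2))) A"
    by (simp add: emeasure_spectral_distribution[OF w A] pvm_inner_combination[OF u A B])
qed

text \<open>
  Testing \<open>w = \<integral>s dF u\<close> against \<open>F(B)u\<close> evaluates the integral of \<open>s\<close> over \<open>B\<close>.
\<close>

lemma spectral_integral_restrict:
  assumes uw: "(u, w) \<in> spectral_integral M F (\<lambda>s. s)" and B: "B \<in> sets borel"
  shows "integrable (spectral_distribution M F u) (\<lambda>s. s)"
    and "L2_inner M w (F B u) = (\<integral>s. indicator B s * s \<partial>spectral_distribution M F u)"
proof -
  let ?\<mu> = "spectral_distribution M F u"
  have u: "u \<in> L2 M" and fin: "(\<integral>\<^sup>+s. ennreal (s\<^sup>2) \<partial>?\<mu>) < \<infinity>"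
    and ud: "u \<in> spectral_domain M F (\<lambda>s. s)"
    using uw by (auto simp: spectral_integral_def spectral_domain_def)
  interpret \<mu>: finite_measure ?\<mu>
    by (rule finite_measure_spectral_distribution[OF u])
  have [measurable_cong]: "sets ?\<mu> = sets borel" by (rule sets_spectral_distribution)
  have [measurable]: "B \<in> sets borel" by (rule B)
  have "(\<lambda>s. s) \<in> L2 ?\<mu>"
    using fin by (simp add: L2_def integrable_iff_bounded)
  moreover have "(\<lambda>s. 1) \<in> L2 ?\<mu>" by (simp add: L2_def)
  ultimately show int: "integrable ?\<mu> (\<lambda>s. s)"
    using L2_mult_integrable by fastforce
  have intB: "integrable ?\<mu> (\<lambda>s. indicator B s * s)"
    using integrable_real_mult_indicator[OF _ int, of B] by (simp add: mult.commute)
  have dens: "(\<integral>s. s \<partial>spectral_distribution M F (\<lambda>x. a * u x + b * F B u x)) =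
      a\<^sup>2 * (\<integral>s. s \<partial>?\<mu>) + ((a + b)\<^sup>2 - a\<^sup>2) * (\<integral>s. indicator B s * s \<partial>?\<mu>)" for a b
  proof -
    have "spectral_distribution M F (\<lambda>x. a * u x + b * F B u x) =
        density ?\<mu> (\<lambda>s. ennreal (if s \<in> B then (a + b)\<^sup>2 else a\<^sup>2))"
      unfolding spectral_distribution_combination[OF u B] by (rule arg_cong2[where f = density]) auto
    then have "(\<integral>s. s \<partial>spectral_distribution M F (\<lambda>x. a * u x + b * F B u x)) =
        (\<integral>s. (if s \<in> B then (a + b)\<^sup>2 else a\<^sup>2) *\<^sub>R s \<partial>?\<mu>)"
      by (simp only:) (rule integral_density; measurable; simp)
    also have "\<dots> = (\<integral>s. a\<^sup>2 * s + ((a + b)\<^sup>2 - a\<^sup>2) * (indicator B s * s) \<partial>?\<mu>)"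
      by (intro Bochner_Integration.integral_cong) (auto simp: indicator_def algebra_simps)
    also have "\<dots> = a\<^sup>2 * (\<integral>s. s \<partial>?\<mu>) + ((a + b)\<^sup>2 - a\<^sup>2) * (\<integral>s. indicator B s * s \<partial>?\<mu>)"
      using int intB by simp
    finally show ?thesis .
  qed
  have "F B u \<in> spectral_domain M F (\<lambda>s. s)"
  proof -
    have "spectral_distribution M F (F B u) = density ?\<mu> (\<lambda>s. if s \<in> B then ennreal 1 else ennreal 0)"
      using spectral_distribution_combination[OF u B, of 0 1]
      by (simp only: mult_zero_left mult_1_left add_0_left one_power2 zero_power2)
    then have "(\<integral>\<^sup>+s. ennreal (s\<^sup>2) \<partial>spectral_distribution M F (F B u)) =
        (\<integral>\<^sup>+s. (if s \<in> B then ennreal 1 else ennreal 0) * ennreal (s\<^sup>2) \<partial>?\<mu>)"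
      by (simp only:) (rule nn_integral_density; measurable)
    also have "\<dots> \<le> (\<integral>\<^sup>+s. ennreal (s\<^sup>2) \<partial>?\<mu>)"
      by (intro nn_integral_mono) auto
    finally show ?thesis
      using fin pvm_L2[OF pvm B u] by (simp add: spectral_domain_def)
  qed
  then have "L2_inner M w (F B u) = 1/4 * ((\<integral>s. s \<partial>spectral_distribution M F (\<lambda>x. u x + F B u x))
      - (\<integral>s. s \<partial>spectral_distribution M F (\<lambda>x. u x - F B u x)))"
    using uw unfolding spectral_integral_def by blast
  then show "L2_inner M w (F B u) = (\<integral>s. indicator B s * s \<partial>?\<mu>)"
    using dens[of 1 1] dens[of 1 "-1"] by simp
qed

text \<open>
  For an eigenvector the integral of \<open>s - l\<close> over every Borel set vanishes. Taking the sets where this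
  integrand is positive, respectively negative, shows that the spectral distribution is concentrated at \<open>l\<close>.
\<close>

lemma eigenvector_spectral_distribution:
  assumes u: "u \<in> L2 M" and uw: "(u, \<lambda>x. l * u x) \<in> spectral_integral M F (\<lambda>s. s)"
    and B: "B \<in> sets borel" and l: "l \<notin> B"
  shows "L2_inner M (F B u) u = 0"
proof -
  let ?\<mu> = "spectral_distribution M F u"
  interpret \<mu>: finite_measure ?\<mu>
    by (rule finite_measure_spectral_distribution[OF u])
  have [measurable_cong]: "sets ?\<mu> = sets borel" by (rule sets_spectral_distribution)
  have int0: "(\<integral>s. indicator A s * (s - l) \<partial>?\<mu>) = 0 \<and> integrable ?\<mu> (\<lambda>s. indicator A s * (s - l))"
    if A: "A \<in> sets borel" for A
  proof -
    have [measurable]: "A \<in> sets borel" by (rule A)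
    have 1: "integrable ?\<mu> (\<lambda>s. indicator A s * s)"
      using integrable_real_mult_indicator[OF _ spectral_integral_restrict(1)[OF uw A], of A]
      by (simp add: mult.commute)
    have 2: "integrable ?\<mu> (\<lambda>s. indicator A s * l)"
      by (intro integrable_mult_left integrable_real_indicator)
        (auto simp: \<mu>.emeasure_eq_measure)
    have "(\<integral>s. indicator A s * s \<partial>?\<mu>) = l * L2_inner M u (F A u)"
      using spectral_integral_restrict(2)[OF uw A] by (simp add: L2_inner_scale_left)
    also have "\<dots> = l * measure ?\<mu> A"
      by (simp add: measure_spectral_distribution[OF u A] L2_inner_commute)
    also have "\<dots> = (\<integral>s. indicator A s * l \<partial>?\<mu>)"
      by (simp add: space_spectral_distribution)
    finally show ?thesis
      using 1 2 by (simp add: right_diff_distrib)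
  qed
  have AE: "AE s in ?\<mu>. c * (s - l) \<le> 0" if c: "c = 1 \<or> c = -1" for c :: real
  proof -
    define A where "A = {s. c * (s - l) > 0}"
    have A: "A \<in> sets borel" unfolding A_def by measurable
    have "(\<integral>s. c * (indicator A s * (s - l)) \<partial>?\<mu>) = 0"
      using int0[OF A] by simp
    then have "AE s in ?\<mu>. c * (indicator A s * (s - l)) = 0"
      using int0[OF A]
      by (subst (asm) integral_nonneg_eq_0_iff_AE) (auto simp: A_def indicator_def)
    then show ?thesis
    proof eventually_elim
      case (elim s)
      then show ?case
        using c by (auto simp: A_def indicator_def split: if_splits)
    qed
  qed
  have "AE s in ?\<mu>. s \<notin> B"
    using AE[OF disjI1[OF refl]] AE[OF disjI2[OF refl]]
  proof eventually_elim
    case (elim s)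
    then have "s = l" by simp
    with l show ?case by blast
  qed
  then have "emeasure ?\<mu> B = 0"
    using B by (subst (asm) AE_iff_measurable[of B]) (auto simp: sets_spectral_distribution space_spectral_distribution)
  then show ?thesis
    using pvm_inner_nonneg[OF B u] by (simp add: emeasure_spectral_distribution[OF u B] ennreal_eq_0_iff)
qed

end

context L2_eigenbasis
begin

lemma eigenfunction_in_diagonal_graph: "(e k, \<lambda>x. lam k * e k x) \<in> diagonal_graph lam"
proof -
  have "lam k * coeff (e k) j = lam j * coeff (e k) j" for j
    by (cases "j = k") (simp_all add: e_orth)
  then show ?thesis
    by (simp add: diagonal_graph_def e_L2 L2_scale L2_inner_scale_left)
qed

lemma coeff_spectral_projection:
  assumes F: "spectral_resolution M (diagonal_graph lam) F" and B: "B \<in> sets borel" and u: "u \<in> L2 M"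
  shows "coeff (F B u) k = indicator B (lam k) * coeff u k"
proof -
  have pvm: "projection_valued_measure M F" and int: "spectral_integral M F (\<lambda>s. s) = diagonal_graph lam"
    using F by (auto simp: spectral_resolution_def)
  have zero: "coeff (F A u) k = 0" if A: "A \<in> sets borel" "lam k \<notin> A" for A
  proof -
    have "L2_inner M (F A (e k)) (e k) = 0"
      using eigenvector_spectral_distribution[OF pvm e_L2 _ A] eigenfunction_in_diagonal_graph by (simp add: int)
    then have "L2_inner M (F A (e k)) (F A (e k)) = 0"
      by (simp add: pvm_inner_self[OF pvm A(1) e_L2])
    then have "L2_inner M (F A (e k)) u = 0"
      by (rule L2_inner_null[OF pvm_L2[OF pvm A(1) e_L2] u])
    then show ?thesis
      using pvm_self_adjoint[OF pvm A(1) e_L2 u, of k] by (simp add: L2_inner_commute)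
  qed
  show ?thesis
  proof (cases "lam k \<in> B")
    case False
    then show ?thesis using zero[OF B] by simp
  next
    case True
    have "coeff u k = coeff (F UNIV u) k"
      using pvm_UNIV[OF pvm B u] by (intro L2_inner_cong_AE u e_L2 pvm_L2[OF pvm]) auto
    also have "F UNIV u = F (B \<union> - B) u" by simp
    also have "coeff (F (B \<union> - B) u) k = coeff (F B u) k + coeff (F (- B) u) k"
      using B by (intro pvm_Un[OF pvm] u e_L2) auto
    also have "coeff (F (- B) u) k = 0"
      using B True by (intro zero) auto
    finally show ?thesis using True by simp
  qed
qed

lemma diagonal_resolution_of_spectral_resolution:
  assumes F: "spectral_resolution M (diagonal_graph lam) F"
  shows "diagonal_resolution F"
  unfolding diagonal_resolution_def
proof (intro ballI)
  fix B :: "real set" and u assume B: "B \<in> sets borel" and u: "u \<in> L2 M"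
  have pvm: "projection_valued_measure M F"
    using F by (simp add: spectral_resolution_def)
  show "L2_inner M (F B u) u = (\<Sum>k. indicator B (lam k) * (coeff u k)\<^sup>2)"
    using sums_unique[OF Parseval[OF pvm_L2[OF pvm B u] u]]
    by (simp add: coeff_spectral_projection[OF F B u] power2_eq_square mult.assoc)
qed

theorem functional_calculus_diagonal:
  assumes "\<phi> \<in> borel_measurable borel"
  shows "functional_calculus M (diagonal_graph lam) \<phi> = diagonal_graph (\<lambda>k. \<phi> (lam k))"
proof -
  have "spectral_resolution M (diagonal_graph lam) (SOME E. spectral_resolution M (diagonal_graph lam) E)"
    by (rule someI[of "spectral_resolution M (diagonal_graph lam)", OF spectral_resolution_eigenprojection])
  from diagonal_resolution_of_spectral_resolution[OF this] show ?thesis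
    unfolding functional_calculus_def by (rule spectral_integral_diagonal[OF _ assms])
qed

end

context ahlfors_regular_space
begin

text \<open>
  Testing the weak equation with eigenfunctions shows that the Laplacian is contained in the diagonal
  operator. Conversely, let \<open>w\<close> have the coordinates \<open>\<lambda>\<^sub>k c\<^sub>k(u)\<close>. The partial sums of the expansion of \<open>u\<close> have
  energies \<open>\<Sum>\<lambda>\<^sub>k c\<^sub>k(u)\<^sup>2\<close>, which are partial sums of the convergent series for \<open>\<langle>w, u\<rangle>\<close>. By lower semicontinuity \<open>u\<close> has finite
  energy and the partial sums converge to \<open>u\<close> in energy, so the weak equation passes to the limit.
\<close>

lemma log_laplacian_diagonal:
  assumes basis: "L2_eigenbasis M e lam" and eD: "\<And>k. e k \<in> form_domain \<delta> M"
    and eigen: "\<And>k g. g \<in> form_domain \<delta> M \<Longrightarrow> energy_form \<delta> M (e k) g = lam k * L2_inner M (e k) g"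
  shows "log_laplacian \<delta> M = L2_eigenbasis.diagonal_graph M e lam"
proof -
  interpret L2_eigenbasis M e lam by fact
  show ?thesis
  proof (intro set_eqI iffI; clarify)
    fix u v assume "(u, v) \<in> log_laplacian \<delta> M"
    then obtain f where v: "v \<in> L2 M" and f: "f \<in> L2 M" and u: "u \<in> form_domain \<delta> M"
      and weak: "\<And>g. g \<in> form_domain \<delta> M \<Longrightarrow> L2_inner M u g + energy_form \<delta> M u g = L2_inner M f g"
      and AE: "AE x in M. v x = f x - u x"
      by (auto simp: log_laplacian_def form_resolvent_def)
    have uL: "u \<in> L2 M" using u by (rule form_domain_L2)
    have "coeff v k = lam k * coeff u k" for k
    proof -
      have "coeff v k = coeff (\<lambda>x. f x - u x) k"
        by (intro L2_inner_cong_AE v L2_diff f uL e_L2 AE) simp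
      also have "\<dots> = coeff f k - coeff u k"
        by (intro L2_inner_diff_left f uL e_L2)
      also have "\<dots> = energy_form \<delta> M u (e k)"
        using weak[OF eD, of k] by simp
      also have "\<dots> = energy_form \<delta> M (e k) u"
        by (rule energy_form_commute)
      also have "\<dots> = lam k * coeff u k"
        unfolding eigen[OF u] by (simp only: L2_inner_commute)
      finally show ?thesis .
    qed
    with uL v show "(u, v) \<in> diagonal_graph lam"
      by (simp add: diagonal_graph_def)
  next
    fix u w assume "(u, w) \<in> diagonal_graph lam"
    then have u: "u \<in> L2 M" and w: "w \<in> L2 M" and c: "\<And>k. coeff w k = lam k * coeff u k"
      by (auto simp: diagonal_graph_def)
    define S where "S n x = (\<Sum>k<n. coeff u k * e k x)" for n :: nat and x
    have SD: "S n \<in> form_domain \<delta> M" for n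
      unfolding S_def by (intro form_domain_sum eD)
    have SL: "S n \<in> L2 M" for n using SD by (rule form_domain_L2)
    have Su: "(\<lambda>n. L2_sqdist M (S n) u) \<longlonglongrightarrow> 0"
      unfolding S_def by (rule expansion[OF u])
    have cS: "coeff (S n) k = (if k < n then coeff u k else 0)" for n k
      unfolding S_def by (simp add: coeff_partial_sum coeff_absorb[OF u])
    have ES: "energy_form \<delta> M (S n) g = (\<Sum>k<n. coeff w k * coeff g k)" if g: "g \<in> form_domain \<delta> M" for n g
    proof -
      have "energy_form \<delta> M (S n) g = (\<Sum>k<n. coeff u k * energy_form \<delta> M (e k) g)"
        unfolding S_def by (intro energy_form_sum_left eD g)
      also have "\<dots> = (\<Sum>k<n. coeff w k * coeff g k)"
        by (intro sum.cong refl) (simp add: eigen[OF g] c L2_inner_commute[of M g] mult.assoc)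
      finally show ?thesis .
    qed
    have tail: "energy_form \<delta> M (\<lambda>x. S (m + n) x - S n x) (\<lambda>x. S (m + n) x - S n x) =
        (\<Sum>k<m + n. coeff w k * coeff u k) - (\<Sum>k<n. coeff w k * coeff u k)" for m n
    proof -
      have D: "(\<lambda>x. S (m + n) x - S n x) \<in> form_domain \<delta> M"
        by (intro form_domain_diff SD)
      have cD: "coeff (\<lambda>x. S (m + n) x - S n x) k = (if n \<le> k \<and> k < m + n then coeff u k else 0)" for k
        by (simp add: L2_inner_diff_left SL e_L2 cS)
      have "energy_form \<delta> M (S j) (\<lambda>x. S (m + n) x - S n x) =
          (\<Sum>k<j. if n \<le> k \<and> k < m + n then coeff w k * coeff u k else 0)" for j
        unfolding ES[OF D] cD by (intro sum.cong) auto
      then have "energy_form \<delta> M (\<lambda>x. S (m + n) x - S n x) (\<lambda>x. S (m + n) x - S n x) =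
          (\<Sum>k<m + n. if n \<le> k \<and> k < m + n then coeff w k * coeff u k else 0) -
          (\<Sum>k<n. if n \<le> k \<and> k < m + n then coeff w k * coeff u k else 0)"
        by (simp add: energy_form_diff_left SD D)
      also have "(\<Sum>k<n. if n \<le> k \<and> k < m + n then coeff w k * coeff u k else 0) = 0"
        by (intro sum.neutral) auto
      also have "(\<Sum>k<m + n. if n \<le> k \<and> k < m + n then coeff w k * coeff u k else 0) =
          (\<Sum>k\<in>{n..<m + n}. coeff w k * coeff u k)"
        by (intro sum.mono_neutral_cong_right) auto
      also have "\<dots> = (\<Sum>k<m + n. coeff w k * coeff u k) - (\<Sum>k<n. coeff w k * coeff u k)"
        using sum_diff_nat_ivl[of 0 n "m + n" "\<lambda>k. coeff w k * coeff u k"] by (simp add: lessThan_atLeast0)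
      finally show ?thesis by simp
    qed
    have wu: "(\<lambda>n. \<Sum>k<n. coeff w k * coeff u k) \<longlonglongrightarrow> L2_inner M w u"
      using Parseval[OF w u] by (simp add: sums_def)
    have res: "(\<lambda>x. u x - S n x) \<in> form_domain \<delta> M"
      "energy_form \<delta> M (\<lambda>x. u x - S n x) (\<lambda>x. u x - S n x) \<le> L2_inner M w u - (\<Sum>k<n. coeff w k * coeff u k)" for n
    proof -
      have 1: "(\<lambda>x. S (m + n) x - S n x) \<in> form_domain \<delta> M" for m
        by (intro form_domain_diff SD)
      have 2: "(\<lambda>x. u x - S n x) \<in> L2 M"
        by (intro L2_diff u SL)
      have 3: "(\<lambda>m. L2_sqdist M (\<lambda>x. S (m + n) x - S n x) (\<lambda>x. u x - S n x)) \<longlonglongrightarrow> 0"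
        using LIMSEQ_ignore_initial_segment[OF Su, of n] by (simp add: L2_sqdist_def)
      have 4: "(\<lambda>m. (\<Sum>k<m + n. coeff w k * coeff u k) - (\<Sum>k<n. coeff w k * coeff u k)) \<longlonglongrightarrow>
          L2_inner M w u - (\<Sum>k<n. coeff w k * coeff u k)"
        by (intro tendsto_diff tendsto_const LIMSEQ_ignore_initial_segment wu)
      note lsc = energy_lower_semicontinuous[of "\<lambda>m x. S (m + n) x - S n x", OF 1 2 3 eq_refl[OF tail] 4]
      show "(\<lambda>x. u x - S n x) \<in> form_domain \<delta> M" by (rule lsc(1))
      show "energy_form \<delta> M (\<lambda>x. u x - S n x) (\<lambda>x. u x - S n x) \<le> L2_inner M w u - (\<Sum>k<n. coeff w k * coeff u k)"
        by (rule lsc(2))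
    qed
    \<comment> \<open>the remainder after no terms is \<open>u\<close> itself\<close>
    have "(\<lambda>x. u x - S 0 x) = u"
      by (simp add: S_def)
    then have uD: "u \<in> form_domain \<delta> M" using res(1)[of 0] by simp
    have weak: "energy_form \<delta> M u g = L2_inner M w g" if g: "g \<in> form_domain \<delta> M" for g
    proof (rule LIMSEQ_unique)
      have gL: "g \<in> L2 M" using g by (rule form_domain_L2)
      show "(\<lambda>n. energy_form \<delta> M (S n) g) \<longlonglongrightarrow> L2_inner M w g"
        using Parseval[OF w gL] by (simp add: ES[OF g] sums_def)
      have "(\<lambda>n. \<bar>energy_form \<delta> M u g - energy_form \<delta> M (S n) g\<bar>) \<longlonglongrightarrow> 0"
      proof (rule tendsto_sandwich[OF always_eventually always_eventually tendsto_const])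
        show "\<forall>n. \<bar>energy_form \<delta> M u g - energy_form \<delta> M (S n) g\<bar> \<le>
            sqrt ((L2_inner M w u - (\<Sum>k<n. coeff w k * coeff u k)) * energy_form \<delta> M g g)"
        proof
          fix n
          have "(energy_form \<delta> M u g - energy_form \<delta> M (S n) g)\<^sup>2 \<le>
              energy_form \<delta> M (\<lambda>x. u x - S n x) (\<lambda>x. u x - S n x) * energy_form \<delta> M g g"
            using energy_form_Cauchy_Schwarz[OF res(1) g, of n] by (simp add: energy_form_diff_left uD SD g)
          also have "\<dots> \<le> (L2_inner M w u - (\<Sum>k<n. coeff w k * coeff u k)) * energy_form \<delta> M g g"
            by (intro mult_right_mono res(2) energy_form_nonneg g)
          finally show "\<bar>energy_form \<delta> M u g - energy_form \<delta> M (S n) g\<bar> \<le>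
              sqrt ((L2_inner M w u - (\<Sum>k<n. coeff w k * coeff u k)) * energy_form \<delta> M g g)"
            by (intro real_le_rsqrt) simp
        qed
        have "(\<lambda>n. sqrt ((L2_inner M w u - (\<Sum>k<n. coeff w k * coeff u k)) * energy_form \<delta> M g g)) \<longlonglongrightarrow>
            sqrt ((L2_inner M w u - L2_inner M w u) * energy_form \<delta> M g g)"
          by (intro tendsto_real_sqrt tendsto_mult tendsto_diff tendsto_const wu)
        then show "(\<lambda>n. sqrt ((L2_inner M w u - (\<Sum>k<n. coeff w k * coeff u k)) * energy_form \<delta> M g g)) \<longlonglongrightarrow> 0"
          by simp
      qed auto
      then have "(\<lambda>n. energy_form \<delta> M u g - energy_form \<delta> M (S n) g) \<longlonglongrightarrow> 0"
        by (simp only: tendsto_rabs_zero_iff)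
      then have "(\<lambda>n. energy_form \<delta> M u g - (energy_form \<delta> M u g - energy_form \<delta> M (S n) g)) \<longlonglongrightarrow> energy_form \<delta> M u g - 0"
        by (intro tendsto_diff tendsto_const)
      then show "(\<lambda>n. energy_form \<delta> M (S n) g) \<longlonglongrightarrow> energy_form \<delta> M u g"
        by simp
    qed
    have fL: "(\<lambda>x. u x + w x) \<in> L2 M" by (intro L2_add u w)
    have "L2_inner M u g + energy_form \<delta> M u g = L2_inner M (\<lambda>x. u x + w x) g" if g: "g \<in> form_domain \<delta> M" for g
      by (simp add: weak[OF g] L2_inner_add_left u w form_domain_L2[OF g])
    then have "((\<lambda>x. u x + w x), u) \<in> form_resolvent \<delta> M"
      by (simp add: form_resolvent_def fL uD)
    then show "(u, w) \<in> log_laplacian \<delta> M"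
      unfolding log_laplacian_def using w by (auto intro!: exI[of _ "\<lambda>x. u x + w x"])
  qed
qed

theorem heat_operator_compact:
  assumes "t > 0"
  shows "compact_operator M (functional_calculus M (log_laplacian \<delta> M) (\<lambda>s. exp (- t * s)))"
proof -
  obtain e :: "nat \<Rightarrow> 'a \<Rightarrow> real" and lam :: "nat \<Rightarrow> real"
  where basis: "L2_eigenbasis M e lam" and eD: "\<And>k. e k \<in> form_domain \<delta> M"
    and eigen: "\<And>k g. g \<in> form_domain \<delta> M \<Longrightarrow> energy_form \<delta> M (e k) g = lam k * L2_inner M (e k) g"
    by (rule eigenbasis_exists) blast
  interpret L2_eigenbasis M e lam by fact
  have "functional_calculus M (log_laplacian \<delta> M) (\<lambda>s. exp (- t * s)) = diagonal_graph (\<lambda>k. exp (- t * lam k))"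
    using log_laplacian_diagonal[of e lam, OF basis eD eigen]
      functional_calculus_diagonal[of "\<lambda>s. exp (- t * s)"] by simp
  moreover have "(\<lambda>k. exp (- t * lam k)) \<longlonglongrightarrow> 0"
  proof -
    have "filterlim (\<lambda>k. t * lam k) at_top sequentially"
      by (rule filterlim_tendsto_pos_mult_at_top[OF tendsto_const assms lam_at_top])
    then have "filterlim (\<lambda>k. - (t * lam k)) at_bot sequentially"
      by (simp add: filterlim_uminus_at_top)
    then have "(\<lambda>k. exp (- (t * lam k))) \<longlonglongrightarrow> 0"
      by (rule filterlim_compose[OF exp_at_bot])
    then show ?thesis by simp
  qed
  ultimately show ?thesis
    by (simp add: diagonal_graph_compact)
qed

end

theorem corollary3p3:
  fixes M :: "'a::{metric_space, second_countable_topology} measure"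
    and \<delta> :: real
  assumes "\<delta> > 0"
    and "metric_measure_space M"
    and "ahlfors_regular \<delta> M"
  shows "\<forall>t>0. compact_operator M (functional_calculus M (log_laplacian \<delta> M) (\<lambda>s. exp (- t * s)))"
proof -
  interpret ahlfors_regular_space \<delta> M
    using assms by unfold_locales
  show ?thesis
    using heat_operator_compact by blast
qed

end
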